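(* Let $\mathcal{A},\mathcal{W},\psi,\mathcal{V}$, the system $f_1=\cdots=f_n=0$, the polynomials $h_1,\dots,h_n$, and $\mathcal{B}=\{(\beta_1,\gamma_1),\dots,(\beta_\ell,\gamma_\ell)\}$ be as described in the context. Consider the two systems $$h_i(x^{v_1},\dots,x^{v_\ell})-x^{w_i}=0,\quad i=1,\dots,n,\qquad(\mathrm{F})$$ $$y^{\beta_j}\cdot h(y)^{\gamma_j}=1,\quad j=1,\dots,\ell.\qquad(\mathrm{G})$$ (1) Suppose that $\mathcal{A}$ spans $\mathbb{Z}^n$ and that $\mathcal{B}$ is a basis for the $\mathbb{Z}$-module of linear relations among $\mathcal{V}\cup\mathcal{W}$. Then the solution set to (F) in $\mathbb{T}^n$ is scheme-theoretically isomorphic to the solution set of the system of rational functions (G) defined in $\mathbb{T}^\ell$ in the complement of the hypersurfaces $h_i(y)=0$, for $i=1,\dots,n$. (2) If the coefficients of the polynomials $f_i$ are real, then so are those of the $h_i(y)$. If (with real coefficients) the span of $\mathcal{A}$ has odd index in $\mathbb{Z}^n$ and the integer span of the exponents $\mathcal{B}$ has odd index in its saturation, then the analytic subscheme defined in $(\mathbb{R}^\times)^n$ by (F) is isomorphic to the analytic subscheme defined by (G) in the complement of the hypersurfaces $h_i(y)=0$ in $(\mathbb{R}^\times)^\ell$. (3) If (with real coefficients) the exponents $\mathcal{A}$ only span a full rank sublattice of $\mathbb{Z}^n$ and the exponents $\mathcal{B}$ only span a full rank sublattice of the module of linear relations among $\mathcal{V}\cup\mathcal{W}$, then the analytic subscheme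 of $\mathbb{R}_{>0}^n$ defined by (F) is isomorphic to the analytic subscheme defined by (G) in the subset of $\mathbb{R}_{>0}^\ell$ defined by $h_i(y)>0$ for $i=1,\dots,n$.
   Context: $\mathbb{T}=\mathbb{C}^\times$, $\mathbb{R}^\times=\mathbb{R}\setminus\{0\}$; $d,\ell,n$ are positive integers; $P=\{p\in\mathbb{Z}^\ell_{\ge0}: p_1+\cdots+p_\ell\le d\}$. $\mathcal{A}=\psi(P)\cup\mathcal{W}\subset\mathbb{Z}^n$ is a $(d,\ell)$-dense set: $\psi:\mathbb{Z}^\ell\to\mathbb{Z}^n$ is affine-linear and $\mathcal{W}=\{w_1,\dots,w_n\}$ consists of $n$ affinely independent vectors. After translating $\mathcal{A}$ by $-\psi(0)$, $\psi$ is assumed linear (so $0\in\mathcal{A}$). $\mathcal{V}=\{v_1,\dots,v_\ell\}$ is the set of images under $\psi$ of the standard basis vectors of $\mathbb{Z}^\ell$. The system of $(d,\ell)$-dense fewnomials is $f_i(x)=\sum_{p\in P}a_{i,p}x^{\psi(p)}+\sum_{k=1}^n a_{i,k}'x^{w_k}$, $i=1,\dots,n$, where the linear forms $\Lambda_i(z)=\sum_k a_{i,k}'z_k$ are assumed linearly independent. Replacing the $f_i$ by suitable linear combinations so that $\Lambda_i(z)=-z_i$ gives the equivalent system (F), where $h_1,\dots,h_n$ are the resulting polynomials of degree $d$ in $y=(y_1,\dots,y_\ell)$, $h_i(y)=\sum_{p\in P}b_{i,p}y^p$. The coefficients of $f_i$ are the numbers $a_{i,p},a'_{i,k}$. A linear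 relation among $\mathcal{V}\cup\mathcal{W}$ is a vector $(\beta,\gamma)=(b_1,\dots,b_\ell,c_1,\dots,c_n)\in\mathbb{Z}^\ell\oplus\mathbb{Z}^n$ with $\sum_m b_mv_m+\sum_i c_iw_i=0$. $\mathcal{B}$ consists of $\ell$ linearly independent such relations $(\beta_j,\gamma_j)$. We write $y^\beta=\prod_m y_m^{b_m}$ and $h(y)^\gamma=\prod_i h_i(y)^{c_i}$. The saturation of a submodule $B\subset\mathbb{Z}^\ell\oplus\mathbb{Z}^n$ is $(B\otimes_{\mathbb{Z}}\mathbb{R})\cap(\mathbb{Z}^\ell\oplus\mathbb{Z}^n)$, the set of integer points in its linear span. *)

theory Defs
  imports
    "HOL-Analysis.Analysis"
    "HOL-Algebra.Algebra"
    "HOL-Algebra.Algebraic_Closure_Type"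
    "HOL-Library.Poly_Mapping"
begin

section \<open>Ringed spaces over a field\<close>

text \<open>
  The sheaf assigns to an open set \<open>W\<close> a ring whose elements are functions on \<open>W\<close> with values
  in the stalks, so that the restriction maps are restrictions of functions.  The structure
  morphism to the ground field \<open>'k\<close> is given by the sections \<open>scalar W c\<close>.
\<close>

record ('p, 's, 'k) ringed_space =
  points :: "'p topology"
  sheaf :: "'p set \<Rightarrow> ('p \<Rightarrow> 's) ring"
  scalar :: "'p set \<Rightarrow> 'k \<Rightarrow> 'p \<Rightarrow> 's"

text \<open>
  An isomorphism over the ground field is a homeomorphism together with an isomorphism of
  sheaves of algebras.  Between locally ringed spaces it is automatically local on stalks.
\<close>

definition isomorphic_spaces ::
  "('p, 's, 'k) ringed_space \<Rightarrow> ('q, 't, 'k) ringed_space \<Rightarrow> bool"  (infix "\<cong>\<^sub>s" 50)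
  where "A \<cong>\<^sub>s B \<longleftrightarrow>
    (\<exists>\<phi> \<Phi>. homeomorphic_map (points A) (points B) \<phi> \<and>
      (\<forall>W. openin (points B) W \<longrightarrow>
        (let pre = (\<lambda>V. {x \<in> topspace (points A). \<phi> x \<in> V}) in
          \<Phi> W \<in> ring_iso (sheaf B W) (sheaf A (pre W)) \<and>
          (\<forall>c. \<Phi> W (scalar B W c) = scalar A (pre W) c) \<and>
          (\<forall>V s. openin (points B) V \<and> V \<subseteq> W \<and> s \<in> carrier (sheaf B W) \<longrightarrow>
            \<Phi> V (restrict s V) = restrict (\<Phi> W s) (pre V)))))"

text \<open>
  The ring of those stalk-valued functions on \<open>W\<close> that locally on \<open>W\<close> agree with a member of
  \<open>loc V\<close>, where \<open>loc V\<close> is a set of functions representing sections over \<open>V\<close>.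
\<close>

definition section_ring ::
  "'p topology \<Rightarrow> ('p \<Rightarrow> 's ring) \<Rightarrow> ('p set \<Rightarrow> ('p \<Rightarrow> 's) set) \<Rightarrow> 'p set \<Rightarrow> ('p \<Rightarrow> 's) ring"
  where "section_ring T St loc W =
    \<lparr>carrier = {s \<in> (\<Pi>\<^sub>E z\<in>W. carrier (St z)).
        \<forall>z\<in>W. \<exists>V t. openin T V \<and> z \<in> V \<and> V \<subseteq> W \<and> t \<in> loc V \<and> (\<forall>x\<in>V. s x = t x)},
     monoid.mult = (\<lambda>s t. \<lambda>z\<in>W. s z \<otimes>\<^bsub>St z\<^esub> t z),
     one = (\<lambda>z\<in>W. \<one>\<^bsub>St z\<^esub>),
     ring.zero = (\<lambda>z\<in>W. \<zero>\<^bsub>St z\<^esub>),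
     add = (\<lambda>s t. \<lambda>z\<in>W. s z \<oplus>\<^bsub>St z\<^esub> t z)\<rparr>"


section \<open>Localization and affine schemes\<close>

text \<open>
  The fraction \<open>a / s\<close> with denominators in the multiplicative set \<open>S\<close>, as an equivalence
  class of pairs.
\<close>

definition frac :: "'a ring \<Rightarrow> 'a set \<Rightarrow> 'a \<Rightarrow> 'a \<Rightarrow> ('a \<times> 'a) set"
  where "frac R S a s =
    {(b, t). b \<in> carrier R \<and> t \<in> S \<and>
      (\<exists>u\<in>S. u \<otimes>\<^bsub>R\<^esub> (t \<otimes>\<^bsub>R\<^esub> a) = u \<otimes>\<^bsub>R\<^esub> (s \<otimes>\<^bsub>R\<^esub> b))}"

text \<open>
  Sums and products are unions over all representatives, as in \<open>rcoset_mult\<close>; all members of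
  the union coincide.
\<close>

definition localization :: "'a ring \<Rightarrow> 'a set \<Rightarrow> ('a \<times> 'a) set ring"
  where "localization R S =
    \<lparr>carrier = {frac R S a s | a s. a \<in> carrier R \<and> s \<in> S},
     monoid.mult = (\<lambda>A B. \<Union>(a, s)\<in>A. \<Union>(b, t)\<in>B. frac R S (a \<otimes>\<^bsub>R\<^esub> b) (s \<otimes>\<^bsub>R\<^esub> t)),
     one = frac R S \<one>\<^bsub>R\<^esub> \<one>\<^bsub>R\<^esub>,
     ring.zero = frac R S \<zero>\<^bsub>R\<^esub> \<one>\<^bsub>R\<^esub>,
     add = (\<lambda>A B. \<Union>(a, s)\<in>A. \<Union>(b, t)\<in>B.
       frac R S ((t \<otimes>\<^bsub>R\<^esub> a) \<oplus>\<^bsub>R\<^esub> (s \<otimes>\<^bsub>R\<^esub> b)) (s \<otimes>\<^bsub>R\<^esub> t))\<rparr>"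

definition zariski :: "'a ring \<Rightarrow> 'a set topology"
  where "zariski R = topology_generated_by {{p. primeideal p R \<and> f \<notin> p} | f. f \<in> carrier R}"

text \<open>\<open>Spec\<close> of the ring \<open>R\<close>, made into an algebra over \<open>'k\<close> by \<open>\<iota>\<close>.\<close>

definition Spec :: "'a ring \<Rightarrow> ('k \<Rightarrow> 'a) \<Rightarrow> ('a set, ('a \<times> 'a) set, 'k) ringed_space"
  where "Spec R \<iota> =
    \<lparr>points = zariski R,
     sheaf = section_ring (zariski R) (\<lambda>p. localization R (carrier R - p))
       (\<lambda>V. {\<lambda>p. frac R (carrier R - p) a s | a s.
          a \<in> carrier R \<and> s \<in> carrier R \<and> (\<forall>p\<in>V. s \<notin> p)}),
     scalar = (\<lambda>W c. \<lambda>p\<in>W. frac R (carrier R - p) (\<iota> c) \<one>\<^bsub>R\<^esub>)\<rparr>"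

text \<open>The closed subscheme of \<open>Spec R\<close> defined by the equations \<open>g = 0\<close> for \<open>g \<in> E\<close>.\<close>

definition closed_subscheme ::
  "'a ring \<Rightarrow> ('k \<Rightarrow> 'a) \<Rightarrow> 'a set \<Rightarrow> ('a set set, ('a set \<times> 'a set) set, 'k) ringed_space"
  where "closed_subscheme R \<iota> E =
    Spec (R Quot (Idl\<^bsub>R\<^esub> E)) (\<lambda>c. (Idl\<^bsub>R\<^esub> E) +>\<^bsub>R\<^esub> \<iota> c)"


section \<open>Real analytic subschemes\<close>

text \<open>For real families \<^const>\<open>has_sum\<close> is absolute convergence.\<close>

definition real_analytic_at :: "(real^'n \<Rightarrow> real) \<Rightarrow> real^'n \<Rightarrow> bool"
  where "real_analytic_at f x \<longleftrightarrow>
    (\<exists>c :: nat^'n \<Rightarrow> real. \<exists>r>0. \<forall>y\<in>ball x r.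
      ((\<lambda>\<alpha>. c \<alpha> * (\<Prod>i\<in>UNIV. (y $ i - x $ i) ^ (\<alpha> $ i))) has_sum f y) UNIV)"

definition real_analytic_on :: "(real^'n \<Rightarrow> real) \<Rightarrow> (real^'n) set \<Rightarrow> bool"
  where "real_analytic_on f U \<longleftrightarrow> (\<forall>x\<in>U. real_analytic_at f x)"

text \<open>
  Members of this ring are total functions rather than germs.  The ideal below contains
  every function vanishing near \<open>z\<close>, so the quotient by it is the local ring of germs at \<open>z\<close>
  modulo the ideal generated by the germs of the \<open>g j\<close>.
\<close>

definition analytic_ring :: "real^'n \<Rightarrow> (real^'n \<Rightarrow> real) ring"
  where "analytic_ring z =
    \<lparr>carrier = {f. real_analytic_at f z},
     monoid.mult = (\<lambda>f g x. f x * g x), one = (\<lambda>x. 1),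
     ring.zero = (\<lambda>x. 0), add = (\<lambda>f g x. f x + g x)\<rparr>"

definition germ_ideal ::
  "('j::finite \<Rightarrow> real^'n \<Rightarrow> real) \<Rightarrow> real^'n \<Rightarrow> (real^'n \<Rightarrow> real) set"
  where "germ_ideal g z =
    {f. real_analytic_at f z \<and>
      (\<exists>V c. open V \<and> z \<in> V \<and> (\<forall>j. real_analytic_on (c j) V) \<and>
        (\<forall>x\<in>V. f x = (\<Sum>j\<in>UNIV. c j x * g j x)))}"

text \<open>
  The zero locus in the open set \<open>U\<close> of the functions \<open>g j\<close> (which are to be analytic on \<open>U\<close>),
  with the restriction to it of the quotient of the sheaf of real analytic functions by the
  ideal sheaf generated by the \<open>g j\<close>.
\<close>

definition analytic_subscheme ::
  "(real^'n) set \<Rightarrow> ('j::finite \<Rightarrow> real^'n \<Rightarrow> real)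
    \<Rightarrow> (real^'n, (real^'n \<Rightarrow> real) set, real) ringed_space"
  where "analytic_subscheme U g =
    (let T = top_of_set {z \<in> U. \<forall>j. g j z = 0};
         cls = (\<lambda>f z. germ_ideal g z +>\<^bsub>analytic_ring z\<^esub> f)
     in \<lparr>points = T,
         sheaf = section_ring T (\<lambda>z. analytic_ring z Quot germ_ideal g z)
           (\<lambda>V. {cls f | f. \<exists>V'. open V' \<and> V \<subseteq> V' \<and> real_analytic_on f V'}),
         scalar = (\<lambda>W c. \<lambda>z\<in>W. cls (\<lambda>x. c) z)\<rparr>)"


section \<open>Lattices\<close>

definition zspan :: "(int^'k) set \<Rightarrow> (int^'k) set"
  where "zspan S = module.span (*s) S"

definition to_real :: "int^'k \<Rightarrow> real^'k"
  where "to_real u = (\<chi> i. real_of_int (u $ i))"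

text \<open>The value is 0 if the index is infinite; in particular an odd index is finite.\<close>

definition lattice_index :: "(int^'k) set \<Rightarrow> (int^'k) set \<Rightarrow> nat"
  where "lattice_index M N = card (M // {(x, y). x \<in> M \<and> y \<in> M \<and> x - y \<in> N})"

definition saturation :: "(int^'k) set \<Rightarrow> (int^'k) set"
  where "saturation S = {u. to_real u \<in> span (to_real ` S)}"

definition lattice_rank :: "(int^'k) set \<Rightarrow> nat"
  where "lattice_rank S = dim (to_real ` S)"

definition full_rank_sublattice :: "(int^'k) set \<Rightarrow> (int^'k) set \<Rightarrow> bool"
  where "full_rank_sublattice N M \<longleftrightarrow> N \<subseteq> M \<and> lattice_rank N = lattice_rank M"


section \<open>Dense fewnomials\<close>

definition simplex_points :: "nat \<Rightarrow> (int^'l) set"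
  where "simplex_points d = {p. (\<forall>m. 0 \<le> p $ m) \<and> (\<Sum>m\<in>UNIV. p $ m) \<le> int d}"

text \<open>
  The lattice \<open>\<int>\<^sup>\<ell> \<oplus> \<int>\<^sup>n\<close> is \<^typ>\<open>int^('l + 'n)\<close>: the vector \<open>r\<close> is the pair \<open>(\<beta>, \<gamma>)\<close> with
  \<open>\<beta> m = r $ Inl m\<close> and \<open>\<gamma> i = r $ Inr i\<close>.
\<close>

definition linear_relations ::
  "('l \<Rightarrow> int^'n) \<Rightarrow> ('n \<Rightarrow> int^'n) \<Rightarrow> (int^('l::finite + 'n::finite)) set"
  where "linear_relations v w =
    {r. (\<Sum>m\<in>UNIV. r $ Inl m *s v m) + (\<Sum>i\<in>UNIV. r $ Inr i *s w i) = 0}"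

text \<open>
  The coefficients of the \<open>h i\<close>, obtained from the coefficients \<open>a\<close>, \<open>a'\<close> of the system
  \<open>f i = (\<Sum>p. a i p x^\<psi>(p)) + (\<Sum>k. a' $ i $ k x^(w k))\<close> by multiplying the column of the \<open>f i\<close>
  by minus the inverse of the matrix \<open>a'\<close>.  This turns the linear forms \<open>a' *v z\<close> into \<open>- z\<close>.
\<close>

definition reduced_coeff ::
  "('n::finite \<Rightarrow> int^'l \<Rightarrow> complex) \<Rightarrow> complex^'n^'n \<Rightarrow> 'n \<Rightarrow> int^'l \<Rightarrow> complex"
  where "reduced_coeff a a' i p = - (\<Sum>j\<in>UNIV. matrix_inv a' $ i $ j * a j p)"

text \<open>
  Value at \<open>y\<close>, in an algebra with structure map \<open>\<iota>\<close>, of the polynomial of degree \<open>d\<close> with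
  coefficients \<open>c\<close>.
\<close>

definition poly_value ::
  "nat \<Rightarrow> ('c \<Rightarrow> 'r::comm_ring_1) \<Rightarrow> (int^'l \<Rightarrow> 'c) \<Rightarrow> ('l::finite \<Rightarrow> 'r) \<Rightarrow> 'r"
  where "poly_value d \<iota> c y =
    (\<Sum>p\<in>simplex_points d. \<iota> (c p) * (\<Prod>m\<in>UNIV. y m ^ nat (p $ m)))"


subsection \<open>The two schemes over the complex numbers\<close>

text \<open>
  The coordinate ring of the torus is the monoid algebra of the character lattice
  \<^typ>\<open>int^'n\<close>, and \<open>chi u\<close> is the Laurent monomial \<open>x^u\<close>.
\<close>

type_synonym 'n laurent = "int^'n \<Rightarrow>\<^sub>0 complex"

abbreviation laurent_ring :: "'n::finite laurent ring"
  where "laurent_ring \<equiv> ring_of_type_algebra"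

definition const :: "complex \<Rightarrow> 'n::finite laurent"
  where "const c = Poly_Mapping.single 0 c"

definition chi :: "int^'n \<Rightarrow> 'n::finite laurent"
  where "chi u = Poly_Mapping.single u 1"

definition F_laurent ::
  "nat \<Rightarrow> ('n \<Rightarrow> int^'l \<Rightarrow> complex) \<Rightarrow> ('l::finite \<Rightarrow> int^'n) \<Rightarrow> ('n \<Rightarrow> int^'n)
    \<Rightarrow> 'n::finite \<Rightarrow> 'n laurent"
  where "F_laurent d b v w i = poly_value d const (b i) (\<lambda>m. chi (v m)) - chi (w i)"

definition F_scheme ::
  "nat \<Rightarrow> ('n \<Rightarrow> int^'l \<Rightarrow> complex) \<Rightarrow> ('l::finite \<Rightarrow> int^'n) \<Rightarrow> ('n::finite \<Rightarrow> int^'n)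
    \<Rightarrow> ('n laurent set set, ('n laurent set \<times> 'n laurent set) set, complex) ringed_space"
  where "F_scheme d b v w = closed_subscheme laurent_ring const (range (F_laurent d b v w))"

definition h_laurent :: "nat \<Rightarrow> (int^'l \<Rightarrow> complex) \<Rightarrow> 'l::finite laurent"
  where "h_laurent d c = poly_value d const c (\<lambda>m. chi (axis m 1))"

text \<open>
  The complement of the hypersurfaces \<open>h i = 0\<close> in the torus is the spectrum of the
  localization at the products of powers of the \<open>h i\<close>.  In that ring the \<open>y m\<close> and the \<open>h i\<close>
  are units, so the integer powers below make sense.
\<close>

definition h_powers :: "nat \<Rightarrow> ('n::finite \<Rightarrow> int^'l \<Rightarrow> complex) \<Rightarrow> 'l::finite laurent set"
  where "h_powers d b = {\<Prod>i\<in>UNIV. h_laurent d (b i) ^ e i | e :: 'n \<Rightarrow> nat. True}"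

definition complement_ring ::
  "nat \<Rightarrow> ('n::finite \<Rightarrow> int^'l \<Rightarrow> complex) \<Rightarrow> ('l::finite laurent \<times> 'l laurent) set ring"
  where "complement_ring d b = localization laurent_ring (h_powers d b)"

definition to_complement_ring ::
  "nat \<Rightarrow> ('n::finite \<Rightarrow> int^'l \<Rightarrow> complex) \<Rightarrow> 'l::finite laurent
    \<Rightarrow> ('l laurent \<times> 'l laurent) set"
  where "to_complement_ring d b f = frac laurent_ring (h_powers d b) f 1"

definition G_rational ::
  "nat \<Rightarrow> ('n::finite \<Rightarrow> int^'l \<Rightarrow> complex) \<Rightarrow> int^('l + 'n)
    \<Rightarrow> ('l::finite laurent \<times> 'l laurent) set"
  where "G_rational d b r =
    (let R = complement_ring d b;
         y = (\<lambda>m. to_complement_ring d b (chi (axis m 1)));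
         h = (\<lambda>i. to_complement_ring d b (h_laurent d (b i)))
     in (\<Otimes>\<^bsub>R\<^esub>m\<in>UNIV. y m [^]\<^bsub>R\<^esub> (r $ Inl m)) \<otimes>\<^bsub>R\<^esub> (\<Otimes>\<^bsub>R\<^esub>i\<in>UNIV. h i [^]\<^bsub>R\<^esub> (r $ Inr i))
          \<ominus>\<^bsub>R\<^esub> \<one>\<^bsub>R\<^esub>)"

definition G_scheme ::
  "nat \<Rightarrow> ('n::finite \<Rightarrow> int^'l \<Rightarrow> complex) \<Rightarrow> ('l \<Rightarrow> int^('l + 'n))
    \<Rightarrow> (('l::finite laurent \<times> 'l laurent) set set set,
        (('l laurent \<times> 'l laurent) set set \<times> ('l laurent \<times> 'l laurent) set set) set,
        complex) ringed_space"
  where "G_scheme d b \<rho> =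
    closed_subscheme (complement_ring d b) (\<lambda>c. to_complement_ring d b (const c))
      (range (\<lambda>j. G_rational d b (\<rho> j)))"


subsection \<open>The two systems over the real numbers\<close>

definition monomial :: "real^'n \<Rightarrow> int^'n \<Rightarrow> real"
  where "monomial x u = (\<Prod>i\<in>UNIV. x $ i powi (u $ i))"

definition h_real :: "nat \<Rightarrow> (int^'l \<Rightarrow> real) \<Rightarrow> real^'l \<Rightarrow> real"
  where "h_real d c y = poly_value d (\<lambda>t. t) c (\<lambda>m. y $ m)"

definition F_real ::
  "nat \<Rightarrow> ('n \<Rightarrow> int^'l \<Rightarrow> real) \<Rightarrow> ('l \<Rightarrow> int^'n) \<Rightarrow> ('n \<Rightarrow> int^'n) \<Rightarrow> 'n::finite \<Rightarrow> real^'n \<Rightarrow> real"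
  where "F_real d b v w i x = h_real d (b i) (\<chi> m. monomial x (v m)) - monomial x (w i)"

definition G_real ::
  "nat \<Rightarrow> ('n::finite \<Rightarrow> int^'l \<Rightarrow> real) \<Rightarrow> int^('l::finite + 'n) \<Rightarrow> real^'l \<Rightarrow> real"
  where "G_real d b r y =
    (\<Prod>m\<in>UNIV. y $ m powi (r $ Inl m)) * (\<Prod>i\<in>UNIV. h_real d (b i) y powi (r $ Inr i)) - 1"

end

theory Submission
  imports Defs
begin

text \<open>
  Part (1).  Substituting \<open>x\<^bsup>v m\<^esup>\<close> for \<open>y m\<close> turns \<open>h i\<close> into \<open>x\<^bsup>w i\<^esup>\<close> modulo (F), hence
  \<open>y\<^bsup>\<beta>\<^esup> h(y)\<^bsup>\<gamma>\<^esup>\<close> into the monomial with exponent \<open>\<Sum>\<beta> v + \<Sum>\<gamma> w\<close>; this kills (G).  Conversely a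
  monomial \<open>x\<^bsup>u\<^esup>\<close> is sent to \<open>y\<^bsup>\<beta>\<^esup> h(y)\<^bsup>\<gamma>\<^esup>\<close> for any representation \<open>u = \<Sum>\<beta> v + \<Sum>\<gamma> w\<close>.  Two
  representations differ by a linear relation, so the choice does not matter modulo (G).  The two
  ring homomorphisms are inverse to each other.

  Parts (2) and (3).  Only multiples \<open>N e\<^sub>k\<close> of the basis vectors can be represented now, and only
  multiples \<open>M r\<close> of the relations \<open>r\<close> follow from \<open>\<B>\<close>.  The inverse is defined with real \<open>N\<close>-th
  roots, which are unique and analytic if \<open>N\<close> is odd or the variables are positive.  On stalks,
  \<open>f\<^bsup>M\<^esup> = 1\<close> modulo the ideal implies \<open>f = 1\<close> modulo the ideal as soon as \<open>f\<close> has value \<open>1\<close>, because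
  the cofactor of \<open>f - 1\<close> in \<open>f\<^bsup>M\<^esup> - 1\<close> is a unit.  That the two analytic maps induce inverse maps
  on stalks, although they are inverse to each other only modulo the ideals, follows from
  Hadamard's lemma: \<open>f \<circ> G - f \<circ> H\<close> lies in the ideal generated by the \<open>G\<^sub>i - H\<^sub>i\<close>.
\<close>

text \<open>The inverse map involves roots, and Hadamard's lemma requires summing infinitely many
  cofactors into one analytic function, so the real parts need power series with quantitative
  control. All estimates use a single norm, the weighted sum of the absolute Taylor coefficients on
  a cube (\<open>majorized\<close>). It is submultiplicative and complete; products, substitution,
  re-expansion at nearby points, the binomial series and the cofactors follow from one interchange
  of sums.

  The lattice hypotheses speak of real spans, ranks and indices, whereas exponents must be integers.
  A rational-valued functional turns real dependences into integer ones, and the index of a subgroup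
  annihilates the quotient, so odd indices yield odd \<open>N\<close> and \<open>M\<close>. In the
  positive case any positive multiples will do, and \<open>M\<close> may vary with the relation.

  The complex isomorphism is assembled from the universal properties of the group ring, of
  localization and of the quotient.\<close>

no_notation fps_nth (infixl "$" 75)

section \<open>Isomorphisms of ringed spaces\<close>

lemma homeomorphic_map_preimage:
  assumes "homeomorphic_map T T' \<phi>" "openin T' W"
  shows "openin T {x \<in> topspace T. \<phi> x \<in> W}" "\<phi> ` {x \<in> topspace T. \<phi> x \<in> W} = W"
proof -
  show "openin T {x \<in> topspace T. \<phi> x \<in> W}"
    using assms homeomorphic_imp_continuous_map openin_continuous_map_preimage by blast
  show "\<phi> ` {x \<in> topspace T. \<phi> x \<in> W} = W"
    using homeomorphic_imp_surjective_map[OF assms(1)] openin_subset[OF assms(2)] by auto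
qed

lemma section_ring_simps [simp]:
  "carrier (section_ring T St loc W) = {s \<in> (\<Pi>\<^sub>E z\<in>W. carrier (St z)).
        \<forall>z\<in>W. \<exists>V t. openin T V \<and> z \<in> V \<and> V \<subseteq> W \<and> t \<in> loc V \<and> (\<forall>x\<in>V. s x = t x)}"
  "s \<otimes>\<^bsub>section_ring T St loc W\<^esub> t = (\<lambda>z\<in>W. s z \<otimes>\<^bsub>St z\<^esub> t z)"
  "\<one>\<^bsub>section_ring T St loc W\<^esub> = (\<lambda>z\<in>W. \<one>\<^bsub>St z\<^esub>)"
  "s \<oplus>\<^bsub>section_ring T St loc W\<^esub> t = (\<lambda>z\<in>W. s z \<oplus>\<^bsub>St z\<^esub> t z)"
  by (auto simp: section_ring_def)

text \<open>Sections are stalk-valued functions, so a comorphism can be prescribed stalk by stalk: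
  \<open>pb z\<close> acts on the value at \<open>\<phi> z\<close>. Bijectivity of the
  \<open>pb z\<close> gives injectivity on sections; the conditions on \<open>loc\<close> and
  \<open>loc'\<close> carry local representability in both directions, the second one being what
  surjectivity needs.\<close>

lemma isomorphic_spacesI:
  assumes homeo: "homeomorphic_map T T' \<phi>"
    and stalk: "\<And>z. z \<in> topspace T \<Longrightarrow> pb z \<in> ring_iso (St' (\<phi> z)) (St z)"
    and loc: "\<And>V t. \<lbrakk>openin T' V; t \<in> loc' V\<rbrakk> \<Longrightarrow>
      \<exists>u \<in> loc {x \<in> topspace T. \<phi> x \<in> V}. \<forall>x\<in>topspace T. \<phi> x \<in> V \<longrightarrow> pb x (t (\<phi> x)) = u x"
    and loc': "\<And>V u. \<lbrakk>openin T V; u \<in> loc V\<rbrakk> \<Longrightarrow>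
      \<exists>t \<in> loc' (\<phi> ` V). \<forall>x\<in>V. t (\<phi> x) \<in> carrier (St' (\<phi> x)) \<and> pb x (t (\<phi> x)) = u x"
    and scalar: "\<And>z c. z \<in> topspace T \<Longrightarrow> pb z (k' c (\<phi> z)) = k c z"
  shows "\<lparr>points = T, sheaf = section_ring T St loc, scalar = (\<lambda>W c. \<lambda>z\<in>W. k c z)\<rparr> \<cong>\<^sub>s
    \<lparr>points = T', sheaf = section_ring T' St' loc', scalar = (\<lambda>W c. \<lambda>z\<in>W. k' c z)\<rparr>"
proof -
  let ?pre = "\<lambda>V. {x \<in> topspace T. \<phi> x \<in> V}"
  define \<Phi> where "\<Phi> W s = (\<lambda>z\<in>?pre W. pb z (s (\<phi> z)))" for W s
  have inj: "inj_on \<phi> (topspace T)"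
    using homeo by (rule homeomorphic_imp_injective_map)
  have hom: "pb z \<in> ring_hom (St' (\<phi> z)) (St z)" and
    bij: "bij_betw (pb z) (carrier (St' (\<phi> z))) (carrier (St z))" if "z \<in> topspace T" for z
    using stalk[OF that] by (auto simp: ring_iso_def)
  have iso: "\<Phi> W \<in> ring_iso (section_ring T' St' loc' W) (section_ring T St loc (?pre W))"
    (is "_ \<in> ring_iso ?B ?A") if W: "openin T' W" for W
  proof -
    have lift: "\<exists>z\<in>?pre W. y = \<phi> z" if "y \<in> W" for y
      using homeomorphic_map_preimage(2)[OF homeo W] that by blast
    have maps: "\<Phi> W s \<in> carrier ?A" if s: "s \<in> carrier ?B" for s
    proof -
      have "pb z (s (\<phi> z)) \<in> carrier (St z)" if "z \<in> ?pre W" for z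
        using s that hom[of z] by (auto simp: PiE_def ring_hom_def)
      moreover have "\<exists>V t. openin T V \<and> z \<in> V \<and> V \<subseteq> ?pre W \<and> t \<in> loc V \<and> (\<forall>x\<in>V. \<Phi> W s x = t x)"
        if z: "z \<in> ?pre W" for z
      proof -
        obtain V t where V: "openin T' V" "\<phi> z \<in> V" "V \<subseteq> W" "t \<in> loc' V" "\<forall>x\<in>V. s x = t x"
          using s z by auto
        obtain u where "u \<in> loc (?pre V)" "\<forall>x\<in>topspace T. \<phi> x \<in> V \<longrightarrow> pb x (t (\<phi> x)) = u x"
          using loc[OF V(1,4)] by auto
        with V z show ?thesis
          by (intro exI[of _ "?pre V"] exI[of _ u])
            (auto simp: \<Phi>_def homeomorphic_map_preimage[OF homeo])
      qed
      ultimately show ?thesis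
        by (auto simp: \<Phi>_def)
    qed
    have "\<Phi> W \<in> ring_hom ?B ?A"
    proof (rule ring_hom_memI)
      fix s t assume st: "s \<in> carrier ?B" "t \<in> carrier ?B"
      have "s (\<phi> z) \<in> carrier (St' (\<phi> z))" "t (\<phi> z) \<in> carrier (St' (\<phi> z))" if "z \<in> ?pre W" for z
        using st that by auto
      then show "\<Phi> W (s \<otimes>\<^bsub>?B\<^esub> t) = \<Phi> W s \<otimes>\<^bsub>?A\<^esub> \<Phi> W t" "\<Phi> W (s \<oplus>\<^bsub>?B\<^esub> t) = \<Phi> W s \<oplus>\<^bsub>?A\<^esub> \<Phi> W t"
        using hom by (auto simp: \<Phi>_def fun_eq_iff restrict_def ring_hom_mult ring_hom_add)
    next
      show "\<Phi> W \<one>\<^bsub>?B\<^esub> = \<one>\<^bsub>?A\<^esub>"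
        using hom by (auto simp: \<Phi>_def fun_eq_iff restrict_def ring_hom_one)
    qed (rule maps)
    moreover have "inj_on (\<Phi> W) (carrier ?B)"
    proof (rule inj_onI)
      fix s t assume st: "s \<in> carrier ?B" "t \<in> carrier ?B" and eq: "\<Phi> W s = \<Phi> W t"
      show "s = t"
      proof (rule extensionalityI[of _ W])
        fix y assume "y \<in> W"
        then obtain z where z: "z \<in> ?pre W" "y = \<phi> z"
          using lift by blast
        then have "pb z (s y) = pb z (t y)"
          using fun_cong[OF eq, of z] by (simp add: \<Phi>_def)
        moreover have "s y \<in> carrier (St' (\<phi> z))" "t y \<in> carrier (St' (\<phi> z))"
          using st z by auto
        ultimately show "s y = t y"
          using bij[of z] z by (auto simp: bij_betw_def inj_on_def)
      qed (use st in \<open>auto simp: PiE_def\<close>)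
    qed
    moreover have "carrier ?A \<subseteq> \<Phi> W ` carrier ?B"
    proof
      fix u assume u: "u \<in> carrier ?A"
      define q where "q = inv_into (topspace T) \<phi>"
      have q: "q (\<phi> z) = z" if "z \<in> topspace T" for z
        using inj that by (simp add: q_def)
      \<comment> \<open>The only candidate for a preimage inverts the stalk maps pointwise. It is
        locally representable because injectivity of \<open>pb\<close> forces it to agree with the
        section \<open>t\<close> supplied by \<open>loc'\<close>.\<close>
      define s where "s = (\<lambda>y\<in>W. inv_into (carrier (St' y)) (pb (q y)) (u (q y)))"
      have ps: "s (\<phi> z) \<in> carrier (St' (\<phi> z))" "pb z (s (\<phi> z)) = u z" if "z \<in> ?pre W" for z
      proof -
        have "u z \<in> pb z ` carrier (St' (\<phi> z))"
          using u that bij[of z] by (auto simp: bij_betw_def)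
        with that show "s (\<phi> z) \<in> carrier (St' (\<phi> z))" "pb z (s (\<phi> z)) = u z"
          by (auto simp: s_def q intro: inv_into_into f_inv_into_f)
      qed
      have "s \<in> (\<Pi>\<^sub>E y\<in>W. carrier (St' y))"
      proof (rule PiE_I)
        fix y assume "y \<in> W"
        then obtain z where "z \<in> ?pre W" "y = \<phi> z"
          using lift by blast
        then show "s y \<in> carrier (St' y)"
          using ps by auto
      qed (simp add: s_def)
      moreover have "\<exists>V t. openin T' V \<and> y \<in> V \<and> V \<subseteq> W \<and> t \<in> loc' V \<and> (\<forall>x\<in>V. s x = t x)"
        if y: "y \<in> W" for y
      proof -
        obtain z where z: "z \<in> ?pre W" "y = \<phi> z"
          using y lift by blast
        obtain V r where V: "openin T V" "z \<in> V" "V \<subseteq> ?pre W" "r \<in> loc V" "\<forall>x\<in>V. u x = r x"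
          using u z by auto
        obtain t where t: "t \<in> loc' (\<phi> ` V)"
          "\<forall>x\<in>V. t (\<phi> x) \<in> carrier (St' (\<phi> x)) \<and> pb x (t (\<phi> x)) = r x"
          using loc'[OF V(1,4)] by auto
        have "s (\<phi> x) = t (\<phi> x)" if "x \<in> V" for x
        proof -
          have x: "x \<in> ?pre W"
            using that V by auto
          have "pb x (s (\<phi> x)) = pb x (t (\<phi> x))"
            using ps(2)[OF x] t(2) V(5) that by auto
          then show ?thesis
            using ps(1)[OF x] t(2) that bij[of x] x by (auto simp: bij_betw_def inj_on_def)
        qed
        moreover have "openin T' (\<phi> ` V)"
          using homeomorphic_map_openness_eq[OF homeo, of V] V(1) by blast
        ultimately show ?thesis
          using V z t by (intro exI[of _ "\<phi> ` V"] exI[of _ t]) auto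
      qed
      ultimately have "s \<in> carrier ?B"
        by simp
      moreover have "\<Phi> W s = u"
        using u ps(2) by (auto simp: \<Phi>_def fun_eq_iff restrict_def PiE_def extensional_def)
      ultimately show "u \<in> \<Phi> W ` carrier ?B"
        by blast
    qed
    ultimately show ?thesis
      unfolding ring_iso_def bij_betw_def using maps by blast
  qed
  have restrict: "\<Phi> V (restrict s V) = restrict (\<Phi> W s) (?pre V)" if "V \<subseteq> W" for V W s
    using that by (auto simp: \<Phi>_def fun_eq_iff restrict_def)
  have sc: "\<Phi> W (\<lambda>z\<in>W. k' c z) = (\<lambda>z\<in>?pre W. k c z)" for W c
    using scalar by (auto simp: \<Phi>_def fun_eq_iff restrict_def)
  show ?thesis
    unfolding isomorphic_spaces_def Let_def
    using homeo iso restrict sc by (intro exI[of _ \<phi>] exI[of _ \<Phi>]) simp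
qed

section \<open>Transport of localizations and spectra along ring isomorphisms\<close>

lemma frac_image:
  assumes R: "ring R" and \<sigma>: "\<sigma> \<in> ring_iso R R'" and S: "S \<subseteq> carrier R"
    and a: "a \<in> carrier R" and s: "s \<in> carrier R"
  shows "map_prod \<sigma> \<sigma> ` frac R S a s = frac R' (\<sigma> ` S) (\<sigma> a) (\<sigma> s)"
proof -
  interpret ring R by fact
  have mult: "\<sigma> (x \<otimes>\<^bsub>R\<^esub> y) = \<sigma> x \<otimes>\<^bsub>R'\<^esub> \<sigma> y" if "x \<in> carrier R" "y \<in> carrier R" for x y
    using \<sigma> that by (rule ring_iso_memE(2))
  have inj: "\<sigma> x = \<sigma> y \<longleftrightarrow> x = y" if "x \<in> carrier R" "y \<in> carrier R" for x y
    using ring_iso_memE(5)[OF \<sigma>] that by (auto simp: bij_betw_def inj_on_def)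
  have surj: "\<sigma> ` carrier R = carrier R'"
    using ring_iso_memE(5)[OF \<sigma>] by (simp add: bij_betw_def)
  have eq: "\<sigma> u \<otimes>\<^bsub>R'\<^esub> (\<sigma> t \<otimes>\<^bsub>R'\<^esub> \<sigma> a) = \<sigma> u \<otimes>\<^bsub>R'\<^esub> (\<sigma> s \<otimes>\<^bsub>R'\<^esub> \<sigma> b) \<longleftrightarrow>
      u \<otimes>\<^bsub>R\<^esub> (t \<otimes>\<^bsub>R\<^esub> a) = u \<otimes>\<^bsub>R\<^esub> (s \<otimes>\<^bsub>R\<^esub> b)"
    if "u \<in> S" "t \<in> S" "b \<in> carrier R" for u t b
  proof -
    have "u \<in> carrier R" "t \<in> carrier R"
      using that S by auto
    then show ?thesis
      using that a s by (simp flip: mult add: inj)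
  qed
  show ?thesis
    unfolding frac_def
  proof (intro equalityI subsetI)
    fix x assume "x \<in> map_prod \<sigma> \<sigma> ` {(b, t). b \<in> carrier R \<and> t \<in> S \<and>
      (\<exists>u\<in>S. u \<otimes>\<^bsub>R\<^esub> (t \<otimes>\<^bsub>R\<^esub> a) = u \<otimes>\<^bsub>R\<^esub> (s \<otimes>\<^bsub>R\<^esub> b))}"
    then obtain b t u where x: "x = (\<sigma> b, \<sigma> t)" and b: "b \<in> carrier R" and t: "t \<in> S" and u: "u \<in> S"
      and "u \<otimes>\<^bsub>R\<^esub> (t \<otimes>\<^bsub>R\<^esub> a) = u \<otimes>\<^bsub>R\<^esub> (s \<otimes>\<^bsub>R\<^esub> b)"
      by auto
    then have "\<sigma> u \<otimes>\<^bsub>R'\<^esub> (\<sigma> t \<otimes>\<^bsub>R'\<^esub> \<sigma> a) = \<sigma> u \<otimes>\<^bsub>R'\<^esub> (\<sigma> s \<otimes>\<^bsub>R'\<^esub> \<sigma> b)"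
      using eq by blast
    then show "x \<in> {(b, t). b \<in> carrier R' \<and> t \<in> \<sigma> ` S \<and>
      (\<exists>u\<in>\<sigma> ` S. u \<otimes>\<^bsub>R'\<^esub> (t \<otimes>\<^bsub>R'\<^esub> \<sigma> a) = u \<otimes>\<^bsub>R'\<^esub> (\<sigma> s \<otimes>\<^bsub>R'\<^esub> b))}"
      unfolding x using b t u surj by blast
  next
    fix x assume "x \<in> {(b, t). b \<in> carrier R' \<and> t \<in> \<sigma> ` S \<and>
      (\<exists>u\<in>\<sigma> ` S. u \<otimes>\<^bsub>R'\<^esub> (t \<otimes>\<^bsub>R'\<^esub> \<sigma> a) = u \<otimes>\<^bsub>R'\<^esub> (\<sigma> s \<otimes>\<^bsub>R'\<^esub> b))}"
    then obtain b t u where x: "x = (\<sigma> b, \<sigma> t)" and b: "b \<in> carrier R" and t: "t \<in> S" and u: "u \<in> S"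
      and "\<sigma> u \<otimes>\<^bsub>R'\<^esub> (\<sigma> t \<otimes>\<^bsub>R'\<^esub> \<sigma> a) = \<sigma> u \<otimes>\<^bsub>R'\<^esub> (\<sigma> s \<otimes>\<^bsub>R'\<^esub> \<sigma> b)"
      unfolding surj[symmetric] by blast
    then have "u \<otimes>\<^bsub>R\<^esub> (t \<otimes>\<^bsub>R\<^esub> a) = u \<otimes>\<^bsub>R\<^esub> (s \<otimes>\<^bsub>R\<^esub> b)"
      using eq by blast
    then show "x \<in> map_prod \<sigma> \<sigma> ` {(b, t). b \<in> carrier R \<and> t \<in> S \<and>
      (\<exists>u\<in>S. u \<otimes>\<^bsub>R\<^esub> (t \<otimes>\<^bsub>R\<^esub> a) = u \<otimes>\<^bsub>R\<^esub> (s \<otimes>\<^bsub>R\<^esub> b))}"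
      unfolding x using b t u by (intro image_eqI[of _ _ "(b, t)"]) auto
  qed
qed

lemma frac_subset: "frac R S a s \<subseteq> carrier R \<times> S"
  by (auto simp: frac_def)

lemma carrier_localization: "carrier (localization R S) = (\<lambda>(a, s). frac R S a s) ` (carrier R \<times> S)"
  by (auto simp: localization_def)

text \<open>Operations in \<open>localization\<close> are unions over all representatives, and
  direct images commute with unions. Hence they are transported representative by representative,
  without any question of well-definedness.\<close>

lemma localization_ring_iso:
  assumes R: "ring R" and \<sigma>: "\<sigma> \<in> ring_iso R R'" and S: "S \<subseteq> carrier R"
  shows "(`) (map_prod \<sigma> \<sigma>) \<in> ring_iso (localization R S) (localization R' (\<sigma> ` S))"
proof -
  interpret ring R by fact
  let ?m = "map_prod \<sigma> \<sigma>"
  note hom = ring_iso_memE[OF \<sigma>]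
  have inj: "inj_on \<sigma> (carrier R)" and surj: "\<sigma> ` carrier R = carrier R'"
    using hom(5) by (auto simp: bij_betw_def)
  have image: "?m ` frac R S a s = frac R' (\<sigma> ` S) (\<sigma> a) (\<sigma> s)" if "a \<in> carrier R" "s \<in> carrier R" for a s
    by (rule frac_image[OF R \<sigma> S that])
  then have image': "?m ` frac R S a s = frac R' (\<sigma> ` S) (\<sigma> a) (\<sigma> s)" if "a \<in> carrier R" "s \<in> S" for a s
    using that S by blast
  have sub: "A \<subseteq> carrier R \<times> S" if "A \<in> carrier (localization R S)" for A
    using that frac_subset[of R S] by (auto simp: localization_def)
  \<comment> \<open>\<open>p\<close> and \<open>p'\<close> stand for the numerator of a product or
    of a sum, so that one argument serves both operations.\<close>
  have op: "?m ` (\<Union>(a, s)\<in>A. \<Union>(b, t)\<in>B. frac R S (p a s b t) (s \<otimes>\<^bsub>R\<^esub> t)) =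
      (\<Union>(a, s)\<in>?m ` A. \<Union>(b, t)\<in>?m ` B. frac R' (\<sigma> ` S) (p' a s b t) (s \<otimes>\<^bsub>R'\<^esub> t))"
    if "A \<subseteq> carrier R \<times> S" "B \<subseteq> carrier R \<times> S"
      and p: "\<And>a s b t. \<lbrakk>a \<in> carrier R; s \<in> carrier R; b \<in> carrier R; t \<in> carrier R\<rbrakk> \<Longrightarrow>
        p a s b t \<in> carrier R \<and> \<sigma> (p a s b t) = p' (\<sigma> a) (\<sigma> s) (\<sigma> b) (\<sigma> t)" for A B p p'
  proof -
    have eq: "?m ` frac R S (p (fst q) (snd q) (fst r) (snd r)) (snd q \<otimes>\<^bsub>R\<^esub> snd r) =
        frac R' (\<sigma> ` S) (p' (\<sigma> (fst q)) (\<sigma> (snd q)) (\<sigma> (fst r)) (\<sigma> (snd r))) (\<sigma> (snd q) \<otimes>\<^bsub>R'\<^esub> \<sigma> (snd r))"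
      if "q \<in> A" "r \<in> B" for q r
    proof -
      have c: "fst q \<in> carrier R" "snd q \<in> carrier R" "fst r \<in> carrier R" "snd r \<in> carrier R"
        using that S \<open>A \<subseteq> _\<close> \<open>B \<subseteq> _\<close> by (cases q; cases r; auto)+
      then show ?thesis
        using p[OF c] hom(2)[of "snd q" "snd r"] by (simp add: image)
    qed
    show ?thesis
      by (simp add: split_beta image_UN eq cong: SUP_cong_simp)
  qed
  show ?thesis
  proof (rule ring_iso_memI)
    fix A assume "A \<in> carrier (localization R S)"
    then obtain a s where "A = frac R S a s" "a \<in> carrier R" "s \<in> S"
      unfolding localization_def by auto
    then have "?m ` A = frac R' (\<sigma> ` S) (\<sigma> a) (\<sigma> s)" "\<sigma> a \<in> carrier R'" "\<sigma> s \<in> \<sigma> ` S"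
      using S hom(1) by (simp_all add: image subsetD)
    then show "?m ` A \<in> carrier (localization R' (\<sigma> ` S))"
      unfolding localization_def by auto
  next
    fix A B assume "A \<in> carrier (localization R S)" "B \<in> carrier (localization R S)"
    then have AB: "A \<subseteq> carrier R \<times> S" "B \<subseteq> carrier R \<times> S"
      using sub by blast+
    show "?m ` (A \<otimes>\<^bsub>localization R S\<^esub> B) = ?m ` A \<otimes>\<^bsub>localization R' (\<sigma> ` S)\<^esub> ?m ` B"
      unfolding localization_def monoid.simps ring.simps by (intro op AB) (simp add: hom)
    show "?m ` (A \<oplus>\<^bsub>localization R S\<^esub> B) = ?m ` A \<oplus>\<^bsub>localization R' (\<sigma> ` S)\<^esub> ?m ` B"
      unfolding localization_def monoid.simps ring.simps by (intro op AB) (simp add: hom)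
  next
    show "?m ` \<one>\<^bsub>localization R S\<^esub> = \<one>\<^bsub>localization R' (\<sigma> ` S)\<^esub>"
      by (simp add: localization_def image hom)
  next
    have "inj_on ?m (carrier R \<times> S)"
      using inj S by (auto simp: inj_on_def)
    then have "inj_on ((`) ?m) (carrier (localization R S))"
      using sub by (intro inj_onI) (simp add: inj_on_image_eq_iff)
    moreover have "(`) ?m ` carrier (localization R S) = carrier (localization R' (\<sigma> ` S))"
    proof -
      have "(`) ?m ` carrier (localization R S) = (\<lambda>(a, s). frac R' (\<sigma> ` S) (\<sigma> a) (\<sigma> s)) ` (carrier R \<times> S)"
        unfolding carrier_localization image_image by (intro image_cong) (clarsimp simp: image')+
      also have "\<dots> = carrier (localization R' (\<sigma> ` S))"
        unfolding carrier_localization surj[symmetric] by (auto intro!: rev_image_eqI)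
      finally show ?thesis .
    qed
    ultimately show "bij_betw ((`) ?m) (carrier (localization R S)) (carrier (localization R' (\<sigma> ` S)))"
      by (simp add: bij_betw_def)
  qed
qed

lemma topspace_zariski: "topspace (zariski R) = {p. primeideal p R}"
proof -
  have "\<one>\<^bsub>R\<^esub> \<in> carrier R \<and> \<one>\<^bsub>R\<^esub> \<notin> p" if p: "primeideal p R" for p
  proof -
    interpret primeideal p R by fact
    show ?thesis
      using I_notcarr one_imp_carrier by auto
  qed
  then show ?thesis
    by (auto simp: zariski_def)
qed

lemma primeideal_preimage:
  assumes R: "cring R" and p: "primeideal p R'" and \<sigma>: "\<sigma> \<in> ring_hom R R'"
  shows "primeideal {r \<in> carrier R. \<sigma> r \<in> p} R"
proof -
  interpret p: primeideal p R' by fact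
  interpret ring_hom_ring R R' \<sigma>
    using cring.axioms(1)[OF R] p.ring_axioms \<sigma> by (rule ring_hom_ringI2)
  show ?thesis
    using primeideal_vimage[OF R p] by simp
qed

lemma primeideal_subset: "primeideal p R \<Longrightarrow> p \<subseteq> carrier R"
  by (meson additive_subgroup.a_subset ideal.axioms(1) primeideal.axioms(1))

lemma continuous_zariski:
  assumes "cring R" and \<sigma>: "\<sigma> \<in> ring_hom R R'"
  shows "continuous_map (zariski R') (zariski R) (\<lambda>p. {r \<in> carrier R. \<sigma> r \<in> p})"
proof -
  let ?\<phi> = "\<lambda>p. {r \<in> carrier R. \<sigma> r \<in> p}"
  have prime: "primeideal (?\<phi> p) R" if "primeideal p R'" for p
    using assms that by (intro primeideal_preimage)
  show ?thesis
    unfolding zariski_def[of R]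
  proof (rule continuous_on_generated_topo)
    fix U assume "U \<in> {{p. primeideal p R \<and> f \<notin> p} |f. f \<in> carrier R}"
    then obtain f where f: "f \<in> carrier R" "U = {p. primeideal p R \<and> f \<notin> p}"
      by blast
    then have "?\<phi> -` U \<inter> topspace (zariski R') = {p. primeideal p R' \<and> \<sigma> f \<notin> p}"
      using prime by (auto simp: topspace_zariski)
    moreover have "openin (zariski R') {p. primeideal p R' \<and> \<sigma> f \<notin> p}"
      unfolding zariski_def using ring_hom_closed[OF \<sigma> f(1)] by (intro topology_generated_by_Basis) auto
    ultimately show "openin (zariski R') (?\<phi> -` U \<inter> topspace (zariski R'))"
      by simp
  next
    have "?\<phi> ` topspace (zariski R') \<subseteq> topspace (zariski R)"
      using prime by (auto simp: topspace_zariski)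
    then show "?\<phi> ` topspace (zariski R') \<subseteq> \<Union> {{p. primeideal p R \<and> f \<notin> p} |f. f \<in> carrier R}"
      by (simp add: zariski_def)
  qed
qed

text \<open>Contravariance fixes the order of the two spaces: \<open>\<sigma>\<close> from
  \<open>R\<close> to \<open>R'\<close> sends primes of \<open>R'\<close> to primes of
  \<open>R\<close> by preimage, while on stalks it acts forward on numerators and
  denominators.\<close>

lemma Spec_isomorphic:
  assumes R: "cring R" and R': "cring R'" and \<sigma>: "\<sigma> \<in> ring_iso R R'"
    and \<iota>: "\<And>c. \<iota> c \<in> carrier R" "\<And>c. \<sigma> (\<iota> c) = \<iota>' c"
  shows "Spec R' \<iota>' \<cong>\<^sub>s Spec R \<iota>"
proof -
  interpret R: cring R by fact
  interpret R': cring R' by fact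
  define \<tau> where "\<tau> = inv_into (carrier R) \<sigma>"
  have \<tau>: "\<tau> \<in> ring_iso R' R"
    unfolding \<tau>_def by (intro ring_iso_set_sym R.ring_axioms \<sigma>)
  have bij: "bij_betw \<sigma> (carrier R) (carrier R')"
    using ring_iso_memE(5)[OF \<sigma>] .
  have \<tau>\<sigma>: "\<tau> (\<sigma> r) = r" if "r \<in> carrier R" for r
    using bij that unfolding \<tau>_def by (rule bij_betw_inv_into_left)
  have \<sigma>\<tau>: "\<sigma> (\<tau> r) = r" if "r \<in> carrier R'" for r
    using bij that unfolding \<tau>_def by (rule bij_betw_inv_into_right)
  have \<sigma>c: "\<sigma> r \<in> carrier R'" if "r \<in> carrier R" for r
    using ring_iso_memE(1)[OF \<sigma> that] .
  have \<tau>c: "\<tau> r \<in> carrier R" if "r \<in> carrier R'" for r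
    using ring_iso_memE(1)[OF \<tau> that] .
  define \<phi> where "\<phi> p = {r \<in> carrier R. \<sigma> r \<in> p}" for p
  have "homeomorphic_maps (zariski R') (zariski R) \<phi> (\<lambda>p. {r \<in> carrier R'. \<tau> r \<in> p})"
    unfolding homeomorphic_maps_def
  proof (intro conjI ballI)
    show "continuous_map (zariski R') (zariski R) \<phi>"
      unfolding \<phi>_def using \<sigma> R by (intro continuous_zariski) (auto simp: ring_iso_def)
    show "continuous_map (zariski R) (zariski R') (\<lambda>p. {r \<in> carrier R'. \<tau> r \<in> p})"
      using \<tau> R' by (intro continuous_zariski) (auto simp: ring_iso_def)
    show "{r \<in> carrier R'. \<tau> r \<in> \<phi> p} = p" if "p \<in> topspace (zariski R')" for p
    proof -
      have "p \<subseteq> carrier R'"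
        using that by (simp add: topspace_zariski primeideal_subset)
      then show ?thesis
        by (auto simp: \<phi>_def \<sigma>\<tau> \<tau>c)
    qed
    show "\<phi> {r \<in> carrier R'. \<tau> r \<in> p} = p" if "p \<in> topspace (zariski R)" for p
    proof -
      have "p \<subseteq> carrier R"
        using that by (simp add: topspace_zariski primeideal_subset)
      then show ?thesis
        by (auto simp: \<phi>_def \<tau>\<sigma> \<sigma>c)
    qed
  qed
  then have homeo: "homeomorphic_map (zariski R') (zariski R) \<phi>"
    by (rule homeomorphic_maps_imp_map)
  \<comment> \<open>Surjectivity of \<open>\<sigma>\<close> makes this an equality: the denominators
    allowed at \<open>\<phi> p\<close> are carried exactly onto those allowed at \<open>p\<close>,
    so the two local rings match.\<close>
  have img: "\<sigma> ` (carrier R - \<phi> p) = carrier R' - p" for p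
  proof -
    have "\<sigma> ` (carrier R - \<phi> p) = \<sigma> ` carrier R - p"
      by (auto simp: \<phi>_def)
    then show ?thesis
      using bij by (simp add: bij_betw_def)
  qed
  have frac: "map_prod \<sigma> \<sigma> ` frac R (carrier R - \<phi> p) a s = frac R' (carrier R' - p) (\<sigma> a) (\<sigma> s)"
    if "a \<in> carrier R" "s \<in> carrier R" for p a s
    using frac_image[OF R.ring_axioms \<sigma> _ that, of "carrier R - \<phi> p"] by (simp add: img)
  show ?thesis
    unfolding Spec_def
  proof (rule isomorphic_spacesI[OF homeo, where pb = "\<lambda>_. (`) (map_prod \<sigma> \<sigma>)"])
    fix p
    show "(`) (map_prod \<sigma> \<sigma>) \<in> ring_iso (localization R (carrier R - \<phi> p)) (localization R' (carrier R' - p))"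
      using localization_ring_iso[OF R.ring_axioms \<sigma>, of "carrier R - \<phi> p"] by (simp add: img)
    show "map_prod \<sigma> \<sigma> ` frac R (carrier R - \<phi> p) (\<iota> c) \<one>\<^bsub>R\<^esub> = frac R' (carrier R' - p) (\<iota>' c) \<one>\<^bsub>R'\<^esub>" for c
      using ring_iso_memE(4)[OF \<sigma>] by (simp add: frac \<iota>)
  next
    fix V t assume V: "openin (zariski R) V"
      and "t \<in> {\<lambda>p. frac R (carrier R - p) a s | a s. a \<in> carrier R \<and> s \<in> carrier R \<and> (\<forall>p\<in>V. s \<notin> p)}"
    then obtain a s where t: "t = (\<lambda>p. frac R (carrier R - p) a s)"
      and as: "a \<in> carrier R" "s \<in> carrier R" "\<forall>p\<in>V. s \<notin> p"
      by blast
    have "\<sigma> s \<notin> p" if "\<phi> p \<in> V" for p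
      using as that by (auto simp: \<phi>_def)
    with as show "\<exists>u \<in> {\<lambda>p. frac R' (carrier R' - p) a s | a s. a \<in> carrier R' \<and> s \<in> carrier R' \<and>
        (\<forall>p \<in> {x \<in> topspace (zariski R'). \<phi> x \<in> V}. s \<notin> p)}.
      \<forall>x\<in>topspace (zariski R'). \<phi> x \<in> V \<longrightarrow> map_prod \<sigma> \<sigma> ` t (\<phi> x) = u x"
      by (intro bexI[of _ "\<lambda>p. frac R' (carrier R' - p) (\<sigma> a) (\<sigma> s)"]
        CollectI exI[of _ "\<sigma> a"] exI[of _ "\<sigma> s"]) (auto simp: t frac \<sigma>c)
  next
    fix V u assume V: "openin (zariski R') V"
      and "u \<in> {\<lambda>p. frac R' (carrier R' - p) a s | a s. a \<in> carrier R' \<and> s \<in> carrier R' \<and> (\<forall>p\<in>V. s \<notin> p)}"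
    then obtain a s where u: "u = (\<lambda>p. frac R' (carrier R' - p) a s)"
      and as: "a \<in> carrier R'" "s \<in> carrier R'" "\<forall>p\<in>V. s \<notin> p"
      by blast
    have "\<tau> s \<notin> \<phi> p" if "p \<in> V" for p
      using as that by (auto simp: \<phi>_def \<sigma>\<tau>)
    with as \<tau>c have "frac R (carrier R - \<phi> x) (\<tau> a) (\<tau> s) \<in> carrier (localization R (carrier R - \<phi> x))"
      if "x \<in> V" for x
      using that unfolding localization_def by simp blast
    then show "\<exists>t \<in> {\<lambda>p. frac R (carrier R - p) a s | a s. a \<in> carrier R \<and> s \<in> carrier R \<and> (\<forall>p\<in>\<phi> ` V. s \<notin> p)}.
      \<forall>x\<in>V. t (\<phi> x) \<in> carrier (localization R (carrier R - \<phi> x)) \<and> map_prod \<sigma> \<sigma> ` t (\<phi> x) = u x"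
      using as \<open>\<And>p. p \<in> V \<Longrightarrow> \<tau> s \<notin> \<phi> p\<close>
      by (intro bexI[of _ "\<lambda>p. frac R (carrier R - p) (\<tau> a) (\<tau> s)"]
        CollectI exI[of _ "\<tau> a"] exI[of _ "\<tau> s"]) (auto simp: u frac \<tau>c \<sigma>\<tau>)
  qed
qed

section \<open>Real analytic functions\<close>

lemma summable_on_abs_iff: "(\<lambda>a. \<bar>f a\<bar>) summable_on A \<longleftrightarrow> f summable_on A" for f :: "'a \<Rightarrow> real"
  using summable_on_iff_abs_summable_on_real[of f A] by simp

lemma summable_on_abs_le:
  fixes f g :: "'a \<Rightarrow> real"
  assumes "g summable_on A" "\<And>a. a \<in> A \<Longrightarrow> \<bar>f a\<bar> \<le> g a"
  shows "f summable_on A"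
  using summable_on_comparison_test[OF assms] by (simp add: summable_on_abs_iff)

lemma abs_infsum_le: "f summable_on A \<Longrightarrow> \<bar>infsum f A\<bar> \<le> (\<Sum>\<^sub>\<infinity>a\<in>A. \<bar>f a\<bar>)" for f :: "'a \<Rightarrow> real"
  using norm_infsum_bound[of f A] by (simp add: summable_on_abs_iff)

text \<open>A closed cube rather than a ball: a centred monomial is bounded on it by
  \<open>\<rho> ^ deg \<alpha>\<close>, with equality at the corner, so convergence at one point
  yields the weighted bound.\<close>

definition cube :: "real^'n \<Rightarrow> real \<Rightarrow> (real^'n) set"
  where "cube x \<rho> = {y. \<forall>i. \<bar>y $ i - x $ i\<bar> \<le> \<rho>}"

definition mono_at :: "real^'n \<Rightarrow> nat^'n \<Rightarrow> real^'n \<Rightarrow> real"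
  where "mono_at x \<alpha> y = (\<Prod>i\<in>UNIV. (y $ i - x $ i) ^ (\<alpha> $ i))"

definition deg :: "nat^'n \<Rightarrow> nat"
  where "deg \<alpha> = (\<Sum>i\<in>UNIV. \<alpha> $ i)"

text \<open>The weighted l1 norm of the Taylor coefficients at \<open>x\<close> is at most
  \<open>K\<close>. It dominates the supremum on the cube and is submultiplicative. Inner functions
  are measured in this norm because a bound on their values alone would not control the rearranged
  series after substitution.\<close>

definition majorized :: "real^'n \<Rightarrow> real \<Rightarrow> (real^'n \<Rightarrow> real) \<Rightarrow> real \<Rightarrow> bool"
  where "majorized x \<rho> f K \<longleftrightarrow> 0 < \<rho> \<and>
    (\<exists>c. (\<lambda>\<alpha>. \<bar>c \<alpha>\<bar> * \<rho> ^ deg \<alpha>) summable_on UNIV \<and> (\<Sum>\<^sub>\<infinity>\<alpha>. \<bar>c \<alpha>\<bar> * \<rho> ^ deg \<alpha>) \<le> K \<and>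
      (\<forall>y\<in>cube x \<rho>. ((\<lambda>\<alpha>. c \<alpha> * mono_at x \<alpha> y) has_sum f y) UNIV))"

lemma center_in_cube: "0 < \<rho> \<Longrightarrow> x \<in> cube x \<rho>"
  by (simp add: cube_def)

lemma deg_0 [simp]: "deg 0 = 0"
  by (simp add: deg_def)

lemma deg_add_axis: "deg (\<alpha> + axis i 1) = Suc (deg \<alpha>)"
  by (simp add: deg_def sum.distrib axis_def)

lemma deg_eq_0: "deg \<alpha> = 0 \<longleftrightarrow> \<alpha> = 0"
  by (auto simp: deg_def vec_eq_iff)

lemma mono_at_0 [simp]: "mono_at x 0 y = 1"
  by (simp add: mono_at_def)

lemma mono_at_add_axis: "mono_at x (\<alpha> + axis i 1) y = (y $ i - x $ i) * mono_at x \<alpha> y"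
proof -
  have "(\<Prod>j\<in>UNIV. (y $ j - x $ j) ^ (axis i 1 $ j)) = (\<Prod>j\<in>UNIV. if j = i then y $ i - x $ i else 1)"
    by (rule prod.cong) (auto simp: axis_def)
  then show ?thesis
    by (simp add: mono_at_def power_add prod.distrib)
qed

text \<open>Induction on the degree, removing one unit from a nonzero entry. It reduces statements
  on monomials to multiplication by a single coordinate, so no Cauchy product over multi-indices is
  ever formed.\<close>

lemma multiindex_induct [case_names zero add_axis]:
  fixes \<alpha> :: "nat^'n"
  assumes "P 0" and step: "\<And>\<alpha> i. P \<alpha> \<Longrightarrow> P (\<alpha> + axis i 1)"
  shows "P \<alpha>"
proof (induction "deg \<alpha>" arbitrary: \<alpha>)
  case 0
  then have "\<alpha> = 0"
    by (simp add: deg_eq_0)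
  with assms show ?case by simp
next
  case (Suc k)
  then have "\<alpha> \<noteq> 0"
    using deg_eq_0[of \<alpha>] by auto
  then obtain i where i: "\<alpha> $ i \<noteq> 0"
    by (auto simp: vec_eq_iff)
  define \<beta> where "\<beta> = \<alpha> - axis i 1"
  have \<alpha>: "\<alpha> = \<beta> + axis i 1"
    using i by (auto simp: \<beta>_def vec_eq_iff axis_def)
  then have "k = deg \<beta>"
    using Suc.hyps(2) deg_add_axis[of \<beta> i] by simp
  with Suc.hyps(1) step show ?case
    unfolding \<alpha> by blast
qed

lemma abs_mono_at_le:
  assumes "y \<in> cube x \<rho>"
  shows "\<bar>mono_at x \<alpha> y\<bar> \<le> \<rho> ^ deg \<alpha>"
proof -
  have "\<bar>mono_at x \<alpha> y\<bar> = (\<Prod>i\<in>UNIV. \<bar>y $ i - x $ i\<bar> ^ (\<alpha> $ i))"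
    by (simp add: mono_at_def abs_prod power_abs)
  also have "\<dots> \<le> (\<Prod>i\<in>UNIV. \<rho> ^ (\<alpha> $ i))"
    using assms by (intro prod_mono) (auto simp: cube_def intro: power_mono)
  finally show ?thesis
    by (simp add: deg_def power_sum)
qed

lemma majorizedE:
  assumes "majorized x \<rho> f K"
  obtains c where "0 < \<rho>" "(\<lambda>\<alpha>. \<bar>c \<alpha>\<bar> * \<rho> ^ deg \<alpha>) summable_on UNIV" "(\<Sum>\<^sub>\<infinity>\<alpha>. \<bar>c \<alpha>\<bar> * \<rho> ^ deg \<alpha>) \<le> K"
    "\<forall>y\<in>cube x \<rho>. ((\<lambda>\<alpha>. c \<alpha> * mono_at x \<alpha> y) has_sum f y) UNIV"
  using assms unfolding majorized_def by blast

lemma majorized_mono: "majorized x \<rho> f K \<Longrightarrow> K \<le> K' \<Longrightarrow> majorized x \<rho> f K'"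
  unfolding majorized_def by (meson order_trans)

lemma majorized_nonneg: "majorized x \<rho> f K \<Longrightarrow> 0 \<le> K"
  by (elim majorizedE, rule order_trans[OF infsum_nonneg]) auto

lemma majorized_cong:
  assumes "majorized x \<rho> f K" "\<And>y. y \<in> cube x \<rho> \<Longrightarrow> f y = g y"
  shows "majorized x \<rho> g K"
  using assms unfolding majorized_def by auto

lemma majorized_bound:
  assumes "majorized x \<rho> f K" "y \<in> cube x \<rho>"
  shows "\<bar>f y\<bar> \<le> K"
proof -
  obtain c where "0 < \<rho>" and c: "(\<lambda>\<alpha>. \<bar>c \<alpha>\<bar> * \<rho> ^ deg \<alpha>) summable_on UNIV"
    "(\<Sum>\<^sub>\<infinity>\<alpha>. \<bar>c \<alpha>\<bar> * \<rho> ^ deg \<alpha>) \<le> K" "((\<lambda>\<alpha>. c \<alpha> * mono_at x \<alpha> y) has_sum f y) UNIV"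
    using assms by (elim majorizedE) auto
  have sum: "(\<lambda>\<alpha>. c \<alpha> * mono_at x \<alpha> y) summable_on UNIV"
    using c(3) by (rule has_sum_imp_summable)
  then have "\<bar>f y\<bar> \<le> (\<Sum>\<^sub>\<infinity>\<alpha>. \<bar>c \<alpha> * mono_at x \<alpha> y\<bar>)"
    using abs_infsum_le infsumI[OF c(3)] by fastforce
  also have "\<dots> \<le> (\<Sum>\<^sub>\<infinity>\<alpha>. \<bar>c \<alpha>\<bar> * \<rho> ^ deg \<alpha>)"
    using c(1) abs_mono_at_le[OF assms(2)]
    by (intro infsum_mono summable_on_abs_iff[THEN iffD2, OF sum]) (auto simp: abs_mult intro!: mult_left_mono)
  finally show ?thesis
    using c(2) by linarith
qed

text \<open>Completeness of the norm: summable bounds \<open>K\<close> make the double family of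
  coefficients absolutely summable, so the sums over \<open>a\<close> and \<open>\<alpha>\<close>
  may be interchanged. Products, substitutions and the cofactors in Hadamard's lemma all arise as
  such sums.\<close>

lemma majorized_has_sum:
  assumes g: "\<And>a. a \<in> A \<Longrightarrow> majorized x \<rho> (g a) (K a)" and \<rho>: "0 < \<rho>"
    and K: "K summable_on A"
    and h: "\<And>y. y \<in> cube x \<rho> \<Longrightarrow> ((\<lambda>a. g a y) has_sum h y) A"
  shows "majorized x \<rho> h (\<Sum>\<^sub>\<infinity>a\<in>A. K a)"
proof -
  have "\<forall>a\<in>A. \<exists>c. (\<lambda>\<alpha>. \<bar>c \<alpha>\<bar> * \<rho> ^ deg \<alpha>) summable_on UNIV \<and> (\<Sum>\<^sub>\<infinity>\<alpha>. \<bar>c \<alpha>\<bar> * \<rho> ^ deg \<alpha>) \<le> K a \<and>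
      (\<forall>y\<in>cube x \<rho>. ((\<lambda>\<alpha>. c \<alpha> * mono_at x \<alpha> y) has_sum g a y) UNIV)"
    using g unfolding majorized_def by blast
  then obtain c where c: "\<And>a. a \<in> A \<Longrightarrow> (\<lambda>\<alpha>. \<bar>c a \<alpha>\<bar> * \<rho> ^ deg \<alpha>) summable_on UNIV"
    "\<And>a. a \<in> A \<Longrightarrow> (\<Sum>\<^sub>\<infinity>\<alpha>. \<bar>c a \<alpha>\<bar> * \<rho> ^ deg \<alpha>) \<le> K a"
    "\<And>a y. \<lbrakk>a \<in> A; y \<in> cube x \<rho>\<rbrakk> \<Longrightarrow> ((\<lambda>\<alpha>. c a \<alpha> * mono_at x \<alpha> y) has_sum g a y) UNIV"
    unfolding bchoice_iff by blast
  have \<rho>0: "0 \<le> \<rho> ^ k" for k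
    using \<rho> by simp
  have sum: "(\<lambda>(a, \<alpha>). \<bar>c a \<alpha>\<bar> * \<rho> ^ deg \<alpha>) summable_on A \<times> UNIV"
  proof (rule summable_on_SigmaI)
    fix a assume "a \<in> A"
    then show "((\<lambda>\<alpha>. case (a, \<alpha>) of (a, \<alpha>) \<Rightarrow> \<bar>c a \<alpha>\<bar> * \<rho> ^ deg \<alpha>) has_sum
        (\<Sum>\<^sub>\<infinity>\<alpha>. \<bar>c a \<alpha>\<bar> * \<rho> ^ deg \<alpha>)) UNIV"
      using c(1) by simp
  next
    show "(\<lambda>a. \<Sum>\<^sub>\<infinity>\<alpha>. \<bar>c a \<alpha>\<bar> * \<rho> ^ deg \<alpha>) summable_on A"
      using c(2) \<rho>0 by (intro summable_on_comparison_test[OF K]) (auto intro: infsum_nonneg)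
  qed (use \<rho>0 in auto)
  have sum': "(\<lambda>(\<alpha>, a). \<bar>c a \<alpha>\<bar> * \<rho> ^ deg \<alpha>) summable_on UNIV \<times> A"
    using sum by (subst summable_on_swap) (simp add: case_prod_unfold)
  \<comment> \<open>Dividing by the positive weight leaves a summable column, so
    \<open>d \<alpha>\<close> below is a genuine sum and not the default value of a divergent
    \<open>infsum\<close>.\<close>
  have col: "(\<lambda>a. \<bar>c a \<alpha>\<bar>) summable_on A" for \<alpha>
  proof -
    have "(\<lambda>a. \<bar>c a \<alpha>\<bar> * \<rho> ^ deg \<alpha>) summable_on A"
      using summable_on_SigmaD1[OF sum', of \<alpha>] by simp
    then show ?thesis
      using \<rho> by (simp add: summable_on_cmult_left')
  qed
  define d where "d \<alpha> = (\<Sum>\<^sub>\<infinity>a\<in>A. c a \<alpha>)" for \<alpha>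
  have d_le: "\<bar>d \<alpha>\<bar> * \<rho> ^ deg \<alpha> \<le> (\<Sum>\<^sub>\<infinity>a\<in>A. \<bar>c a \<alpha>\<bar> * \<rho> ^ deg \<alpha>)" for \<alpha>
  proof -
    have "\<bar>d \<alpha>\<bar> \<le> (\<Sum>\<^sub>\<infinity>a\<in>A. \<bar>c a \<alpha>\<bar>)"
      using abs_infsum_le[of "\<lambda>a. c a \<alpha>" A] col[of \<alpha>] by (simp add: d_def summable_on_abs_iff)
    then have "\<bar>d \<alpha>\<bar> * \<rho> ^ deg \<alpha> \<le> (\<Sum>\<^sub>\<infinity>a\<in>A. \<bar>c a \<alpha>\<bar>) * \<rho> ^ deg \<alpha>"
      using \<rho>0 by (rule mult_right_mono)
    then show ?thesis
      by (simp add: infsum_cmult_left')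
  qed
  have rows: "(\<lambda>\<alpha>. \<Sum>\<^sub>\<infinity>a\<in>A. \<bar>c a \<alpha>\<bar> * \<rho> ^ deg \<alpha>) summable_on UNIV"
    using summable_on_Sigma_banach[OF sum'] by simp
  have d_sum: "(\<lambda>\<alpha>. \<bar>d \<alpha>\<bar> * \<rho> ^ deg \<alpha>) summable_on UNIV"
    using rows d_le \<rho>0 by (intro summable_on_comparison_test[OF rows]) auto
  have "(\<Sum>\<^sub>\<infinity>\<alpha>. \<bar>d \<alpha>\<bar> * \<rho> ^ deg \<alpha>) \<le> (\<Sum>\<^sub>\<infinity>\<alpha>. \<Sum>\<^sub>\<infinity>a\<in>A. \<bar>c a \<alpha>\<bar> * \<rho> ^ deg \<alpha>)"
    using d_sum rows d_le by (rule infsum_mono)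
  also have "\<dots> = (\<Sum>\<^sub>\<infinity>a\<in>A. \<Sum>\<^sub>\<infinity>\<alpha>. \<bar>c a \<alpha>\<bar> * \<rho> ^ deg \<alpha>)"
    using sum' by (rule infsum_swap_banach)
  also have "\<dots> \<le> (\<Sum>\<^sub>\<infinity>a\<in>A. K a)"
  proof (rule infsum_mono[OF _ K])
    show "(\<lambda>a. \<Sum>\<^sub>\<infinity>\<alpha>. \<bar>c a \<alpha>\<bar> * \<rho> ^ deg \<alpha>) summable_on A"
      using summable_on_Sigma_banach[OF sum] by simp
  qed (use c(2) in auto)
  finally have d_le_K: "(\<Sum>\<^sub>\<infinity>\<alpha>. \<bar>d \<alpha>\<bar> * \<rho> ^ deg \<alpha>) \<le> (\<Sum>\<^sub>\<infinity>a\<in>A. K a)" .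
  have "((\<lambda>\<alpha>. d \<alpha> * mono_at x \<alpha> y) has_sum h y) UNIV" if y: "y \<in> cube x \<rho>" for y
  proof -
    have S: "(\<lambda>(\<alpha>, a). c a \<alpha> * mono_at x \<alpha> y) summable_on UNIV \<times> A"
      using abs_mono_at_le[OF y] \<rho>0
      by (intro summable_on_abs_le[OF sum']) (auto simp: abs_mult intro!: mult_left_mono)
    have dm: "(\<Sum>\<^sub>\<infinity>a\<in>A. c a \<alpha> * mono_at x \<alpha> y) = d \<alpha> * mono_at x \<alpha> y" for \<alpha>
      by (simp add: d_def infsum_cmult_left')
    have "(\<Sum>\<^sub>\<infinity>\<alpha>. d \<alpha> * mono_at x \<alpha> y) = (\<Sum>\<^sub>\<infinity>a\<in>A. \<Sum>\<^sub>\<infinity>\<alpha>. c a \<alpha> * mono_at x \<alpha> y)"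
      using infsum_swap_banach[OF S] by (simp add: dm)
    also have "\<dots> = (\<Sum>\<^sub>\<infinity>a\<in>A. g a y)"
      using c(3) y by (intro infsum_cong infsumI) auto
    also have "\<dots> = h y"
      using h[OF y] by (rule infsumI)
    finally have "(\<Sum>\<^sub>\<infinity>\<alpha>. d \<alpha> * mono_at x \<alpha> y) = h y" .
    moreover have "(\<lambda>\<alpha>. d \<alpha> * mono_at x \<alpha> y) summable_on UNIV"
      using summable_on_Sigma_banach[OF S] by (simp add: dm)
    ultimately show ?thesis
      by (simp add: summable_iff_has_sum_infsum)
  qed
  with \<rho> d_sum d_le_K show ?thesis
    unfolding majorized_def by blast
qed

lemma majorized_infsum:
  assumes g: "\<And>a. a \<in> A \<Longrightarrow> majorized x \<rho> (g a) (K a)" and \<rho>: "0 < \<rho>"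
    and K: "K summable_on A"
  shows "majorized x \<rho> (\<lambda>y. \<Sum>\<^sub>\<infinity>a\<in>A. g a y) (\<Sum>\<^sub>\<infinity>a\<in>A. K a)"
    and "y \<in> cube x \<rho> \<Longrightarrow> (\<lambda>a. g a y) summable_on A"
proof -
  have sum: "(\<lambda>a. g a y) summable_on A" if "y \<in> cube x \<rho>" for y
    using majorized_bound[OF g that] by (intro summable_on_abs_le[OF K]) auto
  then show "majorized x \<rho> (\<lambda>y. \<Sum>\<^sub>\<infinity>a\<in>A. g a y) (\<Sum>\<^sub>\<infinity>a\<in>A. K a)"
    by (intro majorized_has_sum[where g = g] g \<rho> K has_sum_infsum sum)
  show "y \<in> cube x \<rho> \<Longrightarrow> (\<lambda>a. g a y) summable_on A"
    by (rule sum)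
qed

lemma majorized_sum:
  assumes "finite A" "\<And>a. a \<in> A \<Longrightarrow> majorized x \<rho> (g a) (K a)" "0 < \<rho>"
  shows "majorized x \<rho> (\<lambda>y. \<Sum>a\<in>A. g a y) (\<Sum>a\<in>A. K a)"
  using majorized_has_sum[of A x \<rho> g K "\<lambda>y. \<Sum>a\<in>A. g a y"] assms by simp

lemma majorized_add:
  assumes "majorized x \<rho> f K" "majorized x \<rho> g L"
  shows "majorized x \<rho> (\<lambda>y. f y + g y) (K + L)"
proof -
  have "majorized x \<rho> (\<lambda>y. \<Sum>b\<in>UNIV. if b then f y else g y) (\<Sum>b\<in>UNIV. if b then K else L)"
    using assms by (intro majorized_sum) (auto elim: majorizedE)
  then show ?thesis
    by (simp add: UNIV_bool add.commute)
qed

lemma majorized_cmult: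
  assumes "majorized x \<rho> f K"
  shows "majorized x \<rho> (\<lambda>y. k * f y) (\<bar>k\<bar> * K)"
proof -
  obtain c where c: "0 < \<rho>" "(\<lambda>\<alpha>. \<bar>c \<alpha>\<bar> * \<rho> ^ deg \<alpha>) summable_on UNIV" "(\<Sum>\<^sub>\<infinity>\<alpha>. \<bar>c \<alpha>\<bar> * \<rho> ^ deg \<alpha>) \<le> K"
    "\<forall>y\<in>cube x \<rho>. ((\<lambda>\<alpha>. c \<alpha> * mono_at x \<alpha> y) has_sum f y) UNIV"
    using assms by (rule majorizedE)
  show ?thesis
    unfolding majorized_def
    using c by (auto intro!: exI[of _ "\<lambda>\<alpha>. k * c \<alpha>"] has_sum_cmult_right mult_left_mono
      summable_on_cmult_right simp: abs_mult mult.assoc infsum_cmult_right')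
qed

lemma majorized_const:
  assumes "0 < \<rho>"
  shows "majorized x \<rho> (\<lambda>_. k) \<bar>k\<bar>"
proof -
  let ?c = "\<lambda>\<alpha>. if \<alpha> = 0 then k else 0"
  have sum: "((\<lambda>\<alpha>. \<bar>?c \<alpha>\<bar> * \<rho> ^ deg \<alpha>) has_sum \<bar>k\<bar>) UNIV"
    by (subst has_sum_cong_neutral[where T = "{0}" and g = "\<lambda>_. \<bar>k\<bar>"]) (auto intro: has_sum_finiteI)
  have "((\<lambda>\<alpha>. ?c \<alpha> * mono_at x \<alpha> y) has_sum k) UNIV" for y
    by (subst has_sum_cong_neutral[where T = "{0}" and g = "\<lambda>_. k"]) (auto intro: has_sum_finiteI)
  then show ?thesis
    unfolding majorized_def
    by (intro conjI exI[of _ ?c] ballI assms has_sum_imp_summable[OF sum] eq_refl[OF infsumI[OF sum]])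
qed

text \<open>Multiplication by a coordinate shifts coefficients, and the image of the shift consists
  of exactly the multi-indices with nonzero \<open>i\<close>-th entry.\<close>

lemma has_sum_add_axis:
  fixes t u :: "nat^'n \<Rightarrow> real"
  assumes "(t has_sum s) UNIV" and u: "\<And>\<alpha>. u (\<alpha> + axis i 1) = t \<alpha>" "\<And>\<alpha>. \<alpha> $ i = 0 \<Longrightarrow> u \<alpha> = 0"
  shows "(u has_sum s) UNIV"
proof -
  let ?h = "\<lambda>\<alpha> :: nat^'n. \<alpha> + axis i 1"
  have "inj ?h"
    by (simp add: inj_on_def)
  have "\<alpha> \<in> range ?h" if "\<alpha> $ i \<noteq> 0" for \<alpha>
    using that by (intro image_eqI[of _ _ "\<alpha> - axis i 1"]) (auto simp: vec_eq_iff axis_def)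
  then have "(u has_sum s) UNIV \<longleftrightarrow> (u has_sum s) (range ?h)"
    using u(2) by (intro has_sum_cong_neutral) auto
  also have "\<dots> \<longleftrightarrow> (t has_sum s) UNIV"
    using u(1) by (subst has_sum_reindex[OF \<open>inj ?h\<close>]) (simp add: o_def)
  finally show ?thesis
    using assms(1) by simp
qed

lemma majorized_coord_mult:
  assumes "majorized x \<rho> f K"
  shows "majorized x \<rho> (\<lambda>y. (y $ i - x $ i) * f y) (\<rho> * K)"
proof -
  obtain c where c: "0 < \<rho>" "(\<lambda>\<alpha>. \<bar>c \<alpha>\<bar> * \<rho> ^ deg \<alpha>) summable_on UNIV" "(\<Sum>\<^sub>\<infinity>\<alpha>. \<bar>c \<alpha>\<bar> * \<rho> ^ deg \<alpha>) \<le> K"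
    "\<forall>y\<in>cube x \<rho>. ((\<lambda>\<alpha>. c \<alpha> * mono_at x \<alpha> y) has_sum f y) UNIV"
    using assms by (rule majorizedE)
  define e where "e \<alpha> = (if \<alpha> $ i = 0 then 0 else c (\<alpha> - axis i 1))" for \<alpha>
  have e: "e (\<alpha> + axis i 1) = c \<alpha>" for \<alpha>
    by (simp add: e_def)
  have "((\<lambda>\<alpha>. \<bar>e \<alpha>\<bar> * \<rho> ^ deg \<alpha>) has_sum \<rho> * (\<Sum>\<^sub>\<infinity>\<alpha>. \<bar>c \<alpha>\<bar> * \<rho> ^ deg \<alpha>)) UNIV"
  proof (rule has_sum_add_axis[where i = i])
    show "((\<lambda>\<alpha>. \<rho> * (\<bar>c \<alpha>\<bar> * \<rho> ^ deg \<alpha>)) has_sum \<rho> * (\<Sum>\<^sub>\<infinity>\<alpha>. \<bar>c \<alpha>\<bar> * \<rho> ^ deg \<alpha>)) UNIV"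
      using c(2) by (intro has_sum_cmult_right) auto
  qed (simp_all only: e deg_add_axis power_Suc, simp_all add: e_def)
  moreover have "((\<lambda>\<alpha>. e \<alpha> * mono_at x \<alpha> y) has_sum (y $ i - x $ i) * f y) UNIV" if "y \<in> cube x \<rho>" for y
  proof (rule has_sum_add_axis[where i = i])
    show "((\<lambda>\<alpha>. (y $ i - x $ i) * (c \<alpha> * mono_at x \<alpha> y)) has_sum (y $ i - x $ i) * f y) UNIV"
      using bspec[OF c(4) that] by (rule has_sum_cmult_right)
  qed (simp_all only: e mono_at_add_axis mult_ac, simp_all add: e_def)
  moreover have "\<rho> * (\<Sum>\<^sub>\<infinity>\<alpha>. \<bar>c \<alpha>\<bar> * \<rho> ^ deg \<alpha>) \<le> \<rho> * K"
    using c(1,3) by (intro mult_left_mono) auto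
  ultimately show ?thesis
    unfolding majorized_def using c(1)
    by (intro conjI exI[of _ e]) (auto simp: infsumI has_sum_imp_summable)
qed

lemma majorized_mono_at_mult:
  assumes "majorized x \<rho> f K"
  shows "majorized x \<rho> (\<lambda>y. mono_at x \<alpha> y * f y) (\<rho> ^ deg \<alpha> * K)"
proof (induction \<alpha> rule: multiindex_induct)
  case zero
  with assms show ?case by simp
next
  case (add_axis \<alpha> i)
  then show ?case
    using majorized_coord_mult[of x \<rho> "\<lambda>y. mono_at x \<alpha> y * f y" "\<rho> ^ deg \<alpha> * K" i]
    by (simp only: mono_at_add_axis deg_add_axis power_Suc mult.assoc)
qed

lemma majorized_coord: "0 < \<rho> \<Longrightarrow> majorized x \<rho> (\<lambda>y. y $ i - x $ i) \<rho>"
  using majorized_coord_mult[OF majorized_const[of \<rho> x 1]] by simp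

text \<open>Only \<open>f\<close> is expanded: the term of exponent \<open>\<alpha>\<close> times
  \<open>g\<close> has norm at most
  \<open>\<bar>c \<alpha>\<bar> * \<rho> ^ deg \<alpha> * L\<close>, and these bounds sum to at most
  \<open>K * L\<close>.\<close>

lemma majorized_mult:
  assumes f: "majorized x \<rho> f K" and g: "majorized x \<rho> g L"
  shows "majorized x \<rho> (\<lambda>y. f y * g y) (K * L)"
proof -
  obtain c where c: "0 < \<rho>" "(\<lambda>\<alpha>. \<bar>c \<alpha>\<bar> * \<rho> ^ deg \<alpha>) summable_on UNIV" "(\<Sum>\<^sub>\<infinity>\<alpha>. \<bar>c \<alpha>\<bar> * \<rho> ^ deg \<alpha>) \<le> K"
    "\<forall>y\<in>cube x \<rho>. ((\<lambda>\<alpha>. c \<alpha> * mono_at x \<alpha> y) has_sum f y) UNIV"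
    using f by (rule majorizedE)
  have "majorized x \<rho> (\<lambda>y. f y * g y) (\<Sum>\<^sub>\<infinity>\<alpha>. \<bar>c \<alpha>\<bar> * \<rho> ^ deg \<alpha> * L)"
  proof (rule majorized_has_sum)
    show "majorized x \<rho> (\<lambda>y. c \<alpha> * (mono_at x \<alpha> y * g y)) (\<bar>c \<alpha>\<bar> * \<rho> ^ deg \<alpha> * L)" for \<alpha>
      using majorized_cmult[OF majorized_mono_at_mult[OF g], of "c \<alpha>" \<alpha>] by (simp add: mult.assoc)
    show "((\<lambda>\<alpha>. c \<alpha> * (mono_at x \<alpha> y * g y)) has_sum f y * g y) UNIV" if "y \<in> cube x \<rho>" for y
      using has_sum_cmult_left[OF bspec[OF c(4) that], of "g y"] by (simp add: mult.assoc)
  qed (use c in \<open>auto intro: summable_on_cmult_left\<close>)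
  moreover have "(\<Sum>\<^sub>\<infinity>\<alpha>. \<bar>c \<alpha>\<bar> * \<rho> ^ deg \<alpha> * L) \<le> K * L"
    using c(3) majorized_nonneg[OF g] by (simp add: infsum_cmult_left' mult_right_mono)
  ultimately show ?thesis
    by (rule majorized_mono)
qed

lemma majorized_power:
  assumes "majorized x \<rho> f K"
  shows "majorized x \<rho> (\<lambda>y. f y ^ k) (K ^ k)"
proof (induction k)
  case 0
  then show ?case
    using majorized_const[of \<rho> x 1] assms by (auto elim: majorizedE)
qed (use majorized_mult[OF assms] in auto)

lemma majorized_compose_mono_at:
  assumes "0 < \<rho>" and G: "\<And>i. majorized x \<rho> (\<lambda>y. G y $ i - p $ i) K"
  shows "majorized x \<rho> (\<lambda>y. mono_at p \<alpha> (G y)) (K ^ deg \<alpha>)"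
proof (induction \<alpha> rule: multiindex_induct)
  case zero
  then show ?case
    using majorized_const[OF assms(1), of x 1] by simp
next
  case (add_axis \<alpha> i)
  then show ?case
    using majorized_mult[OF G[of i] add_axis] by (simp only: mono_at_add_axis deg_add_axis power_Suc)
qed

text \<open>The radius \<open>R\<close> on which \<open>f\<close> is controlled reappears as the
  norm bound of the centred inner functions: a monomial of degree \<open>k\<close> in them has norm
  at most \<open>R ^ k\<close>, so the series of \<open>f\<close> can be substituted term by
  term.\<close>

lemma majorized_compose:
  assumes f: "majorized p R f K" and \<rho>: "0 < \<rho>"
    and G: "\<And>i. majorized x \<rho> (\<lambda>y. G y $ i - p $ i) R"
  shows "majorized x \<rho> (\<lambda>y. f (G y)) K"
proof -
  obtain c where c: "0 < R" "(\<lambda>\<alpha>. \<bar>c \<alpha>\<bar> * R ^ deg \<alpha>) summable_on UNIV" "(\<Sum>\<^sub>\<infinity>\<alpha>. \<bar>c \<alpha>\<bar> * R ^ deg \<alpha>) \<le> K"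
    "\<forall>y\<in>cube p R. ((\<lambda>\<alpha>. c \<alpha> * mono_at p \<alpha> y) has_sum f y) UNIV"
    using f by (rule majorizedE)
  have "majorized x \<rho> (\<lambda>y. f (G y)) (\<Sum>\<^sub>\<infinity>\<alpha>. \<bar>c \<alpha>\<bar> * R ^ deg \<alpha>)"
  proof (rule majorized_has_sum)
    show "majorized x \<rho> (\<lambda>y. c \<alpha> * mono_at p \<alpha> (G y)) (\<bar>c \<alpha>\<bar> * R ^ deg \<alpha>)" for \<alpha>
      by (intro majorized_cmult majorized_compose_mono_at G \<rho>)
    show "((\<lambda>\<alpha>. c \<alpha> * mono_at p \<alpha> (G y)) has_sum f (G y)) UNIV" if "y \<in> cube x \<rho>" for y
      using majorized_bound[OF G that] by (intro c(4)[rule_format]) (simp add: cube_def)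
  qed (use c \<rho> in auto)
  then show ?thesis
    using c(3) by (rule majorized_mono)
qed

text \<open>The version for an outer function of one real variable given by an ordinary power
  series; it serves for the binomial series.\<close>

lemma majorized_power_series:
  fixes a :: "nat \<Rightarrow> real"
  assumes a: "summable (\<lambda>n. \<bar>a n\<bar> * R ^ n)" and F: "\<And>t. \<bar>t - p\<bar> \<le> R \<Longrightarrow> (\<lambda>n. a n * (t - p) ^ n) sums F t"
    and G: "majorized x \<rho> (\<lambda>y. G y - p) R"
  shows "majorized x \<rho> (\<lambda>y. F (G y)) (suminf (\<lambda>n. \<bar>a n\<bar> * R ^ n))"
proof -
  have \<rho>: "0 < \<rho>" and R: "0 \<le> R"
    using G majorized_nonneg by (auto elim: majorizedE)
  have sum: "((\<lambda>n. \<bar>a n\<bar> * R ^ n) has_sum (suminf (\<lambda>n. \<bar>a n\<bar> * R ^ n))) UNIV"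
    using a R by (intro norm_summable_imp_has_sum) (auto simp: summable_sums)
  have "majorized x \<rho> (\<lambda>y. F (G y)) (\<Sum>\<^sub>\<infinity>n. \<bar>a n\<bar> * R ^ n)"
  proof (rule majorized_has_sum)
    show "majorized x \<rho> (\<lambda>y. a n * (G y - p) ^ n) (\<bar>a n\<bar> * R ^ n)" for n
      by (intro majorized_cmult majorized_power G)
    fix y assume "y \<in> cube x \<rho>"
    then have t: "\<bar>G y - p\<bar> \<le> R"
      using majorized_bound[OF G] by auto
    have "summable (\<lambda>n. norm (a n * (G y - p) ^ n))"
      by (rule summable_comparison_test'[OF a]) (use t in \<open>auto simp: abs_mult power_abs intro!: mult_left_mono power_mono\<close>)
    then show "((\<lambda>n. a n * (G y - p) ^ n) has_sum F (G y)) UNIV"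
      using F[OF t] by (rule norm_summable_imp_has_sum)
  qed (use sum \<rho> in \<open>auto simp: has_sum_imp_summable\<close>)
  then show ?thesis
    using infsumI[OF sum] by simp
qed

text \<open>Without the constant term every monomial has degree at least 1 and gains a factor
  \<open>t ^ deg \<alpha> \<le> t\<close> when the cube shrinks. This makes inner functions small
  enough for substitution.\<close>

lemma majorized_shrink:
  assumes f: "majorized x \<rho> f K" and t: "0 < t" "t \<le> 1"
  shows "majorized x (t * \<rho>) (\<lambda>y. f y - f x) (t * K)"
proof -
  obtain c where c: "0 < \<rho>" "(\<lambda>\<alpha>. \<bar>c \<alpha>\<bar> * \<rho> ^ deg \<alpha>) summable_on UNIV" "(\<Sum>\<^sub>\<infinity>\<alpha>. \<bar>c \<alpha>\<bar> * \<rho> ^ deg \<alpha>) \<le> K"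
    "\<forall>y\<in>cube x \<rho>. ((\<lambda>\<alpha>. c \<alpha> * mono_at x \<alpha> y) has_sum f y) UNIV"
    using f by (rule majorizedE)
  define e where "e \<alpha> = (if \<alpha> = 0 then 0 else c \<alpha>)" for \<alpha>
  \<comment> \<open>At the centre only the constant term survives, so subtracting \<open>f x\<close>
    amounts to deleting that term, as \<open>e\<close> does.\<close>
  have x: "mono_at x \<alpha> x = (if \<alpha> = 0 then 1 else 0)" for \<alpha>
  proof (induction \<alpha> rule: multiindex_induct)
    case (add_axis \<alpha> i)
    have "\<alpha> + axis i 1 \<noteq> 0"
      using deg_add_axis[of \<alpha> i] by (metis deg_0 nat.distinct(1))
    then show ?case
      by (simp add: mono_at_add_axis del: One_nat_def)
  qed simp
  have le: "\<bar>e \<alpha>\<bar> * (t * \<rho>) ^ deg \<alpha> \<le> t * (\<bar>c \<alpha>\<bar> * \<rho> ^ deg \<alpha>)" for \<alpha>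
  proof (cases "\<alpha> = 0")
    case False
    then obtain k where k: "deg \<alpha> = Suc k"
      using deg_eq_0[of \<alpha>] not0_implies_Suc by blast
    have "t ^ deg \<alpha> \<le> t"
      using t power_le_one[of t k] by (simp add: k mult_left_le)
    then have "t ^ deg \<alpha> * (\<bar>c \<alpha>\<bar> * \<rho> ^ deg \<alpha>) \<le> t * (\<bar>c \<alpha>\<bar> * \<rho> ^ deg \<alpha>)"
      using c(1) by (intro mult_right_mono) auto
    then show ?thesis
      using False by (simp add: e_def power_mult_distrib mult_ac)
  qed (use c t in \<open>simp add: e_def\<close>)
  have sum: "(\<lambda>\<alpha>. t * (\<bar>c \<alpha>\<bar> * \<rho> ^ deg \<alpha>)) summable_on UNIV"
    using c(2) by (rule summable_on_cmult_right)
  then have sum_e: "(\<lambda>\<alpha>. \<bar>e \<alpha>\<bar> * (t * \<rho>) ^ deg \<alpha>) summable_on UNIV"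
    using le c(1) t by (intro summable_on_comparison_test[OF sum]) auto
  have "(\<Sum>\<^sub>\<infinity>\<alpha>. \<bar>e \<alpha>\<bar> * (t * \<rho>) ^ deg \<alpha>) \<le> (\<Sum>\<^sub>\<infinity>\<alpha>. t * (\<bar>c \<alpha>\<bar> * \<rho> ^ deg \<alpha>))"
    using sum_e sum le by (rule infsum_mono)
  also have "\<dots> \<le> t * K"
    using c(3) t by (simp add: infsum_cmult_right' mult_left_mono)
  finally have bound: "(\<Sum>\<^sub>\<infinity>\<alpha>. \<bar>e \<alpha>\<bar> * (t * \<rho>) ^ deg \<alpha>) \<le> t * K" .
  have "((\<lambda>\<alpha>. e \<alpha> * mono_at x \<alpha> y) has_sum f y - f x) UNIV" if y: "y \<in> cube x (t * \<rho>)" for y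
  proof -
    have "t * \<rho> \<le> \<rho>"
      using t c(1) by (simp add: mult_le_cancel_right1)
    then have "y \<in> cube x \<rho>"
      using y by (auto simp: cube_def intro: order_trans)
    moreover have "((\<lambda>\<alpha>. - (c \<alpha> * mono_at x \<alpha> x)) has_sum - f x) UNIV"
      using bspec[OF c(4) center_in_cube[OF c(1)]] by (simp add: has_sum_uminus)
    ultimately have "((\<lambda>\<alpha>. c \<alpha> * mono_at x \<alpha> y + - (c \<alpha> * mono_at x \<alpha> x)) has_sum f y + - f x) UNIV"
      using c(4) by (intro has_sum_add) auto
    moreover have "c \<alpha> * mono_at x \<alpha> y + - (c \<alpha> * mono_at x \<alpha> x) = e \<alpha> * mono_at x \<alpha> y" for \<alpha>
      by (simp add: e_def x)
    ultimately show ?thesis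
      by simp
  qed
  with bound sum_e c(1) t show ?thesis
    unfolding majorized_def by (auto intro!: exI[of _ e])
qed

section \<open>From majorants to the calculus of real analytic functions\<close>

lemma has_sum_sum:
  fixes f :: "'i \<Rightarrow> 'a \<Rightarrow> real"
  assumes "finite I" "\<And>i. i \<in> I \<Longrightarrow> (f i has_sum s i) A"
  shows "((\<lambda>a. \<Sum>i\<in>I. f i a) has_sum (\<Sum>i\<in>I. s i)) A"
  using assms by (induction I rule: finite_induct) (auto intro: has_sum_add)

lemma ball_subset_cube: "ball x \<rho> \<subseteq> cube x \<rho>"
proof
  fix y assume "y \<in> ball x \<rho>"
  then have "norm (y - x) \<le> \<rho>"
    by (simp add: dist_norm norm_minus_commute)
  then have "\<bar>y $ i - x $ i\<bar> \<le> \<rho>" for i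
    using component_le_norm_cart[of "y - x" i] by simp
  then show "y \<in> cube x \<rho>"
    by (simp add: cube_def)
qed

lemma eventually_in_cube: "0 < \<rho> \<Longrightarrow> \<forall>\<^sub>F y in nhds x. y \<in> cube x \<rho>"
  using ball_subset_cube[of x \<rho>] unfolding eventually_nhds_metric
  by (metis dist_commute mem_ball subsetD)

text \<open>The Euclidean norm is at most \<open>CARD('n)\<close> times the maximum norm; the factor
  2 makes the resulting inequality strict.\<close>

lemma cube_subset_ball:
  fixes x :: "real^'n"
  assumes "0 < r"
  shows "cube x (r / (2 * CARD('n))) \<subseteq> ball x r"
proof
  fix y assume y: "y \<in> cube x (r / (2 * CARD('n)))"
  have "norm (y - x) \<le> (\<Sum>i\<in>UNIV. \<bar>(y - x) $ i\<bar>)"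
    by (rule norm_le_l1_cart)
  also have "\<dots> \<le> (\<Sum>i\<in>(UNIV :: 'n set). r / (2 * CARD('n)))"
    using y by (intro sum_mono) (simp add: cube_def)
  also have "\<dots> < r"
    using assms by simp
  finally show "y \<in> ball x r"
    by (simp add: dist_norm norm_minus_commute)
qed

text \<open>Substitution of the identity, whose centred coordinates have norm \<open>\<rho>'\<close>
  on the smaller cube.\<close>

lemma majorized_radius:
  assumes "majorized x \<rho> f K" "0 < \<rho>'" "\<rho>' \<le> \<rho>"
  shows "majorized x \<rho>' f K"
  by (rule majorized_compose[OF assms(1,2), where G = "\<lambda>y. y"]) (rule majorized_mono[OF majorized_coord[OF assms(2)] assms(3)])

lemma real_analytic_at_iff_majorized: "real_analytic_at f x \<longleftrightarrow> (\<exists>\<rho> K. majorized x \<rho> f K)"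
  for x :: "real^'n"
proof
  assume "real_analytic_at f x"
  then obtain c r where r: "r > 0"
    and c: "\<And>y. y \<in> ball x r \<Longrightarrow> ((\<lambda>\<alpha>. c \<alpha> * mono_at x \<alpha> y) has_sum f y) UNIV"
    unfolding real_analytic_at_def mono_at_def by blast
  define \<rho> where "\<rho> = r / (2 * CARD('n))"
  have \<rho>: "0 < \<rho>" and cube: "cube x \<rho> \<subseteq> ball x r"
    using r cube_subset_ball by (auto simp: \<rho>_def)
  \<comment> \<open>At this corner each centred monomial equals
    \<open>\<rho> ^ deg \<alpha>\<close>. A summable real family is absolutely summable, so
    convergence at this single point gives the weighted bound.\<close>
  let ?y = "x + (\<chi> i. \<rho>)"
  have "?y \<in> cube x \<rho>"
    using \<rho> by (simp add: cube_def)
  then have "(\<lambda>\<alpha>. c \<alpha> * mono_at x \<alpha> ?y) summable_on UNIV"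
    using c cube has_sum_imp_summable by blast
  moreover have "\<bar>c \<alpha> * mono_at x \<alpha> ?y\<bar> = \<bar>c \<alpha>\<bar> * \<rho> ^ deg \<alpha>" for \<alpha>
    using \<rho> by (simp add: mono_at_def deg_def power_sum abs_mult abs_prod)
  ultimately have "(\<lambda>\<alpha>. \<bar>c \<alpha>\<bar> * \<rho> ^ deg \<alpha>) summable_on UNIV"
    using summable_on_abs_iff[of "\<lambda>\<alpha>. c \<alpha> * mono_at x \<alpha> ?y" UNIV] by simp
  then show "\<exists>\<rho> K. majorized x \<rho> f K"
    unfolding majorized_def using cube
    by (intro exI[of _ \<rho>] exI[of _ "\<Sum>\<^sub>\<infinity>\<alpha>. \<bar>c \<alpha>\<bar> * \<rho> ^ deg \<alpha>"] conjI exI[of _ c] ballI c \<rho>) auto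
next
  assume "\<exists>\<rho> K. majorized x \<rho> f K"
  then obtain \<rho> K where "majorized x \<rho> f K"
    by blast
  then obtain c where "0 < \<rho>" "\<forall>y\<in>cube x \<rho>. ((\<lambda>\<alpha>. c \<alpha> * mono_at x \<alpha> y) has_sum f y) UNIV"
    by (rule majorizedE)
  then show "real_analytic_at f x"
    unfolding real_analytic_at_def using ball_subset_cube[of x \<rho>]
    by (intro exI[of _ c] exI[of _ \<rho>]) (auto simp: mono_at_def)
qed

text \<open>The filter \<open>at_right 0\<close> lets the finitely many coordinates of a map share
  one cube; a fixed radius for each would have to be minimized by hand.\<close>

lemma eventually_majorized:
  assumes "real_analytic_at f x" "0 < R"
  shows "\<forall>\<^sub>F \<rho> in at_right 0. majorized x \<rho> (\<lambda>y. f y - f x) R"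
proof -
  obtain \<rho>0 K where f: "majorized x \<rho>0 f K"
    using assms(1) real_analytic_at_iff_majorized by blast
  have \<rho>0: "0 < \<rho>0" and K: "0 \<le> K"
    using f majorized_nonneg by (auto elim: majorizedE)
  \<comment> \<open>The denominator \<open>K + 1\<close> avoids division by 0 when \<open>K\<close>
    vanishes.\<close>
  define t0 where "t0 = min 1 (R / (K + 1))"
  have t0: "0 < t0" "t0 \<le> 1" "t0 * K \<le> R"
  proof -
    show "0 < t0" "t0 \<le> 1"
      using assms(2) K by (auto simp: t0_def)
    have "t0 * K \<le> R / (K + 1) * K"
      using K by (intro mult_right_mono) (auto simp: t0_def)
    also have "\<dots> \<le> R"
      using K assms(2) by (simp add: field_simps)
    finally show "t0 * K \<le> R" .
  qed
  have "majorized x \<rho> (\<lambda>y. f y - f x) R" if \<rho>: "0 < \<rho>" "\<rho> < t0 * \<rho>0" for \<rho>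
  proof -
    have shrunk: "majorized x (t0 * \<rho>0) (\<lambda>y. f y - f x) R"
      using majorized_shrink[OF f t0(1,2)] t0(3) by (rule majorized_mono)
    show ?thesis
      by (rule majorized_radius[OF shrunk]) (use \<rho> in auto)
  qed
  then show ?thesis
    using t0 \<rho>0 unfolding eventually_at_right_field by (intro exI[of _ "t0 * \<rho>0"]) auto
qed

lemma real_analytic_at_common_radius:
  assumes "real_analytic_at f x" "real_analytic_at g x"
  obtains \<rho> K L where "0 < \<rho>" "majorized x \<rho> f K" "majorized x \<rho> g L"
proof -
  obtain \<rho> K \<rho>' L where f: "majorized x \<rho> f K" and g: "majorized x \<rho>' g L"
    using assms real_analytic_at_iff_majorized by blast
  have "0 < \<rho>" "0 < \<rho>'"
    using f g by (auto elim: majorizedE)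
  then have "majorized x (min \<rho> \<rho>') f K" "majorized x (min \<rho> \<rho>') g L"
    by (auto intro: majorized_radius[OF f] majorized_radius[OF g])
  with \<open>0 < \<rho>\<close> \<open>0 < \<rho>'\<close> show ?thesis
    by (intro that[of "min \<rho> \<rho>'"]) auto
qed

lemma real_analytic_at_const [intro, simp]: "real_analytic_at (\<lambda>_. k) x"
  unfolding real_analytic_at_iff_majorized by (intro exI, rule majorized_const[of 1]) simp

lemma real_analytic_at_add [intro]:
  assumes "real_analytic_at f x" "real_analytic_at g x"
  shows "real_analytic_at (\<lambda>y. f y + g y) x"
proof -
  obtain \<rho> K L where "majorized x \<rho> f K" "majorized x \<rho> g L"
    using assms by (rule real_analytic_at_common_radius)
  then show ?thesis
    unfolding real_analytic_at_iff_majorized by (blast intro: majorized_add)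
qed

lemma real_analytic_at_mult [intro]:
  assumes "real_analytic_at f x" "real_analytic_at g x"
  shows "real_analytic_at (\<lambda>y. f y * g y) x"
proof -
  obtain \<rho> K L where "majorized x \<rho> f K" "majorized x \<rho> g L"
    using assms by (rule real_analytic_at_common_radius)
  then show ?thesis
    unfolding real_analytic_at_iff_majorized by (blast intro: majorized_mult)
qed

lemma real_analytic_at_minus [intro]: "real_analytic_at f x \<Longrightarrow> real_analytic_at (\<lambda>y. - f y) x"
  using real_analytic_at_mult[OF real_analytic_at_const[of "-1"], of f x] by simp

lemma real_analytic_at_diff [intro]:
  assumes "real_analytic_at f x" "real_analytic_at g x"
  shows "real_analytic_at (\<lambda>y. f y - g y) x"
  using real_analytic_at_add[OF assms(1) real_analytic_at_minus[OF assms(2)]] by simp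

lemma real_analytic_at_coord [intro, simp]: "real_analytic_at (\<lambda>y. y $ i) x"
proof -
  have "real_analytic_at (\<lambda>y. y $ i - x $ i) x"
    unfolding real_analytic_at_iff_majorized by (intro exI, rule majorized_coord[of 1]) simp
  then show ?thesis
    using real_analytic_at_add[OF _ real_analytic_at_const[of "x $ i"], of "\<lambda>y. y $ i - x $ i"] by simp
qed

lemma real_analytic_at_sum [intro]:
  "(\<And>a. a \<in> A \<Longrightarrow> real_analytic_at (f a) x) \<Longrightarrow> real_analytic_at (\<lambda>y. \<Sum>a\<in>A. f a y) x"
  by (induction A rule: infinite_finite_induct) auto

lemma real_analytic_at_prod [intro]:
  "(\<And>a. a \<in> A \<Longrightarrow> real_analytic_at (f a) x) \<Longrightarrow> real_analytic_at (\<lambda>y. \<Prod>a\<in>A. f a y) x"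
  by (induction A rule: infinite_finite_induct) auto

lemma real_analytic_at_power [intro]:
  "real_analytic_at f x \<Longrightarrow> real_analytic_at (\<lambda>y. f y ^ k) x"
  by (induction k) auto

lemma real_analytic_at_compose:
  assumes f: "real_analytic_at f (G x)" and G: "\<And>i. real_analytic_at (\<lambda>y. G y $ i) x"
  shows "real_analytic_at (\<lambda>y. f (G y)) x"
proof -
  obtain R K where R: "majorized (G x) R f K"
    using f real_analytic_at_iff_majorized by blast
  then have "0 < R"
    by (auto elim: majorizedE)
  have "\<forall>\<^sub>F \<rho> in at_right 0. \<forall>i. majorized x \<rho> (\<lambda>y. G y $ i - G x $ i) R"
    using eventually_majorized[OF G \<open>0 < R\<close>] by (rule eventually_all_finite)
  then have "\<forall>\<^sub>F \<rho> in at_right 0. majorized x \<rho> (\<lambda>y. f (G y)) K"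
    using eventually_at_right_less
    by eventually_elim (rule majorized_compose[OF R], auto)
  then show ?thesis
    using eventually_happens[of _ "at_right (0::real)"] real_analytic_at_iff_majorized by fastforce
qed

text \<open>Re-expansion at a nearby \<open>x'\<close> is substitution of a translation:
  \<open>y $ i - x $ i\<close> has norm at most \<open>\<rho> / 2\<close> from its linear part at
  \<open>x'\<close> plus \<open>\<rho> / 2\<close> from its constant, which stays within the radius
  \<open>\<rho>\<close>.\<close>

lemma eventually_real_analytic_at:
  assumes "real_analytic_at f x"
  shows "\<forall>\<^sub>F y in nhds x. real_analytic_at f y"
proof -
  obtain \<rho> K where f: "majorized x \<rho> f K"
    using assms real_analytic_at_iff_majorized by blast
  then have \<rho>: "0 < \<rho>"
    by (auto elim: majorizedE)
  have "real_analytic_at f x'" if x': "x' \<in> cube x (\<rho> / 2)" for x'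
  proof -
    have "majorized x' (\<rho> / 2) (\<lambda>y. y $ i - x $ i) \<rho>" for i
    proof -
      have "majorized x' (\<rho> / 2) (\<lambda>y. (y $ i - x' $ i) + (x' $ i - x $ i)) (\<rho> / 2 + \<bar>x' $ i - x $ i\<bar>)"
        using \<rho> by (intro majorized_add majorized_coord majorized_const) auto
      moreover have "\<bar>x' $ i - x $ i\<bar> \<le> \<rho> / 2"
        using x' by (simp add: cube_def)
      ultimately show ?thesis
        by (auto intro: majorized_mono)
    qed
    then have "majorized x' (\<rho> / 2) (\<lambda>y. f y) K"
      using \<rho> by (intro majorized_compose[OF f]) auto
    then show ?thesis
      using real_analytic_at_iff_majorized by blast
  qed
  then show ?thesis
    using eventually_in_cube[of "\<rho> / 2" x] \<rho> by (auto elim: eventually_mono)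
qed

lemma real_analytic_at_cong:
  assumes "real_analytic_at f x" "\<forall>\<^sub>F y in nhds x. f y = g y"
  shows "real_analytic_at g x"
proof -
  obtain \<rho> K where f: "majorized x \<rho> f K"
    using assms real_analytic_at_iff_majorized by blast
  then have \<rho>: "0 < \<rho>"
    by (auto elim: majorizedE)
  obtain e where e: "e > 0" "\<And>y. y \<in> ball x e \<Longrightarrow> f y = g y"
    using assms(2) by (auto simp: eventually_nhds_metric dist_commute)
  let ?r = "min \<rho> (e / (2 * CARD('a)))"
  have "majorized x ?r f K"
    using f \<rho> e(1) by (intro majorized_radius[OF f]) auto
  then have "majorized x ?r g K"
  proof (rule majorized_cong)
    fix y assume "y \<in> cube x ?r"
    then have "y \<in> ball x e"
      using cube_subset_ball[OF e(1), of x] by (auto simp: cube_def)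
    then show "f y = g y"
      by (rule e(2))
  qed
  then show ?thesis
    using real_analytic_at_iff_majorized by blast
qed

lemma real_analytic_at_imp_isCont:
  assumes "real_analytic_at f x"
  shows "isCont f x"
proof -
  have "\<forall>\<^sub>F y in nhds x. dist (f y) (f x) < e" if "e > 0" for e
  proof -
    have "\<forall>\<^sub>F \<rho> in at_right 0. majorized x \<rho> (\<lambda>y. f y - f x) (e / 2)"
      using assms that by (intro eventually_majorized) auto
    then obtain \<rho> where \<rho>: "majorized x \<rho> (\<lambda>y. f y - f x) (e / 2)"
      using eventually_happens[of _ "at_right (0::real)"] by fastforce
    then have "0 < \<rho>"
      by (auto elim: majorizedE)
    from eventually_in_cube[OF this, of x] show ?thesis
      by eventually_elim (use majorized_bound[OF \<rho>] that in \<open>force simp: dist_real_def\<close>)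
  qed
  then have "(f \<longlongrightarrow> f x) (nhds x)"
    by (simp add: tendsto_iff)
  then show ?thesis
    by (simp add: isCont_def tendsto_at_iff_tendsto_nhds)
qed

text \<open>The binomial series of \<open>t powr a\<close> about \<open>p = g x\<close> converges
  for distances less than \<open>p\<close>. Reciprocals and roots are both obtained from it.\<close>

lemma real_analytic_at_powr:
  assumes g: "real_analytic_at g x" and pos: "0 < g x"
  shows "real_analytic_at (\<lambda>y. g y powr a) x"
proof -
  define p where "p = g x"
  define c where "c n = (a gchoose n) * p powr (a - of_nat n)" for n
  have sums: "(\<lambda>n. c n * t ^ n) sums (t + p) powr a" if "\<bar>t\<bar> < p" for t
    using gen_binomial_real'[OF that, of a] by (simp add: c_def mult_ac)
  have p: "0 < p"
    using pos by (simp add: p_def)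
  \<comment> \<open>The factor \<open>3 / 4\<close> is any number strictly between
    \<open>1 / 2\<close> and \<open>1\<close>: convergence there gives absolute convergence at
    \<open>p / 2\<close>.\<close>
  have "summable (\<lambda>n. c n * (3 / 4 * p) ^ n)"
    using sums[of "3 / 4 * p"] p by (simp add: sums_iff)
  then have "summable (\<lambda>n. norm (c n * (p / 2) ^ n))"
    by (rule powser_insidea) (use p in auto)
  then have summable: "summable (\<lambda>n. \<bar>c n\<bar> * (p / 2) ^ n)"
    using p by (simp add: abs_mult power_abs)
  have "\<forall>\<^sub>F \<rho> in at_right 0. majorized x \<rho> (\<lambda>y. g y - g x) (p / 2)"
    using g p by (intro eventually_majorized) auto
  then obtain \<rho> where \<rho>: "majorized x \<rho> (\<lambda>y. g y - p) (p / 2)"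
    using eventually_happens[of _ "at_right (0::real)"] unfolding p_def by fastforce
  have "majorized x \<rho> (\<lambda>y. g y powr a) (suminf (\<lambda>n. \<bar>c n\<bar> * (p / 2) ^ n))"
  proof (rule majorized_power_series[OF summable _ \<rho>])
    fix t assume "\<bar>t - p\<bar> \<le> p / 2"
    then show "(\<lambda>n. c n * (t - p) ^ n) sums t powr a"
      using sums[of "t - p"] p by auto
  qed
  then show ?thesis
    using real_analytic_at_iff_majorized by blast
qed

lemma eventually_nhds_pos:
  assumes "real_analytic_at g x" "0 < g x"
  shows "\<forall>\<^sub>F y in nhds x. 0 < g y"
  using real_analytic_at_imp_isCont[OF assms(1)] assms(2)
  by (auto simp: isCont_def tendsto_at_iff_tendsto_nhds intro: order_tendstoD)

text \<open>Where \<open>g\<close> is negative, oddness of \<open>F\<close> moves the question to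
  \<open>- g\<close>. Both \<open>inverse\<close> and \<open>root N\<close> are odd.\<close>

lemma real_analytic_at_sign_cases:
  assumes g: "real_analytic_at g x" "g x \<noteq> 0"
    and pos: "\<And>g. \<lbrakk>real_analytic_at g x; 0 < g x\<rbrakk> \<Longrightarrow> real_analytic_at (\<lambda>y. F (g y)) x"
    and odd: "\<And>t. F (- t) = - F t"
  shows "real_analytic_at (\<lambda>y. F (g y)) x"
proof (cases "0 < g x")
  case False
  then have "real_analytic_at (\<lambda>y. - F (- g y)) x"
    using g by (intro real_analytic_at_minus pos) auto
  then show ?thesis
    by (simp add: odd)
qed (use g pos in auto)

lemma real_analytic_at_inverse [intro]:
  assumes "real_analytic_at g x" "g x \<noteq> 0"
  shows "real_analytic_at (\<lambda>y. inverse (g y)) x"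
  using assms
proof (rule real_analytic_at_sign_cases)
  fix g assume g: "real_analytic_at g x" "0 < g x"
  from eventually_nhds_pos[OF g] have "\<forall>\<^sub>F y in nhds x. g y powr - 1 = inverse (g y)"
    by eventually_elim (simp add: powr_minus)
  with real_analytic_at_powr[OF g] show "real_analytic_at (\<lambda>y. inverse (g y)) x"
    by (rule real_analytic_at_cong)
qed simp

text \<open>In HOL \<open>root N\<close> is an odd function for every \<open>N\<close>, even
  \<open>N\<close> included, so a nonzero value of \<open>g\<close> suffices whatever its
  sign.\<close>

lemma real_analytic_at_root [intro]:
  assumes "real_analytic_at g x" "g x \<noteq> 0" "0 < N"
  shows "real_analytic_at (\<lambda>y. root N (g y)) x"
  using assms(1,2)
proof (rule real_analytic_at_sign_cases)
  fix g assume g: "real_analytic_at g x" "0 < g x"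
  from eventually_nhds_pos[OF g] have "\<forall>\<^sub>F y in nhds x. g y powr (1 / N) = root N (g y)"
    by eventually_elim (use assms(3) in \<open>simp add: root_powr_inverse\<close>)
  with real_analytic_at_powr[OF g] show "real_analytic_at (\<lambda>y. root N (g y)) x"
    by (rule real_analytic_at_cong)
qed (rule real_root_minus)

lemma real_analytic_at_power_int [intro]:
  assumes "real_analytic_at g x" "g x \<noteq> 0"
  shows "real_analytic_at (\<lambda>y. g y powi k) x"
  using assms by (cases "0 \<le> k") (auto simp: power_int_def power_inverse)

text \<open>Exchanging one coordinate factor at a time gives cofactors of size
  \<open>deg \<alpha>\<close> times the power of \<open>K\<close> with exponent one less than the
  degree; the quotient by \<open>K\<close> expresses this without truncated subtraction in degree
  0.\<close>

lemma mono_at_difference: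
  fixes K :: real
  assumes "0 < K" and a: "\<And>i. majorized x \<rho> (\<lambda>y. G y $ i - p $ i) K"
    and b: "\<And>i. majorized x \<rho> (\<lambda>y. H y $ i - p $ i) K"
  shows "\<exists>q. (\<forall>i. majorized x \<rho> (q i) (deg \<alpha> * K ^ deg \<alpha> / K)) \<and>
    (\<forall>y. mono_at p \<alpha> (G y) - mono_at p \<alpha> (H y) = (\<Sum>i\<in>UNIV. (G y $ i - H y $ i) * q i y))"
proof (induction \<alpha> rule: multiindex_induct)
  have \<rho>: "0 < \<rho>"
    using a by (auto elim: majorizedE)
  {
    case zero
    show ?case
      using majorized_const[OF \<rho>, of x 0] by (intro exI[of _ "\<lambda>_ _. 0"]) auto
  next
    case (add_axis \<alpha> i)
    then obtain q where q: "\<And>i. majorized x \<rho> (q i) (deg \<alpha> * K ^ deg \<alpha> / K)"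
      "\<And>y. mono_at p \<alpha> (G y) - mono_at p \<alpha> (H y) = (\<Sum>i\<in>UNIV. (G y $ i - H y $ i) * q i y)"
      by blast
    \<comment> \<open>This is \<open>A * B - A' * B' = A * (B - B') + (A - A') * B'\<close>, where
      \<open>A\<close>, \<open>A'\<close> are the added coordinate factors and \<open>B\<close>,
      \<open>B'\<close> the monomials of exponent \<open>\<alpha>\<close> in \<open>G\<close> and
      \<open>H\<close>. Only the cofactor with index \<open>i\<close> receives the second
      summand.\<close>
    define r where "r j y = (G y $ i - p $ i) * q j y + (if j = i then mono_at p \<alpha> (H y) else 0)" for j y
    have "majorized x \<rho> (r j) (deg (\<alpha> + axis i 1) * K ^ deg (\<alpha> + axis i 1) / K)" for j
    proof -
      have "majorized x \<rho> (\<lambda>y. if j = i then mono_at p \<alpha> (H y) else 0) (K ^ deg \<alpha>)"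
        using majorized_compose_mono_at[OF \<rho> b] majorized_mono[OF majorized_const[OF \<rho>, of x 0]] \<open>0 < K\<close>
        by (cases "j = i") auto
      with q(1)[of j] have "majorized x \<rho> (r j) (K * (deg \<alpha> * K ^ deg \<alpha> / K) + K ^ deg \<alpha>)"
        unfolding r_def by (intro majorized_add majorized_mult a)
      also have "K * (deg \<alpha> * K ^ deg \<alpha> / K) + K ^ deg \<alpha> = deg (\<alpha> + axis i 1) * K ^ deg (\<alpha> + axis i 1) / K"
        using \<open>0 < K\<close> unfolding deg_add_axis by (simp add: field_simps)
      finally show ?thesis .
    qed
    moreover have "mono_at p (\<alpha> + axis i 1) (G y) - mono_at p (\<alpha> + axis i 1) (H y) =
        (\<Sum>j\<in>UNIV. (G y $ j - H y $ j) * r j y)" for y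
    proof -
      have "(\<Sum>j\<in>UNIV. (G y $ j - H y $ j) * r j y) =
          (\<Sum>j\<in>UNIV. (G y $ i - p $ i) * ((G y $ j - H y $ j) * q j y)) +
          (\<Sum>j\<in>UNIV. if j = i then (G y $ j - H y $ j) * mono_at p \<alpha> (H y) else 0)"
        unfolding r_def sum.distrib[symmetric] by (rule sum.cong) (auto simp: algebra_simps)
      also have "\<dots> = (G y $ i - p $ i) * (mono_at p \<alpha> (G y) - mono_at p \<alpha> (H y)) +
          (G y $ i - H y $ i) * mono_at p \<alpha> (H y)"
        by (simp add: q(2) sum_distrib_left)
      also have "\<dots> = mono_at p (\<alpha> + axis i 1) (G y) - mono_at p (\<alpha> + axis i 1) (H y)"
        unfolding mono_at_add_axis by (simp add: algebra_simps)
      finally show ?thesis by simp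
    qed
    ultimately show ?case
      by blast
  }
qed

text \<open>The cofactors of the single monomials are summed against the coefficients of
  \<open>f\<close>; their growth with the degree is paid for by halving the radius.\<close>

lemma real_analytic_hadamard:
  fixes f :: "real^'m \<Rightarrow> real" and G H :: "real^'n \<Rightarrow> real^'m"
  assumes f: "real_analytic_at f (G x)" and eq: "H x = G x"
    and G: "\<And>i. real_analytic_at (\<lambda>y. G y $ i) x" and H: "\<And>i. real_analytic_at (\<lambda>y. H y $ i) x"
  shows "\<exists>q. (\<forall>i. real_analytic_at (q i) x) \<and>
    (\<forall>\<^sub>F y in nhds x. f (G y) - f (H y) = (\<Sum>i\<in>UNIV. (G y $ i - H y $ i) * q i y))"
proof -
  define p where "p = G x"
  obtain R K where "majorized p R f K"
    using f real_analytic_at_iff_majorized p_def by blast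
  then obtain c where R: "0 < R" and c: "(\<lambda>\<alpha>. \<bar>c \<alpha>\<bar> * R ^ deg \<alpha>) summable_on UNIV"
    "\<forall>y\<in>cube p R. ((\<lambda>\<alpha>. c \<alpha> * mono_at p \<alpha> y) has_sum f y) UNIV"
    by (rule majorizedE)
  \<comment> \<open>Half the radius of \<open>f\<close>, because the factor
    \<open>deg \<alpha>\<close> in the cofactor bound is absorbed by
    \<open>2 ^ deg \<alpha>\<close>: then
    \<open>deg \<alpha> * L ^ deg \<alpha> \<le> R ^ deg \<alpha>\<close>.\<close>
  define L where "L = R / 2"
  have L: "0 < L"
    using R by (simp add: L_def)
  have "\<forall>\<^sub>F \<rho> in at_right 0. (\<forall>i. majorized x \<rho> (\<lambda>y. G y $ i - p $ i) L) \<and> (\<forall>i. majorized x \<rho> (\<lambda>y. H y $ i - p $ i) L)"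
    using eventually_majorized[OF G L] eventually_majorized[OF H L] eq
    by (intro eventually_conj eventually_all_finite) (auto simp: p_def)
  then obtain \<rho> where a: "\<And>i. majorized x \<rho> (\<lambda>y. G y $ i - p $ i) L" and b: "\<And>i. majorized x \<rho> (\<lambda>y. H y $ i - p $ i) L"
    using eventually_happens[of _ "at_right (0::real)"] by fastforce
  have \<rho>: "0 < \<rho>"
    using a by (auto elim: majorizedE)
  obtain q where q: "\<And>\<alpha> i. majorized x \<rho> (q \<alpha> i) (deg \<alpha> * L ^ deg \<alpha> / L)"
    "\<And>\<alpha> y. mono_at p \<alpha> (G y) - mono_at p \<alpha> (H y) = (\<Sum>i\<in>UNIV. (G y $ i - H y $ i) * q \<alpha> i y)"
    using mono_at_difference[OF L a b] by metis
  have q': "majorized x \<rho> (\<lambda>y. c \<alpha> * q \<alpha> i y) (\<bar>c \<alpha>\<bar> * R ^ deg \<alpha> / L)" for \<alpha> i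
  proof (rule majorized_mono[OF majorized_cmult[OF q(1)]])
    have "real (deg \<alpha>) * L ^ deg \<alpha> \<le> 2 ^ deg \<alpha> * L ^ deg \<alpha>"
      using of_nat_less_two_power[of "deg \<alpha>", where 'a = real] L by (intro mult_right_mono) auto
    also have "\<dots> = R ^ deg \<alpha>"
      by (simp add: L_def flip: power_mult_distrib)
    finally have "\<bar>c \<alpha>\<bar> * (real (deg \<alpha>) * L ^ deg \<alpha> / L) \<le> \<bar>c \<alpha>\<bar> * (R ^ deg \<alpha> / L)"
      using L by (intro mult_left_mono divide_right_mono) auto
    then show "\<bar>c \<alpha>\<bar> * (real (deg \<alpha>) * L ^ deg \<alpha> / L) \<le> \<bar>c \<alpha>\<bar> * R ^ deg \<alpha> / L"
      by simp
  qed
  have sum: "(\<lambda>\<alpha>. \<bar>c \<alpha>\<bar> * R ^ deg \<alpha> / L) summable_on UNIV"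
    using summable_on_cmult_left[OF c(1), of "1 / L"] by simp
  have q_sum: "majorized x \<rho> (\<lambda>y. \<Sum>\<^sub>\<infinity>\<alpha>. c \<alpha> * q \<alpha> i y) (\<Sum>\<^sub>\<infinity>\<alpha>. \<bar>c \<alpha>\<bar> * R ^ deg \<alpha> / L)"
    "y \<in> cube x \<rho> \<Longrightarrow> (\<lambda>\<alpha>. c \<alpha> * q \<alpha> i y) summable_on UNIV" for i y
    using majorized_infsum[of UNIV x \<rho> "\<lambda>\<alpha> y. c \<alpha> * q \<alpha> i y" "\<lambda>\<alpha>. \<bar>c \<alpha>\<bar> * R ^ deg \<alpha> / L"] q' \<rho> sum
    by blast+
  define r where "r i y = (\<Sum>\<^sub>\<infinity>\<alpha>. c \<alpha> * q \<alpha> i y)" for i y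
  have "real_analytic_at (r i) x" for i
    using q_sum(1) real_analytic_at_iff_majorized unfolding r_def by blast
  moreover have "\<forall>\<^sub>F y in nhds x. f (G y) - f (H y) = (\<Sum>i\<in>UNIV. (G y $ i - H y $ i) * r i y)"
    using eventually_in_cube[OF \<rho>, of x]
  proof eventually_elim
    case (elim y)
    have "\<bar>G y $ i - p $ i\<bar> \<le> R" "\<bar>H y $ i - p $ i\<bar> \<le> R" for i
      using majorized_bound[OF a elim, of i] majorized_bound[OF b elim, of i] R by (auto simp: L_def)
    then have "G y \<in> cube p R" "H y \<in> cube p R"
      by (auto simp: cube_def)
    then have "((\<lambda>\<alpha>. c \<alpha> * mono_at p \<alpha> (G y) + - (c \<alpha> * mono_at p \<alpha> (H y))) has_sum f (G y) + - f (H y)) UNIV"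
      using c(2) by (intro has_sum_add) (auto simp: has_sum_uminus)
    then have "((\<lambda>\<alpha>. \<Sum>i\<in>UNIV. (G y $ i - H y $ i) * (c \<alpha> * q \<alpha> i y)) has_sum f (G y) - f (H y)) UNIV"
      by (simp add: q(2) mult.left_commute flip: right_diff_distrib sum_distrib_left)
    moreover have "((\<lambda>\<alpha>. \<Sum>i\<in>UNIV. (G y $ i - H y $ i) * (c \<alpha> * q \<alpha> i y)) has_sum (\<Sum>i\<in>UNIV. (G y $ i - H y $ i) * r i y)) UNIV"
      unfolding r_def using q_sum(2)[OF elim] by (intro has_sum_sum has_sum_cmult_right has_sum_infsum) auto
    ultimately show ?case
      by (rule has_sum_unique)
  qed
  ultimately show ?thesis
    by blast
qed

section \<open>Isomorphisms of real analytic subschemes\<close>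

text \<open>Supplies the open set \<open>V'\<close> that a local section of
  \<open>analytic_subscheme\<close> demands, namely all points at which the function is
  analytic.\<close>

lemma real_analytic_on_open: "real_analytic_on f {x. real_analytic_at f x}" "open {x. real_analytic_at f x}"
proof -
  show "real_analytic_on f {x. real_analytic_at f x}"
    by (simp add: real_analytic_on_def)
  show "open {x. real_analytic_at f x}"
  proof (subst open_subopen, intro ballI)
    fix x assume "x \<in> {x. real_analytic_at f x}"
    then show "\<exists>T. open T \<and> x \<in> T \<and> T \<subseteq> {x. real_analytic_at f x}"
      using eventually_real_analytic_at[of f x] unfolding eventually_nhds by blast
  qed
qed

text \<open>Analyticity at \<open>z\<close> spreads to nearby points, and there are finitely many
  cofactors, so a common neighbourhood can be recovered from conditions at \<open>z\<close>
  alone.\<close>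

lemma germ_ideal_iff:
  "f \<in> germ_ideal g z \<longleftrightarrow> real_analytic_at f z \<and>
    (\<exists>c. (\<forall>j. real_analytic_at (c j) z) \<and> (\<forall>\<^sub>F x in nhds z. f x = (\<Sum>j\<in>UNIV. c j x * g j x)))"
proof
  assume "f \<in> germ_ideal g z"
  then obtain V c where V: "real_analytic_at f z" "open V" "z \<in> V" "\<And>j. real_analytic_on (c j) V"
    "\<And>x. x \<in> V \<Longrightarrow> f x = (\<Sum>j\<in>UNIV. c j x * g j x)"
    unfolding germ_ideal_def by blast
  then have "\<forall>\<^sub>F x in nhds z. f x = (\<Sum>j\<in>UNIV. c j x * g j x)"
    unfolding eventually_nhds by blast
  with V show "real_analytic_at f z \<and>
      (\<exists>c. (\<forall>j. real_analytic_at (c j) z) \<and> (\<forall>\<^sub>F x in nhds z. f x = (\<Sum>j\<in>UNIV. c j x * g j x)))"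
    unfolding real_analytic_on_def by blast
next
  assume "real_analytic_at f z \<and>
      (\<exists>c. (\<forall>j. real_analytic_at (c j) z) \<and> (\<forall>\<^sub>F x in nhds z. f x = (\<Sum>j\<in>UNIV. c j x * g j x)))"
  then obtain c where f: "real_analytic_at f z" and c: "\<And>j. real_analytic_at (c j) z"
    "\<forall>\<^sub>F x in nhds z. f x = (\<Sum>j\<in>UNIV. c j x * g j x)"
    by blast
  have "\<forall>\<^sub>F x in nhds z. (\<forall>j. real_analytic_at (c j) x) \<and> f x = (\<Sum>j\<in>UNIV. c j x * g j x)"
    by (intro eventually_conj eventually_all_finite eventually_real_analytic_at c)
  then obtain V where "open V" "z \<in> V" "\<forall>x\<in>V. (\<forall>j. real_analytic_at (c j) x) \<and> f x = (\<Sum>j\<in>UNIV. c j x * g j x)"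
    unfolding eventually_nhds by blast
  then show "f \<in> germ_ideal g z"
    unfolding germ_ideal_def real_analytic_on_def using f by blast
qed

lemma germ_ideal_analytic: "f \<in> germ_ideal g z \<Longrightarrow> real_analytic_at f z"
  by (simp add: germ_ideal_iff)

lemma germ_ideal_cong:
  assumes "f \<in> germ_ideal g z" "\<forall>\<^sub>F x in nhds z. f x = f' x"
  shows "f' \<in> germ_ideal g z"
proof -
  obtain c where c: "\<And>j. real_analytic_at (c j) z" "\<forall>\<^sub>F x in nhds z. f x = (\<Sum>j\<in>UNIV. c j x * g j x)"
    using assms(1) unfolding germ_ideal_iff by blast
  from c(2) assms(2) have "\<forall>\<^sub>F x in nhds z. f' x = (\<Sum>j\<in>UNIV. c j x * g j x)"
    by eventually_elim simp
  with c(1) real_analytic_at_cong[OF germ_ideal_analytic[OF assms(1)] assms(2)] show ?thesis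
    unfolding germ_ideal_iff by blast
qed

lemma germ_ideal_zero: "(\<lambda>x. 0) \<in> germ_ideal g z"
  unfolding germ_ideal_iff by (intro conjI exI[of _ "\<lambda>_ _. 0"]) simp_all

lemma germ_ideal_add:
  assumes "f \<in> germ_ideal g z" "f' \<in> germ_ideal g z"
  shows "(\<lambda>x. f x + f' x) \<in> germ_ideal g z"
proof -
  obtain c where c: "\<And>j. real_analytic_at (c j) z" "\<forall>\<^sub>F x in nhds z. f x = (\<Sum>j\<in>UNIV. c j x * g j x)"
    using assms(1) unfolding germ_ideal_iff by blast
  obtain c' where c': "\<And>j. real_analytic_at (c' j) z" "\<forall>\<^sub>F x in nhds z. f' x = (\<Sum>j\<in>UNIV. c' j x * g j x)"
    using assms(2) unfolding germ_ideal_iff by blast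
  from c(2) c'(2) have "\<forall>\<^sub>F x in nhds z. f x + f' x = (\<Sum>j\<in>UNIV. (c j x + c' j x) * g j x)"
    by eventually_elim (simp add: ring_distribs sum.distrib)
  moreover have "real_analytic_at (\<lambda>x. c j x + c' j x) z" for j
    using c c' by auto
  ultimately show ?thesis
    unfolding germ_ideal_iff using assms[THEN germ_ideal_analytic] c(1) c'(1)
    by (intro conjI exI[of _ "\<lambda>j x. c j x + c' j x"] allI real_analytic_at_add)
qed

lemma germ_ideal_mult:
  assumes "f \<in> germ_ideal g z" "real_analytic_at k z"
  shows "(\<lambda>x. k x * f x) \<in> germ_ideal g z"
proof -
  obtain c where c: "\<And>j. real_analytic_at (c j) z" "\<forall>\<^sub>F x in nhds z. f x = (\<Sum>j\<in>UNIV. c j x * g j x)"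
    using assms(1) unfolding germ_ideal_iff by blast
  from c(2) have "\<forall>\<^sub>F x in nhds z. k x * f x = (\<Sum>j\<in>UNIV. (k x * c j x) * g j x)"
    by eventually_elim (simp add: sum_distrib_left mult.assoc)
  moreover have "real_analytic_at (\<lambda>x. k x * c j x) z" for j
    using c assms by auto
  ultimately show ?thesis
    unfolding germ_ideal_iff using germ_ideal_analytic[OF assms(1)] assms(2) c(1)
    by (intro conjI exI[of _ "\<lambda>j x. k x * c j x"] allI real_analytic_at_mult)
qed

lemma germ_ideal_uminus: "f \<in> germ_ideal g z \<Longrightarrow> (\<lambda>x. - f x) \<in> germ_ideal g z"
  using germ_ideal_mult[of f g z "\<lambda>_. -1"] by simp

lemma germ_ideal_diff:
  "\<lbrakk>f \<in> germ_ideal g z; f' \<in> germ_ideal g z\<rbrakk> \<Longrightarrow> (\<lambda>x. f x - f' x) \<in> germ_ideal g z"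
  using germ_ideal_add[of f g z "\<lambda>x. - f' x"] germ_ideal_uminus[of f' g z] by simp

lemma germ_ideal_sum:
  "(\<And>i. i \<in> I \<Longrightarrow> f i \<in> germ_ideal g z) \<Longrightarrow> (\<lambda>x. \<Sum>i\<in>I. f i x) \<in> germ_ideal g z"
  by (induction I rule: infinite_finite_induct) (auto intro: germ_ideal_zero germ_ideal_add)

lemma germ_ideal_generator:
  assumes "real_analytic_at (g j) z"
  shows "g j \<in> germ_ideal g z"
proof -
  have "g j x = (\<Sum>i\<in>UNIV. (if i = j then 1 else 0) * g i x)" for x
    by (simp add: if_distrib[of "\<lambda>c. c * _"] cong: if_cong)
  then have "\<forall>\<^sub>F x in nhds z. g j x = (\<Sum>i\<in>UNIV. (if i = j then 1 else 0) * g i x)"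
    by simp
  then show ?thesis
    unfolding germ_ideal_iff using assms
    by (intro conjI exI[of _ "\<lambda>i x. if i = j then 1 else 0"] allI) simp_all
qed

lemma germ_ideal_vanishes:
  assumes "f \<in> germ_ideal g z" "\<forall>j. g j z = 0"
  shows "f z = 0"
proof -
  obtain c where "\<forall>\<^sub>F x in nhds z. f x = (\<Sum>j\<in>UNIV. c j x * g j x)"
    using assms(1) unfolding germ_ideal_iff by blast
  then have "f z = (\<Sum>j\<in>UNIV. c j z * g j z)"
    by (rule eventually_nhds_x_imp_x)
  with assms(2) show ?thesis by simp
qed

lemma analytic_map_tendsto:
  assumes "\<And>i. real_analytic_at (\<lambda>y. \<phi> y $ i) z"
  shows "(\<phi> \<longlongrightarrow> \<phi> z) (nhds z)"
proof (rule vec_tendstoI)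
  show "((\<lambda>y. \<phi> y $ i) \<longlongrightarrow> \<phi> z $ i) (nhds z)" for i
    using real_analytic_at_imp_isCont[OF assms, of i] unfolding isCont_def
    by (rule tendsto_at_iff_tendsto_nhds[THEN iffD1])
qed

lemma germ_ideal_pullback:
  assumes \<phi>: "\<And>i. real_analytic_at (\<lambda>y. \<phi> y $ i) z"
    and g: "\<And>j. (\<lambda>y. g' j (\<phi> y)) \<in> germ_ideal g z" and f: "f \<in> germ_ideal g' (\<phi> z)"
  shows "(\<lambda>y. f (\<phi> y)) \<in> germ_ideal g z"
proof -
  obtain c where c: "\<And>j. real_analytic_at (c j) (\<phi> z)"
    "\<forall>\<^sub>F x in nhds (\<phi> z). f x = (\<Sum>j\<in>UNIV. c j x * g' j x)"
    using f unfolding germ_ideal_iff by blast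
  have eq: "\<forall>\<^sub>F y in nhds z. f (\<phi> y) = (\<Sum>j\<in>UNIV. c j (\<phi> y) * g' j (\<phi> y))"
    using filterlim_iff[THEN iffD1, OF analytic_map_tendsto[OF \<phi>]] c(2) by blast
  have "(\<lambda>y. \<Sum>j\<in>UNIV. c j (\<phi> y) * g' j (\<phi> y)) \<in> germ_ideal g z"
    by (rule germ_ideal_sum, rule germ_ideal_mult[OF g], rule real_analytic_at_compose[OF c(1) \<phi>])
  then show ?thesis
    by (rule germ_ideal_cong) (use eq in \<open>simp add: eq_commute\<close>)
qed

lemma germ_ideal_compose_diff:
  fixes f :: "real^'m \<Rightarrow> real" and G H :: "real^'n \<Rightarrow> real^'m"
  assumes f: "real_analytic_at f (G z)" and eq: "H z = G z"
    and G: "\<And>i. real_analytic_at (\<lambda>y. G y $ i) z" and H: "\<And>i. real_analytic_at (\<lambda>y. H y $ i) z"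
    and diff: "\<And>i. (\<lambda>y. G y $ i - H y $ i) \<in> germ_ideal g z"
  shows "(\<lambda>y. f (G y) - f (H y)) \<in> germ_ideal g z"
proof -
  obtain q where q: "\<And>i. real_analytic_at (q i) z"
    "\<forall>\<^sub>F y in nhds z. f (G y) - f (H y) = (\<Sum>i\<in>UNIV. (G y $ i - H y $ i) * q i y)"
    using real_analytic_hadamard[of f G z H] f eq G H by blast
  have "(\<lambda>y. \<Sum>i\<in>UNIV. q i y * (G y $ i - H y $ i)) \<in> germ_ideal g z"
    by (intro germ_ideal_sum germ_ideal_mult diff q)
  then show ?thesis
    by (rule germ_ideal_cong) (use q(2) in \<open>simp add: mult.commute eq_commute\<close>)
qed

lemma analytic_ring_simps [simp]:
  "carrier (analytic_ring z) = {f. real_analytic_at f z}"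
  "f \<otimes>\<^bsub>analytic_ring z\<^esub> g = (\<lambda>x. f x * g x)"
  "\<one>\<^bsub>analytic_ring z\<^esub> = (\<lambda>x. 1)"
  "f \<oplus>\<^bsub>analytic_ring z\<^esub> g = (\<lambda>x. f x + g x)"
  "\<zero>\<^bsub>analytic_ring z\<^esub> = (\<lambda>x. 0)"
  by (simp_all add: analytic_ring_def)

lemma cring_analytic_ring: "cring (analytic_ring z)"
proof (rule cringI)
  show "abelian_group (analytic_ring z)"
  proof (rule abelian_groupI)
    fix f assume "f \<in> carrier (analytic_ring z)"
    then show "\<exists>h \<in> carrier (analytic_ring z). h \<oplus>\<^bsub>analytic_ring z\<^esub> f = \<zero>\<^bsub>analytic_ring z\<^esub>"
      by (intro bexI[of _ "\<lambda>x. - f x"]) auto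
  qed (auto simp: add_ac)
  show "comm_monoid (analytic_ring z)"
    by (rule comm_monoidI) (auto simp: mult_ac)
qed (simp add: ring_distribs)

lemma analytic_ring_minus:
  assumes "real_analytic_at f z" "real_analytic_at g z"
  shows "f \<ominus>\<^bsub>analytic_ring z\<^esub> g = (\<lambda>x. f x - g x)"
proof -
  interpret cring "analytic_ring z"
    by (rule cring_analytic_ring)
  have "\<ominus>\<^bsub>analytic_ring z\<^esub> g = (\<lambda>x. - g x)"
    by (rule minus_equality) (use assms in auto)
  then show ?thesis
    by (simp add: a_minus_def)
qed

lemma ideal_germ_ideal: "ideal (germ_ideal g z) (analytic_ring z)"
proof (rule idealI)
  interpret cring "analytic_ring z"
    by (rule cring_analytic_ring)
  show "ring (analytic_ring z)"
    by (rule ring_axioms)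
  show "subgroup (germ_ideal g z) (add_monoid (analytic_ring z))"
  proof (rule add.subgroupI)
    show "germ_ideal g z \<noteq> {}"
      using germ_ideal_zero by blast
    show "\<ominus>\<^bsub>analytic_ring z\<^esub> f \<in> germ_ideal g z" if "f \<in> germ_ideal g z" for f
    proof -
      have "\<ominus>\<^bsub>analytic_ring z\<^esub> f = (\<lambda>x. - f x)"
        by (rule minus_equality) (use germ_ideal_analytic[OF that] in auto)
      then show ?thesis
        using that by (simp add: germ_ideal_uminus)
    qed
  qed (auto simp: germ_ideal_analytic germ_ideal_add)
  fix f k assume fk: "f \<in> germ_ideal g z" "k \<in> carrier (analytic_ring z)"
  then show "k \<otimes>\<^bsub>analytic_ring z\<^esub> f \<in> germ_ideal g z"
    by (simp add: germ_ideal_mult)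
  with fk show "f \<otimes>\<^bsub>analytic_ring z\<^esub> k \<in> germ_ideal g z"
    by (simp add: mult.commute)
qed

abbreviation germ_class :: "('j::finite \<Rightarrow> real^'n \<Rightarrow> real) \<Rightarrow> real^'n \<Rightarrow> (real^'n \<Rightarrow> real) \<Rightarrow> (real^'n \<Rightarrow> real) set"
  where "germ_class g z f \<equiv> germ_ideal g z +>\<^bsub>analytic_ring z\<^esub> f"

abbreviation germ_ring :: "('j::finite \<Rightarrow> real^'n \<Rightarrow> real) \<Rightarrow> real^'n \<Rightarrow> (real^'n \<Rightarrow> real) set ring"
  where "germ_ring g z \<equiv> analytic_ring z Quot germ_ideal g z"

lemma germ_class_eq_iff:
  assumes "real_analytic_at f z" "real_analytic_at f' z"
  shows "germ_class g z f = germ_class g z f' \<longleftrightarrow> (\<lambda>x. f x - f' x) \<in> germ_ideal g z"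
proof -
  interpret cring "analytic_ring z"
    by (rule cring_analytic_ring)
  show ?thesis
    using quotient_eq_iff_same_a_r_cos[OF ideal_germ_ideal[of g z], of f f'] assms
    by (simp add: analytic_ring_minus)
qed

lemma in_germ_class_iff:
  assumes "real_analytic_at f z"
  shows "k \<in> germ_class g z f \<longleftrightarrow> real_analytic_at k z \<and> (\<lambda>x. k x - f x) \<in> germ_ideal g z"
proof
  assume "k \<in> germ_class g z f"
  then obtain i where "i \<in> germ_ideal g z" "k = (\<lambda>x. i x + f x)"
    by (auto simp: a_r_coset_def')
  then show "real_analytic_at k z \<and> (\<lambda>x. k x - f x) \<in> germ_ideal g z"
    using assms germ_ideal_analytic[of i] by auto
next
  assume "real_analytic_at k z \<and> (\<lambda>x. k x - f x) \<in> germ_ideal g z"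
  then show "k \<in> germ_class g z f"
    by (auto simp: a_r_coset_def' intro!: bexI[of _ "\<lambda>x. k x - f x"])
qed

lemma carrier_germ_ring: "carrier (germ_ring g z) = germ_class g z ` {f. real_analytic_at f z}"
  by (auto simp: FactRing_def A_RCOSETS_def')

lemma germ_class_hom: "germ_class g z \<in> ring_hom (analytic_ring z) (germ_ring g z)"
  by (rule ideal.rcos_ring_hom[OF ideal_germ_ideal])

text \<open>
  The comorphism of a map on stalks.  All the cosets in the union coincide when the map pulls
  the ideal of its target back into that of its source.
\<close>

definition germ_pullback :: "('j::finite \<Rightarrow> real^'n \<Rightarrow> real) \<Rightarrow> (real^'n \<Rightarrow> real^'m) \<Rightarrow> real^'n
    \<Rightarrow> (real^'m \<Rightarrow> real) set \<Rightarrow> (real^'n \<Rightarrow> real) set"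
  where "germ_pullback g \<phi> z C = (\<Union>f\<in>C. germ_class g z (\<lambda>y. f (\<phi> y)))"

lemma germ_pullback_class:
  assumes \<phi>: "\<And>i. real_analytic_at (\<lambda>y. \<phi> y $ i) z"
    and g: "\<And>j. (\<lambda>y. g' j (\<phi> y)) \<in> germ_ideal g z" and f: "real_analytic_at f (\<phi> z)"
  shows "germ_pullback g \<phi> z (germ_class g' (\<phi> z) f) = germ_class g z (\<lambda>y. f (\<phi> y))"
proof -
  have "germ_class g z (\<lambda>y. k (\<phi> y)) = germ_class g z (\<lambda>y. f (\<phi> y))" if "k \<in> germ_class g' (\<phi> z) f" for k
  proof -
    have k: "real_analytic_at k (\<phi> z)" "(\<lambda>x. k x - f x) \<in> germ_ideal g' (\<phi> z)"
      using that in_germ_class_iff[OF f] by auto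
    have "(\<lambda>y. k (\<phi> y) - f (\<phi> y)) \<in> germ_ideal g z"
      using germ_ideal_pullback[OF \<phi> g k(2)] .
    then show ?thesis
      using real_analytic_at_compose[OF k(1) \<phi>] real_analytic_at_compose[OF f \<phi>] by (simp add: germ_class_eq_iff)
  qed
  moreover have "f \<in> germ_class g' (\<phi> z) f"
    using f by (simp add: in_germ_class_iff germ_ideal_zero)
  ultimately show ?thesis
    unfolding germ_pullback_def by blast
qed

text \<open>\<open>\<phi>\<close> and \<open>\<psi>\<close> are total functions, constrained only
  through their germs at points of \<open>Z\<close> and \<open>Z'\<close>. Congruence of the
  composites to the identity already makes them inverse on points, since members of the ideal vanish
  there; on stalks it makes the two comorphisms inverse to each other.\<close>

lemma analytic_subscheme_isomorphic:
  fixes g :: "'j::finite \<Rightarrow> real^'n \<Rightarrow> real" and g' :: "'k::finite \<Rightarrow> real^'m \<Rightarrow> real"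
    and U :: "(real^'n) set" and U' :: "(real^'m) set"
  defines "Z \<equiv> {z \<in> U. \<forall>j. g j z = 0}" and "Z' \<equiv> {z \<in> U'. \<forall>j. g' j z = 0}"
  assumes \<phi>: "\<And>z. z \<in> Z \<Longrightarrow> \<phi> z \<in> Z'" "\<And>z i. z \<in> Z \<Longrightarrow> real_analytic_at (\<lambda>y. \<phi> y $ i) z"
      "\<And>z j. z \<in> Z \<Longrightarrow> (\<lambda>y. g' j (\<phi> y)) \<in> germ_ideal g z"
    and \<psi>: "\<And>z. z \<in> Z' \<Longrightarrow> \<psi> z \<in> Z" "\<And>z i. z \<in> Z' \<Longrightarrow> real_analytic_at (\<lambda>y. \<psi> y $ i) z"
      "\<And>z j. z \<in> Z' \<Longrightarrow> (\<lambda>y. g j (\<psi> y)) \<in> germ_ideal g' z"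
    and \<psi>\<phi>: "\<And>z i. z \<in> Z \<Longrightarrow> (\<lambda>y. \<psi> (\<phi> y) $ i - y $ i) \<in> germ_ideal g z"
    and \<phi>\<psi>: "\<And>z i. z \<in> Z' \<Longrightarrow> (\<lambda>y. \<phi> (\<psi> y) $ i - y $ i) \<in> germ_ideal g' z"
  shows "analytic_subscheme U g \<cong>\<^sub>s analytic_subscheme U' g'"
proof -
  have inv: "\<psi> (\<phi> z) = z" if "z \<in> Z" for z
    using germ_ideal_vanishes[OF \<psi>\<phi>[OF that]] that by (simp add: vec_eq_iff Z_def)
  have inv': "\<phi> (\<psi> z) = z" if "z \<in> Z'" for z
    using germ_ideal_vanishes[OF \<phi>\<psi>[OF that]] that by (simp add: vec_eq_iff Z'_def)
  have cont: "continuous_on Z \<phi>"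
    using analytic_map_tendsto[of \<phi>] \<phi>(2)
    by (auto intro!: continuous_at_imp_continuous_on simp: isCont_def tendsto_at_iff_tendsto_nhds)
  have cont': "continuous_on Z' \<psi>"
    using analytic_map_tendsto[of \<psi>] \<psi>(2)
    by (auto intro!: continuous_at_imp_continuous_on simp: isCont_def tendsto_at_iff_tendsto_nhds)
  have "homeomorphic_maps (top_of_set Z) (top_of_set Z') \<phi> \<psi>"
    using cont cont' inv inv' \<phi>(1) \<psi>(1) by (auto simp: homeomorphic_maps_def)
  then have homeo: "homeomorphic_map (top_of_set Z) (top_of_set Z') \<phi>"
    by (rule homeomorphic_maps_imp_map)
  have pb: "germ_pullback g \<phi> z (germ_class g' (\<phi> z) f) = germ_class g z (\<lambda>y. f (\<phi> y))"
    if "z \<in> Z" "real_analytic_at f (\<phi> z)" for z f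
    by (rule germ_pullback_class) (use that \<phi> in auto)
  have \<phi>_compose: "real_analytic_at (\<lambda>y. f (\<phi> y)) z" if "z \<in> Z" "real_analytic_at f (\<phi> z)" for z f
    by (rule real_analytic_at_compose[where G = \<phi>]) (use that \<phi> in auto)
  have \<psi>_compose: "real_analytic_at (\<lambda>y. f (\<psi> y)) z" if "z \<in> Z'" "real_analytic_at f (\<psi> z)" for z f
    by (rule real_analytic_at_compose[where G = \<psi>]) (use that \<psi> in auto)
  have \<psi>\<phi>_class: "germ_class g z (\<lambda>y. f (\<psi> (\<phi> y))) = germ_class g z f"
    if z: "z \<in> Z" and f: "real_analytic_at f z" for z f
  proof -
    have G: "real_analytic_at (\<lambda>y. \<psi> (\<phi> y) $ i) z" for i
      using \<phi>_compose[OF z \<psi>(2)[OF \<phi>(1)[OF z]]] .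
    have "(\<lambda>y. f (\<psi> (\<phi> y)) - f y) \<in> germ_ideal g z"
      by (rule germ_ideal_compose_diff[where G = "\<lambda>y. \<psi> (\<phi> y)" and H = "\<lambda>y. y"]) (use z f inv[OF z] G \<psi>\<phi> in auto)
    moreover have "real_analytic_at (\<lambda>y. f (\<psi> (\<phi> y))) z"
      by (rule real_analytic_at_compose[where G = "\<lambda>y. \<psi> (\<phi> y)"]) (use f inv[OF z] G in auto)
    ultimately show ?thesis
      using f by (simp add: germ_class_eq_iff)
  qed
  have stalk: "germ_pullback g \<phi> z \<in> ring_iso (germ_ring g' (\<phi> z)) (germ_ring g z)" if z: "z \<in> Z" for z
  proof -
    note hom = germ_class_hom[where g = g and z = z] and hom' = germ_class_hom[where g = g' and z = "\<phi> z"]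
    have carrier: "\<exists>f. real_analytic_at f (\<phi> z) \<and> C = germ_class g' (\<phi> z) f"
      if "C \<in> carrier (germ_ring g' (\<phi> z))" for C
      using that unfolding carrier_germ_ring by blast
    show ?thesis
    proof (rule ring_iso_memI)
      fix C assume "C \<in> carrier (germ_ring g' (\<phi> z))"
      then obtain f where f: "real_analytic_at f (\<phi> z)" "C = germ_class g' (\<phi> z) f"
        using carrier by blast
      then show "germ_pullback g \<phi> z C \<in> carrier (germ_ring g z)"
        unfolding carrier_germ_ring using z by (auto simp: pb \<phi>_compose)
      fix D assume "D \<in> carrier (germ_ring g' (\<phi> z))"
      then obtain h where h: "real_analytic_at h (\<phi> z)" "D = germ_class g' (\<phi> z) h"
        using carrier by blast
      have "C \<otimes>\<^bsub>germ_ring g' (\<phi> z)\<^esub> D = germ_class g' (\<phi> z) (\<lambda>x. f x * h x)"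
        "C \<oplus>\<^bsub>germ_ring g' (\<phi> z)\<^esub> D = germ_class g' (\<phi> z) (\<lambda>x. f x + h x)"
        using ring_hom_mult[OF hom', of f h] ring_hom_add[OF hom', of f h] f h by simp_all
      then show "germ_pullback g \<phi> z (C \<otimes>\<^bsub>germ_ring g' (\<phi> z)\<^esub> D) =
          germ_pullback g \<phi> z C \<otimes>\<^bsub>germ_ring g z\<^esub> germ_pullback g \<phi> z D"
        "germ_pullback g \<phi> z (C \<oplus>\<^bsub>germ_ring g' (\<phi> z)\<^esub> D) =
          germ_pullback g \<phi> z C \<oplus>\<^bsub>germ_ring g z\<^esub> germ_pullback g \<phi> z D"
        using ring_hom_mult[OF hom, of "\<lambda>y. f (\<phi> y)" "\<lambda>y. h (\<phi> y)"]
          ring_hom_add[OF hom, of "\<lambda>y. f (\<phi> y)" "\<lambda>y. h (\<phi> y)"] f h z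
        by (simp_all add: pb \<phi>_compose real_analytic_at_mult real_analytic_at_add)
    next
      show "germ_pullback g \<phi> z \<one>\<^bsub>germ_ring g' (\<phi> z)\<^esub> = \<one>\<^bsub>germ_ring g z\<^esub>"
        using ring_hom_one[OF hom] ring_hom_one[OF hom'] pb[OF z, of "\<lambda>_. 1"] by simp
    next
      show "bij_betw (germ_pullback g \<phi> z) (carrier (germ_ring g' (\<phi> z))) (carrier (germ_ring g z))"
        unfolding bij_betw_def
      proof (intro conjI inj_onI)
        fix C D assume C: "C \<in> carrier (germ_ring g' (\<phi> z))" and D: "D \<in> carrier (germ_ring g' (\<phi> z))"
          and eq: "germ_pullback g \<phi> z C = germ_pullback g \<phi> z D"
        obtain f h where f: "real_analytic_at f (\<phi> z)" "C = germ_class g' (\<phi> z) f"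
          and h: "real_analytic_at h (\<phi> z)" "D = germ_class g' (\<phi> z) h"
          using carrier C D by metis
        have z': "\<phi> z \<in> Z'"
          using \<phi>(1) z .
        \<comment> \<open>Injectivity on stalks: this difference, at the base point
          \<open>\<psi> (\<phi> z) = z\<close>, is pulled back along \<open>\<psi>\<close>. The
          result is congruent to \<open>f - h\<close>, because \<open>\<phi>\<close> after
          \<open>\<psi>\<close> is congruent to the identity.\<close>
        have d: "(\<lambda>y. f (\<phi> y) - h (\<phi> y)) \<in> germ_ideal g (\<psi> (\<phi> z))"
          using eq f h z by (simp add: pb \<phi>_compose germ_class_eq_iff inv)
        have d1: "(\<lambda>y. f (\<phi> (\<psi> y)) - h (\<phi> (\<psi> y))) \<in> germ_ideal g' (\<phi> z)"
          using germ_ideal_pullback[OF \<psi>(2,3)[OF z'] d] .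
        have G: "real_analytic_at (\<lambda>y. \<phi> (\<psi> y) $ i) (\<phi> z)" for i
          by (rule \<psi>_compose[OF z']) (use \<phi>(2)[OF z] inv[OF z] in auto)
        have "(\<lambda>y. (f (\<phi> (\<psi> y)) - h (\<phi> (\<psi> y))) - (f y - h y)) \<in> germ_ideal g' (\<phi> z)"
          by (rule germ_ideal_compose_diff[where f = "\<lambda>y. f y - h y" and G = "\<lambda>y. \<phi> (\<psi> y)" and H = "\<lambda>y. y"])
            (use f h inv'[OF z'] G \<phi>\<psi>[OF z'] in auto)
        from germ_ideal_diff[OF d1 this] have "(\<lambda>y. f y - h y) \<in> germ_ideal g' (\<phi> z)"
          by simp
        then show "C = D"
          using f h by (simp add: germ_class_eq_iff)
      next
        show "germ_pullback g \<phi> z ` carrier (germ_ring g' (\<phi> z)) = carrier (germ_ring g z)"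
        proof (intro equalityI subsetI)
          fix C assume "C \<in> carrier (germ_ring g z)"
          then obtain f where f: "real_analytic_at f z" "C = germ_class g z f"
            unfolding carrier_germ_ring by blast
          have f': "real_analytic_at (\<lambda>y. f (\<psi> y)) (\<phi> z)"
            by (rule \<psi>_compose) (use f z \<phi>(1) inv in auto)
          then have "C = germ_pullback g \<phi> z (germ_class g' (\<phi> z) (\<lambda>y. f (\<psi> y)))"
            using z f by (simp add: pb \<psi>\<phi>_class)
          then show "C \<in> germ_pullback g \<phi> z ` carrier (germ_ring g' (\<phi> z))"
            unfolding carrier_germ_ring using f' by blast
        next
          fix C assume "C \<in> germ_pullback g \<phi> z ` carrier (germ_ring g' (\<phi> z))"
          then obtain f where "real_analytic_at f (\<phi> z)" "C = germ_pullback g \<phi> z (germ_class g' (\<phi> z) f)"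
            using carrier by blast
          then show "C \<in> carrier (germ_ring g z)"
            unfolding carrier_germ_ring using z by (auto simp: pb \<phi>_compose)
        qed
      qed
    qed
  qed
  show ?thesis
    unfolding analytic_subscheme_def Let_def Z_def[symmetric] Z'_def[symmetric]
  proof (rule isomorphic_spacesI[OF homeo, where pb = "germ_pullback g \<phi>"])
    fix z assume "z \<in> topspace (top_of_set Z)"
    then have z: "z \<in> Z"
      by simp
    then show "germ_pullback g \<phi> z \<in> ring_iso (germ_ring g' (\<phi> z)) (germ_ring g z)"
      by (rule stalk)
    show "germ_pullback g \<phi> z (germ_class g' (\<phi> z) (\<lambda>x. c)) = germ_class g z (\<lambda>x. c)" for c
      using pb[OF z, of "\<lambda>_. c"] by simp
  next
    fix V t assume V: "openin (top_of_set Z') V"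
      and "t \<in> {(\<lambda>f z. germ_class g' z f) f | f. \<exists>V'. open V' \<and> V \<subseteq> V' \<and> real_analytic_on f V'}"
    then obtain f where t: "t = (\<lambda>z. germ_class g' z f)" and f: "\<And>x. x \<in> V \<Longrightarrow> real_analytic_at f x"
      unfolding real_analytic_on_def by blast
    let ?f = "\<lambda>y. f (\<phi> y)" and ?pre = "{x \<in> topspace (top_of_set Z). \<phi> x \<in> V}"
    have "?pre \<subseteq> {x. real_analytic_at ?f x}"
      using f \<phi>_compose by auto
    then have "(\<lambda>z. germ_class g z ?f) \<in> {(\<lambda>f z. germ_class g z f) f | f.
        \<exists>V'. open V' \<and> ?pre \<subseteq> V' \<and> real_analytic_on f V'}"
      using real_analytic_on_open by blast
    then show "\<exists>u\<in>{(\<lambda>f z. germ_class g z f) f | f. \<exists>V'. open V' \<and> ?pre \<subseteq> V' \<and> real_analytic_on f V'}.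
        \<forall>x\<in>topspace (top_of_set Z). \<phi> x \<in> V \<longrightarrow> germ_pullback g \<phi> x (t (\<phi> x)) = u x"
      by (rule bexI[rotated]) (use f in \<open>auto simp: t pb\<close>)
  next
    fix V u assume V: "openin (top_of_set Z) V"
      and "u \<in> {(\<lambda>f z. germ_class g z f) f | f. \<exists>V'. open V' \<and> V \<subseteq> V' \<and> real_analytic_on f V'}"
    then obtain f where u: "u = (\<lambda>z. germ_class g z f)" and f: "\<And>x. x \<in> V \<Longrightarrow> real_analytic_at f x"
      unfolding real_analytic_on_def by blast
    have VZ: "V \<subseteq> Z"
      using openin_subset[OF V] by simp
    let ?f = "\<lambda>y. f (\<psi> y)"
    have an: "real_analytic_at ?f (\<phi> x)" if "x \<in> V" for x
      by (rule \<psi>_compose) (use f VZ that inv \<phi>(1) in auto)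
    then have "(\<lambda>z. germ_class g' z ?f) \<in> {(\<lambda>f z. germ_class g' z f) f | f.
        \<exists>V'. open V' \<and> \<phi> ` V \<subseteq> V' \<and> real_analytic_on f V'}"
      using real_analytic_on_open by blast
    then show "\<exists>t\<in>{(\<lambda>f z. germ_class g' z f) f | f. \<exists>V'. open V' \<and> \<phi> ` V \<subseteq> V' \<and> real_analytic_on f V'}.
        \<forall>x\<in>V. t (\<phi> x) \<in> carrier (germ_ring g' (\<phi> x)) \<and> germ_pullback g \<phi> x (t (\<phi> x)) = u x"
    proof (rule bexI[rotated], intro ballI conjI)
      fix x assume x: "x \<in> V"
      then have "x \<in> Z"
        using VZ by blast
      show "germ_class g' (\<phi> x) ?f \<in> carrier (germ_ring g' (\<phi> x))"
        unfolding carrier_germ_ring using an[OF x] by blast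
      show "germ_pullback g \<phi> x (germ_class g' (\<phi> x) ?f) = u x"
        using pb[OF \<open>x \<in> Z\<close> an[OF x]] \<psi>\<phi>_class[OF \<open>x \<in> Z\<close> f[OF x]] by (simp add: u)
    qed
  qed
qed

section \<open>Lattices\<close>

text \<open>Applies a \<open>\<rat>\<close>-linear functional \<open>\<real> \<rightarrow> \<rat>\<close> with value \<open>1\<close> at \<open>a k0\<close> and clears denominators.\<close>

lemma integer_relation_transfer:
  fixes a :: "'k \<Rightarrow> real"
  assumes K: "finite K" and k0: "k0 \<in> K" "a k0 \<noteq> 0"
  obtains u :: "'k \<Rightarrow> int" where "0 < u k0"
    "\<forall>z :: 'k \<Rightarrow> int. (\<Sum>k\<in>K. a k * of_int (z k)) = 0 \<longrightarrow> (\<Sum>k\<in>K. u k * z k) = 0"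
proof -
  interpret vector_space_pair "\<lambda>(q::rat) (x::real). of_rat q * x" "(*) :: rat \<Rightarrow> rat \<Rightarrow> rat"
    by unfold_locales (simp_all add: ring_distribs of_rat_add of_rat_mult mult.assoc)
  have "vs1.independent {a k0}"
    using k0(2) by simp
  then obtain g where g: "Vector_Spaces.linear (\<lambda>q x. of_rat q * x) (*) g" and g1: "g (a k0) = (1 :: rat)"
    using linear_independent_extend[of "{a k0}" "\<lambda>_. 1"] by auto
  interpret g: Vector_Spaces.linear "\<lambda>(q::rat) (x::real). of_rat q * x" "(*) :: rat \<Rightarrow> rat \<Rightarrow> rat" g
    by (rule g)
  \<comment> \<open>A common denominator of the finitely many rationals \<open>g (a k)\<close>;
    after multiplication by it the floors below are exact.\<close>
  define D where "D = (\<Prod>k\<in>K. snd (quotient_of (g (a k))))"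
  have D: "0 < D"
    unfolding D_def by (intro prod_pos) (auto simp: quotient_of_denom_pos')
  have "of_int D * g (a k) \<in> \<int>" if "k \<in> K" for k
  proof -
    obtain p q where pq: "quotient_of (g (a k)) = (p, q)"
      by fastforce
    then have "g (a k) = of_int p / of_int q" "q \<noteq> 0"
      using quotient_of_div quotient_of_denom_pos by (blast, fastforce)
    moreover have "D = q * (\<Prod>k\<in>K - {k}. snd (quotient_of (g (a k))))"
      unfolding D_def using K that pq by (subst prod.remove[of K k]) auto
    ultimately have "of_int D * g (a k) = of_int (p * (\<Prod>k\<in>K - {k}. snd (quotient_of (g (a k)))))"
      by simp
    then show ?thesis
      by (metis Ints_of_int)
  qed
  then have u: "of_int \<lfloor>of_int D * g (a k)\<rfloor> = of_int D * g (a k)" if "k \<in> K" for k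
    using that by simp
  show ?thesis
  proof (rule that[of "\<lambda>k. \<lfloor>of_int D * g (a k)\<rfloor>"], safe)
    show "0 < \<lfloor>of_int D * g (a k0)\<rfloor>"
      using D by (simp add: g1)
    fix z :: "'k \<Rightarrow> int"
    assume "(\<Sum>k\<in>K. a k * of_int (z k)) = 0"
    then have "g (\<Sum>k\<in>K. of_rat (of_int (z k)) * a k) = 0"
      by (simp add: mult.commute)
    then have "(\<Sum>k\<in>K. of_int (z k) * g (a k)) = 0"
      by (simp only: g.sum g.scale)
    then have "(\<Sum>k\<in>K. of_int D * g (a k) * of_int (z k)) = 0"
      by (simp add: mult.assoc mult.commute[of "g _"] flip: sum_distrib_left)
    moreover have "of_int (\<Sum>k\<in>K. \<lfloor>of_int D * g (a k)\<rfloor> * z k) = (\<Sum>k\<in>K. of_int D * g (a k) * of_int (z k))"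
      unfolding of_int_sum of_int_mult by (rule sum.cong[OF refl]) (simp only: u)
    ultimately have "of_int (\<Sum>k\<in>K. \<lfloor>of_int D * g (a k)\<rfloor> * z k) = (0 :: rat)"
      by simp
    then show "(\<Sum>k\<in>K. \<lfloor>of_int D * g (a k)\<rfloor> * z k) = 0"
      by (simp only: of_int_eq_0_iff)
  qed
qed

text \<open>The hypothesis is one relation with real coefficients that holds in every coordinate.
  Integer coefficients that annihilate all the same integer vectors replace them, and the positive
  one at \<open>u\<close> becomes \<open>D\<close>.\<close>

lemma real_combination_imp_integer_combination:
  fixes c :: "'k \<Rightarrow> int^'m"
  assumes K: "finite K" and eq: "to_real u = (\<Sum>k\<in>K. a k *\<^sub>R to_real (c k))"
  obtains D :: nat and w :: "'k \<Rightarrow> int" where "0 < D" "int D *s u = (\<Sum>k\<in>K. w k *s c k)"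
proof -
  \<comment> \<open>\<open>None\<close> is the index of \<open>u\<close>, entered with coefficient 1
    so that its integer coefficient comes out positive.\<close>
  let ?K = "insert None (Some ` K)"
  let ?a = "\<lambda>k. case k of None \<Rightarrow> 1 | Some k \<Rightarrow> - a k"
  obtain v where v: "0 < v None"
    "\<forall>z :: 'k option \<Rightarrow> int. (\<Sum>k\<in>?K. ?a k * of_int (z k)) = 0 \<longrightarrow> (\<Sum>k\<in>?K. v k * z k) = 0"
    by (rule integer_relation_transfer[of ?K None ?a]) (use K in simp_all)
  have sum: "(\<Sum>k\<in>?K. f k) = f None + (\<Sum>k\<in>K. f (Some k))" for f :: "'k option \<Rightarrow> 'b::comm_monoid_add"
    using K by (subst sum.insert) (auto simp: sum.reindex)
  have "(int (nat (v None)) *s u) $ i = (\<Sum>k\<in>K. (- v (Some k)) *s c k) $ i" for i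
  proof -
    have "real_of_int (u $ i) = (\<Sum>k\<in>K. a k * of_int (c k $ i))"
      using arg_cong[OF eq, of "\<lambda>x. x $ i"] by (simp add: to_real_def)
    then show ?thesis
      using v(2)[rule_format, of "\<lambda>k. case k of None \<Rightarrow> u $ i | Some k \<Rightarrow> c k $ i"] v(1)
      by (simp add: sum sum_negf)
  qed
  then show ?thesis
    using v(1) by (intro that[of "nat (v None)" "\<lambda>k. - v (Some k)"]) (auto simp: vec_eq_iff)
qed

interpretation int_vec: Modules.module "(*s) :: int \<Rightarrow> int^'k \<Rightarrow> int^'k"
  by unfold_locales (auto simp: vec_eq_iff algebra_simps)

lemma zspan_superset: "S \<subseteq> zspan S"
  unfolding zspan_def by (rule int_vec.span_superset)

lemma zspan_closed:
  "0 \<in> zspan S" "x \<in> zspan S \<Longrightarrow> y \<in> zspan S \<Longrightarrow> x + y \<in> zspan S" "x \<in> zspan S \<Longrightarrow> - x \<in> zspan S"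
  "x \<in> zspan S \<Longrightarrow> y \<in> zspan S \<Longrightarrow> x - y \<in> zspan S" "x \<in> zspan S \<Longrightarrow> c *s x \<in> zspan S"
  unfolding zspan_def
  by (rule int_vec.span_zero int_vec.span_add int_vec.span_neg int_vec.span_diff int_vec.span_scale; assumption)+

lemma zspan_sum: "(\<And>i. i \<in> I \<Longrightarrow> f i \<in> zspan S) \<Longrightarrow> (\<Sum>i\<in>I. f i) \<in> zspan S"
  unfolding zspan_def by (rule int_vec.span_sum)

text \<open>Over the integers closure under addition and negation already gives closure under
  scalars. Later \<open>T\<close> consists of exponents whose monomial is 1 modulo an ideal.\<close>

lemma zspan_subset_subgroup:
  assumes "S \<subseteq> T" "0 \<in> T" "\<And>x y. x \<in> T \<Longrightarrow> y \<in> T \<Longrightarrow> x + y \<in> T" "\<And>x. x \<in> T \<Longrightarrow> - x \<in> T"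
  shows "zspan S \<subseteq> T"
proof -
  have "c *s x \<in> T" if "x \<in> T" for c x
  proof (induction c rule: int_induct[where k = 0])
    case base
    show ?case using assms(2) by simp
  next
    case (step1 i)
    then show ?case using assms(3) that by (simp add: int_vec.scale_left_distrib)
  next
    case (step2 i)
    have "(i - 1) *s x = i *s x + - x"
      by (simp add: vec_eq_iff algebra_simps)
    with step2 show ?case using assms(3,4) that by metis
  qed
  then have "int_vec.subspace T"
    using assms by (auto intro: int_vec.subspaceI)
  with assms(1) show ?thesis
    unfolding zspan_def by (rule int_vec.span_minimal)
qed

text \<open>Translation by \<open>x\<close> permutes the classes when they are finite in number.
  Summing \<open>r q + x - r (\<tau> q)\<close> over all of them cancels the representatives and
  leaves the index times \<open>x\<close>, while each summand lies in \<open>N\<close>.\<close>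

lemma lattice_index_smult_mem:
  fixes M N :: "(int^'k) set"
  assumes M: "0 \<in> M" "\<And>x y. x \<in> M \<Longrightarrow> y \<in> M \<Longrightarrow> x + y \<in> M"
    and N: "0 \<in> N" "\<And>x y. x \<in> N \<Longrightarrow> y \<in> N \<Longrightarrow> x + y \<in> N" "\<And>x. x \<in> N \<Longrightarrow> - x \<in> N"
    and x: "x \<in> M"
  shows "int (lattice_index M N) *s x \<in> N"
proof -
  define E where "E = {(x, y). x \<in> M \<and> y \<in> M \<and> x - y \<in> N}"
  define Q where "Q = M // E"
  have "equiv M E"
  proof (rule equivI)
    show "E \<subseteq> M \<times> M" "refl_on M E"
      using N(1) by (auto simp: E_def refl_on_def)
    show "sym E"
      using N(3) by (force simp: E_def sym_def)
    show "trans E"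
      using N(2) by (force simp: E_def trans_def)
  qed
  show ?thesis
  proof (cases "finite Q")
    \<comment> \<open>\<open>card\<close> of an infinite quotient is 0, so the multiple in question
      is the zero vector.\<close>
    case False
    then show ?thesis
      using N(1) by (simp add: lattice_index_def flip: E_def Q_def)
  next
    case True
    define r where "r q = (SOME y. y \<in> q)" for q :: "(int^'k) set"
    have r: "r q \<in> q" "r q \<in> M" "q = E `` {r q}" if q: "q \<in> Q" for q
    proof -
      show "r q \<in> q"
        unfolding r_def using in_quotient_imp_non_empty[OF \<open>equiv M E\<close>] q Q_def by (metis some_in_eq)
      then show "r q \<in> M"
        using in_quotient_imp_subset[OF \<open>equiv M E\<close>] q Q_def by blast
      obtain a where "q = E `` {a}"
        using q[unfolded Q_def] by (rule quotientE)
      with \<open>r q \<in> q\<close> show "q = E `` {r q}"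
        using equiv_class_eq[OF \<open>equiv M E\<close>, of a "r q"] by simp
    qed
    define \<tau> where "\<tau> q = E `` {r q + x}" for q
    have \<tau>Q: "\<tau> q \<in> Q" if "q \<in> Q" for q
      unfolding \<tau>_def Q_def using r(2)[OF that] x M(2) by (intro quotientI) auto
    have "inj_on \<tau> Q"
    proof (rule inj_onI)
      fix q q' assume q: "q \<in> Q" "q' \<in> Q" "\<tau> q = \<tau> q'"
      then have "(r q + x, r q' + x) \<in> E"
        using r(2) x M(2) \<open>equiv M E\<close> unfolding \<tau>_def
        by (intro eq_equiv_class[OF _ \<open>equiv M E\<close>]) auto
      then have "(r q, r q') \<in> E"
        using r(2)[OF q(1)] r(2)[OF q(2)] by (simp add: E_def)
      then have "E `` {r q} = E `` {r q'}"
        by (rule equiv_class_eq[OF \<open>equiv M E\<close>])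
      then show "q = q'"
        unfolding r(3)[OF q(1), symmetric] r(3)[OF q(2), symmetric] .
    qed
    then have bij: "bij_betw \<tau> Q Q"
      using True \<tau>Q by (simp add: bij_betw_def endo_inj_surj image_subsetI)
    have "r q + x - r (\<tau> q) \<in> N" if "q \<in> Q" for q
      using r(1)[OF \<tau>Q[OF that]] by (auto simp: \<tau>_def E_def)
    then have "(\<Sum>q\<in>Q. r q + x - r (\<tau> q)) \<in> N"
      using True
    proof (induction Q rule: infinite_finite_induct)
      case (insert q F)
      then show ?case using N(2) by auto
    qed (use N(1) in auto)
    moreover have "(\<Sum>q\<in>Q. r q + x - r (\<tau> q)) = int (card Q) *s x"
      (is "?l = ?r")
    proof -
      have "?l $ i = ?r $ i" for i
        using arg_cong[OF sum.reindex_bij_betw[OF bij, of r], of "\<lambda>v. v $ i"]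
        by (simp add: sum.distrib sum_subtractf of_nat_index)
      then show ?thesis
        by (simp add: vec_eq_iff)
    qed
    ultimately show ?thesis
      by (simp add: lattice_index_def flip: E_def Q_def)
  qed
qed

text \<open>The spanning vectors used are images of integer vectors, so their real coefficients can
  be made integral at the cost of a factor \<open>D\<close>.\<close>

lemma span_to_real_imp_multiple_in_zspan:
  assumes "to_real u \<in> span (to_real ` S)"
  obtains D :: nat where "0 < D" "int D *s u \<in> zspan S"
proof -
  obtain T a where T: "finite T" "T \<subseteq> to_real ` S" "to_real u = (\<Sum>x\<in>T. a x *\<^sub>R x)"
    using assms by (auto simp: span_explicit)
  obtain c where c: "\<And>x. x \<in> T \<Longrightarrow> c x \<in> S \<and> to_real (c x) = x"
    using T(2) by (metis (no_types, opaque_lifting) image_iff subsetD)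
  obtain D w where "0 < D" "int D *s u = (\<Sum>x\<in>T. w x *s c x)"
    by (rule real_combination_imp_integer_combination[OF T(1), of u a c]) (use T(3) c in simp_all)
  moreover have "(\<Sum>x\<in>T. w x *s c x) \<in> zspan S"
    using c zspan_superset by (intro zspan_sum zspan_closed(5)) blast
  ultimately show ?thesis
    using that by simp
qed

lemma to_real_smult: "to_real (c *s x) = of_int c *\<^sub>R to_real x"
  by (simp add: to_real_def vec_eq_iff)

lemma multiple_in_imp_span_to_real:
  assumes "0 < D" "int D *s u \<in> S"
  shows "to_real u \<in> span (to_real ` S)"
proof -
  have "to_real u = inverse (real D) *\<^sub>R to_real (int D *s u)"
    using assms(1) by (simp add: to_real_smult)
  then show ?thesis
    using assms(2) by (metis imageI span_base span_scale)
qed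

text \<open>Equal ranks force equal real spans, so every integer vector lies in the real span of the
  sublattice; clearing coefficients gives the multiple.\<close>

lemma full_rank_imp_multiple_mem:
  fixes S :: "(int^'k) set"
  assumes "full_rank_sublattice (zspan S) UNIV"
  obtains D :: nat where "0 < D" "int D *s u \<in> zspan S"
proof -
  have "range to_real \<subseteq> span (to_real ` zspan S)"
  proof -
    have "dim (to_real ` zspan S) = dim (range (to_real :: int^'k \<Rightarrow> _))"
      using assms by (simp add: full_rank_sublattice_def lattice_rank_def)
    then have "span (to_real ` zspan S) = span (range to_real)"
      by (intro dim_eq_span) auto
    then show ?thesis
      using span_superset[of "range (to_real :: int^'k \<Rightarrow> _)"] by simp
  qed
  then have "to_real u \<in> span (to_real ` zspan S)"
    by blast
  then obtain D :: nat where "0 < D" "int D *s u \<in> zspan (zspan S)"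
    by (rule span_to_real_imp_multiple_in_zspan)
  then show ?thesis
    by (intro that) (simp_all add: zspan_def int_vec.span_span)
qed

text \<open>The family has as many members as the ambient dimension, so the real linear map it
  defines is onto once it is injective. Independence is known only for integer coefficients; a
  nonzero real kernel vector would be turned into a nonzero integer relation.\<close>

lemma independent_family_spans:
  fixes c :: "'k::finite \<Rightarrow> int^'k"
  assumes indep: "\<And>u. (\<Sum>k\<in>UNIV. u k *s c k) = 0 \<Longrightarrow> \<forall>k. u k = 0"
  obtains D :: nat and w where "0 < D" "int D *s x = (\<Sum>k\<in>UNIV. w k *s c k)"
proof -
  define f where "f a = (\<Sum>k\<in>UNIV. a $ k *\<^sub>R to_real (c k))" for a :: "real^'k"
  have "linear f"
    unfolding f_def by (intro linearI) (simp_all add: scaleR_left_distrib sum.distrib scaleR_sum_right)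
  moreover have "a = 0" if "f a = 0" for a
  proof (rule ccontr)
    assume "a \<noteq> 0"
    then obtain k0 where k0: "a $ k0 \<noteq> 0"
      by (auto simp: vec_eq_iff)
    obtain u :: "'k \<Rightarrow> int" where u: "0 < u k0"
      "\<forall>z :: 'k \<Rightarrow> int. (\<Sum>k\<in>UNIV. a $ k * of_int (z k)) = 0 \<longrightarrow> (\<Sum>k\<in>UNIV. u k * z k) = 0"
      by (rule integer_relation_transfer[of UNIV k0 "($) a"]) (use k0 in simp_all)
    have "(\<Sum>k\<in>UNIV. a $ k * of_int (c k $ i)) = 0" for i
      using arg_cong[OF that, of "\<lambda>x. x $ i"] by (simp add: f_def to_real_def)
    then have "(\<Sum>k\<in>UNIV. u k *s c k) = 0"
      using u(2) by (simp add: vec_eq_iff)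
    with indep u(1) show False
      by fastforce
  qed
  ultimately have "surj f"
    by (simp add: linear_injective_0 linear_injective_imp_surjective)
  then obtain a where a: "to_real x = f a"
    by (metis surjD)
  obtain D w where "0 < D" "int D *s x = (\<Sum>k\<in>UNIV. w k *s c k)"
    by (rule real_combination_imp_integer_combination[of UNIV x "($) a" c]) (use a in \<open>simp_all add: f_def\<close>)
  then show ?thesis
    by (rule that)
qed

text \<open>The lattice homomorphism taking the \<open>k\<close>-th unit vector to
  \<open>c k\<close>. For \<open>c = case_sum v w\<close> its kernel is
  \<open>linear_relations v w\<close> and its image contains the span of the exponents, so the
  lattice conditions become conditions on kernel and image.\<close>

definition combination :: "('k::finite \<Rightarrow> int^'n) \<Rightarrow> int^'k \<Rightarrow> int^'n"
  where "combination c r = (\<Sum>k\<in>UNIV. r $ k *s c k)"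

lemma combination_0 [simp]: "combination c 0 = 0"
  by (simp add: combination_def)

lemma combination_add: "combination c (r + s) = combination c r + combination c s"
  by (simp add: combination_def int_vec.scale_left_distrib sum.distrib)

lemma combination_minus: "combination c (- r) = - combination c r"
  by (simp add: combination_def vec_eq_iff sum_negf)

lemma combination_diff: "combination c (r - s) = combination c r - combination c s"
  by (metis combination_add combination_minus diff_conv_add_uminus)

lemma combination_smult: "combination c (a *s r) = a *s combination c r"
  by (simp add: combination_def vec_eq_iff sum_distrib_left mult.assoc)

lemma combination_sum: "combination c (\<Sum>i\<in>I. f i) = (\<Sum>i\<in>I. combination c (f i))"
  by (induction I rule: infinite_finite_induct) (auto simp: combination_add)

lemma combination_axis: "combination c (axis k 1) = c k"
proof -
  have "combination c (axis k 1) = (\<Sum>j\<in>UNIV. if j = k then c k else 0)"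
    unfolding combination_def by (rule sum.cong) (auto simp: axis_def)
  then show ?thesis by simp
qed

lemma combination_axes: "combination (\<lambda>k. axis k 1) u = u"
  by (simp add: combination_def vec_eq_iff axis_def if_distrib cong: if_cong)

lemma sum_UNIV_Plus:
  "(\<Sum>k\<in>UNIV. f k) = (\<Sum>m\<in>UNIV. f (Inl m)) + (\<Sum>i\<in>UNIV. f (Inr i))"
  for f :: "'l::finite + 'n::finite \<Rightarrow> 'a::comm_monoid_add"
  by (simp add: UNIV_Plus_UNIV[symmetric] sum.Plus del: UNIV_Plus_UNIV)

lemma linear_relations_eq: "linear_relations v w = {r. combination (case_sum v w) r = 0}"
  by (simp add: linear_relations_def combination_def sum_UNIV_Plus)

text \<open>By linearity \<open>\<psi> p\<close> is the combination of the
  \<open>\<psi> (axis m 1)\<close> with the entries of \<open>p\<close> as coefficients, and the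
  image of a homomorphism is a subgroup.\<close>

lemma zspan_subset_combinations:
  assumes \<psi>: "module_hom (*s) (*s) \<psi>"
  shows "zspan (\<psi> ` P \<union> range w) \<subseteq> range (combination (case_sum (\<lambda>m. \<psi> (axis m 1)) w))"
proof (rule zspan_subset_subgroup)
  interpret Modules.module_hom "(*s)" "(*s)" \<psi>
    by (rule \<psi>)
  let ?c = "combination (case_sum (\<lambda>m. \<psi> (axis m 1)) w)"
  have "\<psi> p = ?c (\<chi> k. case k of Inl m \<Rightarrow> p $ m | Inr i \<Rightarrow> 0)" for p
  proof -
    have "\<psi> p = \<psi> (combination (\<lambda>m. axis m 1) p)"
      by (simp add: combination_axes)
    then show ?thesis
      by (simp add: combination_def sum_UNIV_Plus sum scale)
  qed
  moreover have "w i = ?c (axis (Inr i) 1)" for i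
    by (simp add: combination_axis)
  ultimately show "\<psi> ` P \<union> range w \<subseteq> range ?c"
    by blast
  show "0 \<in> range ?c"
    using combination_0 by (rule range_eqI[OF sym])
  show "x + y \<in> range ?c" if "x \<in> range ?c" "y \<in> range ?c" for x y
    using that by (auto simp flip: combination_add)
  show "- x \<in> range ?c" if "x \<in> range ?c" for x
    using that by (auto simp flip: combination_minus)
qed

text \<open>
  The \<open>\<rho> j\<close> together with preimages of multiples of the basis vectors are as many independent
  vectors as the rank of \<open>\<int>\<^sup>\<ell> \<oplus> \<int>\<^sup>n\<close>, so they span a sublattice of full rank.
\<close>

lemma relation_multiple_in_zspan:
  fixes \<rho> :: "'l::finite \<Rightarrow> int^('l + 'n::finite)" and c :: "'l + 'n \<Rightarrow> int^'n"
  assumes N: "0 < N" and s: "\<And>k. combination c (s k) = int N *s axis k 1"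
    and \<rho>: "\<And>j. combination c (\<rho> j) = 0" and indep: "inj \<rho>" "\<not> module.dependent (*s) (range \<rho>)"
    and r: "combination c r = 0"
  obtains D :: nat where "0 < D" "int D *s r \<in> zspan (range \<rho>)"
proof -
  \<comment> \<open>Applying \<open>combination c\<close> kills the \<open>\<rho> j\<close> and
    leaves \<open>N\<close> times the coefficients at the \<open>s k\<close>. These must therefore
    vanish, both in a relation and in a representation of a multiple of \<open>r\<close>.\<close>
  have push: "combination c (\<Sum>k\<in>UNIV. u k *s case_sum \<rho> s k) = int N *s (\<chi> k. u (Inr k))" for u
    by (simp add: sum_UNIV_Plus combination_add combination_sum combination_smult s \<rho>)
      (simp add: vec_eq_iff axis_def if_distrib cong: if_cong)
  have independent: "\<forall>k. u k = 0" if eq: "(\<Sum>k\<in>UNIV. u k *s case_sum \<rho> s k) = 0" for u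
  proof -
    have inr: "u (Inr k) = 0" for k
      using push[of u] N unfolding eq by (simp add: vec_eq_iff)
    have "(\<Sum>j\<in>UNIV. u (Inl j) *s \<rho> j) = 0"
      using eq by (simp add: sum_UNIV_Plus inr)
    then have "(\<Sum>x\<in>range \<rho>. u (Inl (inv_into UNIV \<rho> x)) *s x) = 0"
      using indep(1) by (simp add: sum.reindex)
    then have "\<forall>x\<in>range \<rho>. u (Inl (inv_into UNIV \<rho> x)) = 0"
      using indep(2) int_vec.dependent_finite[of "range \<rho>"] by auto
    then have "u (Inl j) = 0" for j
      using indep(1) by simp
    with inr show ?thesis
      by (metis sum.exhaust)
  qed
  obtain D w where D: "0 < D" "int D *s r = (\<Sum>k\<in>UNIV. w k *s case_sum \<rho> s k)"
    by (rule independent_family_spans[where x = r, OF independent])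
  have "w (Inr k) = 0" for k
    using push[of w] N unfolding D(2)[symmetric] combination_smult r by (simp add: vec_eq_iff)
  then have "int D *s r = (\<Sum>j\<in>UNIV. w (Inl j) *s \<rho> j)"
    using D(2) by (simp add: sum_UNIV_Plus)
  also have "\<dots> \<in> zspan (range \<rho>)"
    using zspan_superset by (intro zspan_sum zspan_closed(5)) blast
  finally show ?thesis
    using D(1) that by blast
qed

section \<open>The systems over the real numbers\<close>

text \<open>Equality of classes in the stalk, phrased for functions. Analyticity of both sides is
  included so that chains of congruences carry it along.\<close>

definition germ_eq :: "('j::finite \<Rightarrow> real^'n \<Rightarrow> real) \<Rightarrow> real^'n \<Rightarrow> (real^'n \<Rightarrow> real) \<Rightarrow> (real^'n \<Rightarrow> real) \<Rightarrow> bool"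
  where "germ_eq g z f f' \<longleftrightarrow>
    real_analytic_at f z \<and> real_analytic_at f' z \<and> (\<lambda>x. f x - f' x) \<in> germ_ideal g z"

lemma germ_eq_refl: "real_analytic_at f z \<Longrightarrow> germ_eq g z f f"
  by (simp add: germ_eq_def germ_ideal_zero)

lemma germ_eq_trans: "germ_eq g z f f' \<Longrightarrow> germ_eq g z f' f'' \<Longrightarrow> germ_eq g z f f''"
  using germ_ideal_add[of "\<lambda>x. f x - f' x" g z "\<lambda>x. f' x - f'' x"] by (simp add: germ_eq_def)

lemma germ_eq_value: "germ_eq g z f f' \<Longrightarrow> \<forall>j. g j z = 0 \<Longrightarrow> f z = f' z"
  using germ_ideal_vanishes[of "\<lambda>x. f x - f' x" g z] by (simp add: germ_eq_def)

lemma germ_eq_eventually: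
  assumes "real_analytic_at f z" "\<forall>\<^sub>F x in nhds z. f x = f' x"
  shows "germ_eq g z f f'"
proof -
  have "\<forall>\<^sub>F x in nhds z. 0 = f x - f' x"
    using assms(2) by eventually_elim simp
  then have "(\<lambda>x. f x - f' x) \<in> germ_ideal g z"
    by (rule germ_ideal_cong[OF germ_ideal_zero])
  then show ?thesis
    unfolding germ_eq_def using assms(1) real_analytic_at_cong[OF assms] by blast
qed

lemma germ_eq_mult:
  assumes "germ_eq g z f f'" "germ_eq g z k k'"
  shows "germ_eq g z (\<lambda>x. f x * k x) (\<lambda>x. f' x * k' x)"
proof -
  have "(\<lambda>x. k x * (f x - f' x) + f' x * (k x - k' x)) \<in> germ_ideal g z"
    using assms by (intro germ_ideal_add germ_ideal_mult) (auto simp: germ_eq_def)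
  moreover have "k x * (f x - f' x) + f' x * (k x - k' x) = f x * k x - f' x * k' x" for x
    by (simp add: algebra_simps)
  ultimately show ?thesis
    using assms by (auto simp: germ_eq_def)
qed

lemma germ_eq_power: "germ_eq g z f f' \<Longrightarrow> germ_eq g z (\<lambda>x. f x ^ N) (\<lambda>x. f' x ^ N)"
proof (induction N)
  case 0
  show ?case by (simp add: germ_eq_refl)
next
  case (Suc N)
  from germ_eq_mult[OF Suc.prems Suc.IH[OF Suc.prems]] show ?case by simp
qed

lemma germ_eq_prod:
  "(\<And>a. a \<in> A \<Longrightarrow> germ_eq g z (f a) (f' a)) \<Longrightarrow> germ_eq g z (\<lambda>x. \<Prod>a\<in>A. f a x) (\<lambda>x. \<Prod>a\<in>A. f' a x)"
  by (induction A rule: infinite_finite_induct) (simp_all add: germ_eq_refl germ_eq_mult)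

lemma eventually_nonzero:
  assumes "real_analytic_at f z" "f z \<noteq> 0"
  shows "\<forall>\<^sub>F x in nhds z. f x \<noteq> 0"
proof -
  have "(f \<longlongrightarrow> f z) (nhds z)"
    using real_analytic_at_imp_isCont[OF assms(1)] by (simp add: isCont_def tendsto_at_iff_tendsto_nhds)
  then show ?thesis
    using assms(2) by (rule tendsto_imp_eventually_ne)
qed

text \<open>Near \<open>z\<close> the difference of the inverses is \<open>f - f'\<close> times the
  analytic function \<open>- inverse (f x) * inverse (f' x)\<close>.\<close>

lemma germ_eq_inverse:
  assumes eq: "germ_eq g z f f'" and nz: "f z \<noteq> 0" "f' z \<noteq> 0"
  shows "germ_eq g z (\<lambda>x. inverse (f x)) (\<lambda>x. inverse (f' x))"
proof -
  have f: "real_analytic_at f z" "real_analytic_at f' z" "(\<lambda>x. f x - f' x) \<in> germ_ideal g z"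
    using eq by (auto simp: germ_eq_def)
  have inv: "real_analytic_at (\<lambda>x. inverse (f x)) z" "real_analytic_at (\<lambda>x. inverse (f' x)) z"
    using f nz by auto
  then have "(\<lambda>x. - (inverse (f x) * inverse (f' x)) * (f x - f' x)) \<in> germ_ideal g z"
    using f(3) by (intro germ_ideal_mult) auto
  moreover have "\<forall>\<^sub>F x in nhds z. - (inverse (f x) * inverse (f' x)) * (f x - f' x) = inverse (f x) - inverse (f' x)"
    using eventually_nonzero[OF f(1) nz(1)] eventually_nonzero[OF f(2) nz(2)]
    by eventually_elim (simp add: field_simps)
  ultimately have "(\<lambda>x. inverse (f x) - inverse (f' x)) \<in> germ_ideal g z"
    by (rule germ_ideal_cong)
  with inv show ?thesis
    unfolding germ_eq_def by blast
qed

lemma germ_eq_power_int: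
  assumes "germ_eq g z f f'" "f z \<noteq> 0" "f' z \<noteq> 0"
  shows "germ_eq g z (\<lambda>x. f x powi k) (\<lambda>x. f' x powi k)"
  using germ_eq_power[OF assms(1)] germ_eq_power[OF germ_eq_inverse[OF assms]]
  by (cases "0 \<le> k") (simp_all add: power_int_def)

text \<open>The cofactor of \<open>f - 1\<close> in \<open>f ^ M - 1\<close> has value \<open>M\<close> where \<open>f = 1\<close>, so it is a unit.\<close>

lemma germ_eq_one_if_power:
  assumes f: "real_analytic_at f z" and eq: "germ_eq g z (\<lambda>x. f x ^ M) (\<lambda>_. 1)" and "f z = 1" "0 < M"
  shows "germ_eq g z f (\<lambda>_. 1)"
proof -
  define q where "q x = (\<Sum>i<M. f x ^ i)" for x
  have q: "real_analytic_at q z"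
    unfolding q_def using f by auto
  have qz: "q z \<noteq> 0"
    using assms(3,4) by (simp add: q_def)
  have "(\<lambda>x. inverse (q x) * (f x ^ M - 1)) \<in> germ_ideal g z"
    using eq q qz by (intro germ_ideal_mult) (auto simp: germ_eq_def)
  moreover have "\<forall>\<^sub>F x in nhds z. inverse (q x) * (f x ^ M - 1) = f x - 1"
    using eventually_nonzero[OF q qz]
  proof eventually_elim
    case (elim x)
    have "f x ^ M - 1 = (f x - 1) * q x"
      by (simp add: q_def power_diff_1_eq)
    with elim show ?case by simp
  qed
  ultimately have "(\<lambda>x. f x - 1) \<in> germ_ideal g z"
    by (rule germ_ideal_cong)
  with f show ?thesis
    by (simp add: germ_eq_def)
qed

text \<open>Monomials in an arbitrary finite family, so that one calculus covers both the monomials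
  in \<open>x\<close> and those in the \<open>y m\<close> and \<open>h i\<close> together, where the
  index type is a sum.\<close>

definition pmon :: "('k::finite \<Rightarrow> real) \<Rightarrow> int^'k \<Rightarrow> real"
  where "pmon t r = (\<Prod>k\<in>UNIV. t k powi (r $ k))"

lemma pmon_0 [simp]: "pmon t 0 = 1"
  by (simp add: pmon_def)

lemma pmon_add: "(\<And>k. t k \<noteq> 0) \<Longrightarrow> pmon t (r + s) = pmon t r * pmon t s"
  by (simp add: pmon_def power_int_add prod.distrib)

lemma pmon_nonzero: "(\<And>k. t k \<noteq> 0) \<Longrightarrow> pmon t r \<noteq> 0"
  by (simp add: pmon_def)

lemma pmon_minus: "pmon t (- r) = inverse (pmon t r)"
  by (simp add: pmon_def power_int_minus o_def flip: prod_inversef)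

lemma pmon_smult: "pmon t (c *s r) = pmon t r powi c"
proof -
  have "(\<Prod>k\<in>A. f k) powi c = (\<Prod>k\<in>A. f k powi c)" for A and f :: "'a \<Rightarrow> real"
    by (induction A rule: infinite_finite_induct) (simp_all add: power_int_mult_distrib)
  then show ?thesis
    by (simp add: pmon_def power_int_mult mult.commute[of c])
qed

lemma pmon_axis: "pmon t (axis k 1) = t k"
proof -
  have "pmon t (axis k 1) = (\<Prod>j\<in>UNIV. if j = k then t k else 1)"
    unfolding pmon_def by (rule prod.cong) (auto simp: axis_def)
  then show ?thesis by simp
qed

lemma pmon_sum:
  assumes "\<And>k. t k \<noteq> 0"
  shows "pmon t (\<Sum>i\<in>I. f i) = (\<Prod>i\<in>I. pmon t (f i))"
  by (induction I rule: infinite_finite_induct) (simp_all add: pmon_add assms)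

lemma pmon_combination:
  "(\<And>k. t k \<noteq> 0) \<Longrightarrow> pmon t (combination c r) = pmon (\<lambda>k. pmon t (c k)) r"
  by (simp add: combination_def pmon_sum pmon_smult) (simp add: pmon_def)

lemma pmon_power_base: "pmon (\<lambda>k. t k ^ N) r = pmon t r ^ N"
proof -
  have "(t k ^ N) powi (r $ k) = (t k powi (r $ k)) ^ N" for k
    by (metis mult.commute power_int_mult power_int_of_nat)
  then show ?thesis
    by (simp add: pmon_def prod_power_distrib)
qed

lemma monomial_eq: "monomial x u = pmon (($) x) u"
  by (simp add: monomial_def pmon_def)

lemma real_analytic_at_pmon:
  "(\<And>k. real_analytic_at (\<lambda>x. t x k) z) \<Longrightarrow> (\<And>k. t z k \<noteq> 0) \<Longrightarrow> real_analytic_at (\<lambda>x. pmon (t x) r) z"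
  unfolding pmon_def by (intro real_analytic_at_prod real_analytic_at_power_int)

lemma germ_eq_pmon:
  assumes "\<And>k. germ_eq g z (\<lambda>x. t x k) (\<lambda>x. t' x k)" "\<And>k. t z k \<noteq> 0" "\<And>k. t' z k \<noteq> 0"
  shows "germ_eq g z (\<lambda>x. pmon (t x) r) (\<lambda>x. pmon (t' x) r)"
  unfolding pmon_def by (rule germ_eq_prod) (rule germ_eq_power_int[OF assms])

lemma real_analytic_at_h_real: "real_analytic_at (h_real d c) z"
proof -
  have "real_analytic_at (\<lambda>y. \<Sum>p\<in>simplex_points d. c p * (\<Prod>m\<in>UNIV. (y $ m) ^ nat (p $ m))) z"
    by (intro real_analytic_at_sum real_analytic_at_mult real_analytic_at_prod real_analytic_at_power
        real_analytic_at_const real_analytic_at_coord)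
  then show ?thesis
    by (simp add: h_real_def[abs_def] poly_value_def)
qed

lemma prod_UNIV_Plus:
  "(\<Prod>k\<in>UNIV. f k) = (\<Prod>m\<in>UNIV. f (Inl m)) * (\<Prod>i\<in>UNIV. f (Inr i))"
  for f :: "'l::finite + 'n::finite \<Rightarrow> 'a::comm_monoid_mult"
  by (simp add: UNIV_Plus_UNIV[symmetric] prod.Plus del: UNIV_Plus_UNIV)

text \<open>Positive reals and nonzero reals are both stable under products, integer powers and
  \<open>root N\<close>; the parameter lets one argument treat both domains.\<close>

definition admissible :: "bool \<Rightarrow> real \<Rightarrow> bool"
  where "admissible pos t \<longleftrightarrow> (if pos then 0 < t else t \<noteq> 0)"

lemma admissible_nonzero: "admissible pos t \<Longrightarrow> t \<noteq> 0"
  by (auto simp: admissible_def split: if_splits)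

lemma admissible_powi: "admissible pos t \<Longrightarrow> admissible pos (t powi k)"
  by (auto simp: admissible_def split: if_splits)

lemma admissible_prod: "(\<And>k. k \<in> A \<Longrightarrow> admissible pos (t k)) \<Longrightarrow> admissible pos (\<Prod>k\<in>A. t k)"
  by (cases pos) (auto simp: admissible_def intro: prod_pos, cases "finite A", auto)

lemma admissible_pmon: "(\<And>k. admissible pos (t k)) \<Longrightarrow> admissible pos (pmon t r)"
  unfolding pmon_def by (intro admissible_prod admissible_powi)

lemma admissible_root: "admissible pos t \<Longrightarrow> 0 < N \<Longrightarrow> admissible pos (root N t)"
  by (auto simp: admissible_def split: if_splits)

lemma admissible_root_power:
  "admissible pos t \<Longrightarrow> 0 < N \<Longrightarrow> pos \<or> odd N \<Longrightarrow> root N t ^ N = t"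
  by (auto simp: admissible_def odd_real_root_pow split: if_splits)

text \<open>A negative \<open>t\<close> has negative odd powers, and among the positive reals 1 is
  the only root of unity.\<close>

lemma admissible_power_eq_1:
  assumes "admissible pos t" "0 < M" "pos \<or> odd M" "t ^ M = 1"
  shows "t = 1"
proof (cases "0 < t")
  case True
  with assms show ?thesis
    by (metis less_imp_le power_eq_1_iff real_root_one real_root_power_cancel)
next
  case False
  with assms have "odd M" "t < 0"
    by (auto simp: admissible_def split: if_splits)
  with assms(4) show ?thesis
    by (metis not_one_less_zero power_less_zero_eq)
qed

lemma eventually_admissible:
  assumes "real_analytic_at f z" "admissible pos (f z)"
  shows "\<forall>\<^sub>F x in nhds z. admissible pos (f x)"
  using eventually_nhds_pos[OF assms(1)] eventually_nonzero[OF assms(1)] assms(2)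
  by (auto simp: admissible_def split: if_splits)

text \<open>
  The case \<open>pos\<close> is the one of positive solutions, where all roots exist; otherwise the solutions
  are merely nonzero and only roots of odd order \<open>N\<close> and \<open>M r\<close> are used.  The inverse of
  \<open>x \<mapsto> (x\<^bsup>v m\<^esup>)\<close> maps \<open>y\<close> to the point with \<open>k\<close>-th coordinate the \<open>N\<close>-th root of
  \<open>y\<^bsup>\<beta>\<^esup> h(y)\<^bsup>\<gamma>\<^esup>\<close>, where \<open>(\<beta>, \<gamma>) = s k\<close>.
\<close>

lemma real_systems_isomorphic:
  fixes v :: "'l::finite \<Rightarrow> int^'n::finite" and w :: "'n \<Rightarrow> int^'n" and b :: "'n \<Rightarrow> int^'l \<Rightarrow> real"
    and \<rho> :: "'l \<Rightarrow> int^('l + 'n)" and pos :: bool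
  assumes \<rho>: "\<And>j. \<rho> j \<in> linear_relations v w"
    and N: "0 < N" "pos \<or> odd N" and s: "\<And>k. combination (case_sum v w) (s k) = int N *s axis k 1"
    and M: "\<And>r. r \<in> linear_relations v w \<Longrightarrow> \<exists>M>0. (pos \<or> odd M) \<and> int M *s r \<in> zspan (range \<rho>)"
  shows "analytic_subscheme {x. \<forall>i. admissible pos (x $ i)} (F_real d b v w) \<cong>\<^sub>s
    analytic_subscheme {y. (\<forall>m. admissible pos (y $ m)) \<and> (\<forall>i. admissible pos (h_real d (b i) y))}
      (\<lambda>j. G_real d b (\<rho> j))"
proof -
  define c where "c = case_sum v w"
  \<comment> \<open>The variables and the values \<open>h i\<close> as one family. The system (G)
    becomes \<open>pmon (\<eta> y) (\<rho> j) = 1\<close>, and its domain says that all members of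
    the family are admissible.\<close>
  define \<eta> where "\<eta> y k = (case k of Inl m \<Rightarrow> y $ m | Inr i \<Rightarrow> h_real d (b i) y)" for y :: "real^'l" and k :: "'l + 'n"
  define F where "F = F_real d b v w"
  define G where "G j = G_real d b (\<rho> j)" for j
  define \<phi> where "\<phi> x = (\<chi> m. pmon (($) x) (v m))" for x :: "real^'n"
  define \<psi> where "\<psi> y = (\<chi> k. root N (pmon (\<eta> y) (s k)))" for y :: "real^'l"
  have s: "combination c (s k) = int N *s axis k 1" for k
    using s by (simp add: c_def)
  have G_eq: "G j y = pmon (\<eta> y) (\<rho> j) - 1" for j y
    by (simp add: G_def G_real_def pmon_def prod_UNIV_Plus \<eta>_def)
  have F_eq: "F i x = h_real d (b i) (\<phi> x) - pmon (($) x) (w i)" for i x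
    by (simp add: F_def F_real_def \<phi>_def monomial_eq)
  have relations: "linear_relations v w = {r. combination c r = 0}"
    by (simp add: linear_relations_eq c_def)
  have \<eta>_analytic: "real_analytic_at (\<lambda>y. \<eta> y k) z" for k z
    by (cases k) (simp_all add: \<eta>_def real_analytic_at_h_real)
  have domain: "(\<forall>m. admissible pos (y $ m)) \<and> (\<forall>i. admissible pos (h_real d (b i) y)) \<longleftrightarrow> (\<forall>k. admissible pos (\<eta> y k))" for y
    by (auto simp: \<eta>_def split: sum.splits)
  define Z where "Z = {x. (\<forall>i. admissible pos (x $ i)) \<and> (\<forall>i. F i x = 0)}"
  define Z' where "Z' = {y. (\<forall>k. admissible pos (\<eta> y k)) \<and> (\<forall>j. G j y = 0)}"

  have x_adm: "admissible pos (pmon (($) x) u)" if "x \<in> Z" for x u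
    using that by (intro admissible_pmon) (simp add: Z_def)
  have x_nz: "x $ i \<noteq> 0" if "x \<in> Z" for x i
    by (rule admissible_nonzero[of pos]) (use that in \<open>simp add: Z_def\<close>)
  have F0: "\<forall>i. F i x = 0" if "x \<in> Z" for x
    using that by (simp add: Z_def)
  have G0: "\<forall>j. G j y = 0" if "y \<in> Z'" for y
    using that by (simp add: Z'_def)
  have \<eta>_adm: "admissible pos (\<eta> y k)" if "y \<in> Z'" for y k
    using that by (simp add: Z'_def)
  have \<eta>_nz: "\<eta> y k \<noteq> 0" if "y \<in> Z'" for y k
    using \<eta>_adm[OF that] by (rule admissible_nonzero)

  have \<phi>_analytic: "real_analytic_at (\<lambda>x. \<phi> x $ m) z" if "z \<in> Z" for z m
    using x_nz[OF that] by (simp add: \<phi>_def real_analytic_at_pmon)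
  have \<eta>\<phi>_analytic: "real_analytic_at (\<lambda>x. \<eta> (\<phi> x) k) z" if "z \<in> Z" for z k
    by (rule real_analytic_at_compose[OF \<eta>_analytic \<phi>_analytic[OF that]])
  \<comment> \<open>For \<open>Inl m\<close> this holds by the choice of \<open>\<phi>\<close>; for
    \<open>Inr i\<close> the difference of the two sides is the generator
    \<open>F i\<close>.\<close>
  have \<eta>\<phi>: "germ_eq F z (\<lambda>x. \<eta> (\<phi> x) k) (\<lambda>x. pmon (($) x) (c k))" if z: "z \<in> Z" for z k
  proof (cases k)
    case (Inl m)
    then show ?thesis
      using \<phi>_analytic[OF z] by (simp add: \<eta>_def \<phi>_def c_def germ_eq_refl)
  next
    case (Inr i)
    have "real_analytic_at (\<lambda>x. \<eta> (\<phi> x) k) z" "real_analytic_at (\<lambda>x. pmon (($) x) (w i)) z"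
      using \<eta>\<phi>_analytic[OF z] x_nz[OF z] by (simp_all add: real_analytic_at_pmon)
    moreover from this have "(\<lambda>x. F i x) \<in> germ_ideal F z"
      using Inr by (intro germ_ideal_generator) (auto simp: F_eq[abs_def] \<eta>_def)
    ultimately show ?thesis
      using Inr by (simp add: germ_eq_def F_eq \<eta>_def c_def)
  qed
  have \<eta>\<phi>_adm: "admissible pos (\<eta> (\<phi> z) k)" if "z \<in> Z" for z k
    using germ_eq_value[OF \<eta>\<phi>[OF that] F0[OF that]] x_adm[OF that] by simp
  have mon_\<eta>\<phi>: "germ_eq F z (\<lambda>x. pmon (\<eta> (\<phi> x)) r) (\<lambda>x. pmon (($) x) (combination c r))" if z: "z \<in> Z" for z r
  proof -
    have "germ_eq F z (\<lambda>x. pmon (\<eta> (\<phi> x)) r) (\<lambda>x. pmon (\<lambda>k. pmon (($) x) (c k)) r)"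
      by (rule germ_eq_pmon[OF \<eta>\<phi>[OF z]]) (rule admissible_nonzero[OF \<eta>\<phi>_adm[OF z]] admissible_nonzero[OF x_adm[OF z]])+
    moreover have "germ_eq F z (\<lambda>x. pmon (\<lambda>k. pmon (($) x) (c k)) r) (\<lambda>x. pmon (($) x) (combination c r))"
    proof (rule germ_eq_eventually)
      have "\<forall>\<^sub>F x in nhds z. \<forall>i. x $ i \<noteq> 0"
        using x_nz[OF z] by (intro eventually_all_finite eventually_nonzero) auto
      then show "\<forall>\<^sub>F x in nhds z. pmon (\<lambda>k. pmon (($) x) (c k)) r = pmon (($) x) (combination c r)"
        by eventually_elim (simp add: pmon_combination)
      show "real_analytic_at (\<lambda>x. pmon (\<lambda>k. pmon (($) x) (c k)) r) z"
        using calculation by (simp add: germ_eq_def)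
    qed
    ultimately show ?thesis
      by (rule germ_eq_trans)
  qed
  have G\<phi>: "(\<lambda>x. G j (\<phi> x)) \<in> germ_ideal F z" if "z \<in> Z" for z j
    using mon_\<eta>\<phi>[OF that, of "\<rho> j"] \<rho>[of j] by (simp add: relations germ_eq_def G_eq)
  have \<phi>Z: "\<phi> z \<in> Z'" if "z \<in> Z" for z
    using \<eta>\<phi>_adm[OF that] germ_ideal_vanishes[OF G\<phi>[OF that] F0[OF that]] by (simp add: Z'_def)

  have \<psi>_adm: "admissible pos (\<psi> y $ k)" if "y \<in> Z'" for y k
    unfolding \<psi>_def using \<eta>_adm[OF that] N(1) by (simp add: admissible_root admissible_pmon)
  have \<psi>_nz: "\<psi> y $ k \<noteq> 0" if "y \<in> Z'" for y k
    using \<psi>_adm[OF that] by (rule admissible_nonzero)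
  have mon_\<eta>_analytic: "real_analytic_at (\<lambda>y. pmon (\<eta> y) r) z" if "z \<in> Z'" for z r
    by (rule real_analytic_at_pmon[OF \<eta>_analytic \<eta>_nz[OF that]])
  have \<psi>_analytic: "real_analytic_at (\<lambda>y. \<psi> y $ k) z" if "z \<in> Z'" for z k
    using mon_\<eta>_analytic[OF that] pmon_nonzero[of "\<eta> z", OF \<eta>_nz[OF that]] N(1) by (simp add: \<psi>_def real_analytic_at_root)
  have \<eta>_near: "\<forall>\<^sub>F y in nhds z. \<forall>k. admissible pos (\<eta> y k)" if "z \<in> Z'" for z
    using \<eta>_adm[OF that] by (intro eventually_all_finite eventually_admissible \<eta>_analytic)
  have \<psi>_power: "(\<psi> y $ k) ^ N = pmon (\<eta> y) (s k)" if "\<forall>k. admissible pos (\<eta> y k)" for y k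
    using admissible_root_power[of pos "pmon (\<eta> y) (s k)" N] admissible_pmon[of pos "\<eta> y" "s k"] that N
    by (simp add: \<psi>_def)

  \<comment> \<open>The exponents whose monomial is 1 modulo (G) form a subgroup, and it contains
    the \<open>\<rho> j\<close> because the differences are the generators.\<close>
  have relation_one: "germ_eq G z (\<lambda>y. pmon (\<eta> y) r) (\<lambda>_. 1)" if z: "z \<in> Z'" and r: "r \<in> zspan (range \<rho>)" for z r
  proof -
    have near: "\<forall>\<^sub>F y in nhds z. \<forall>k. \<eta> y k \<noteq> 0"
      using \<eta>_near[OF z] by eventually_elim (use admissible_nonzero in blast)
    have "zspan (range \<rho>) \<subseteq> {r. germ_eq G z (\<lambda>y. pmon (\<eta> y) r) (\<lambda>_. 1)}"
    proof (rule zspan_subset_subgroup)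
      have "G j \<in> germ_ideal G z" for j
        using mon_\<eta>_analytic[OF z] by (intro germ_ideal_generator) (auto simp: G_eq[abs_def])
      then show "range \<rho> \<subseteq> {r. germ_eq G z (\<lambda>y. pmon (\<eta> y) r) (\<lambda>_. 1)}"
        using mon_\<eta>_analytic[OF z] by (auto simp: germ_eq_def G_eq[abs_def])
      show "0 \<in> {r. germ_eq G z (\<lambda>y. pmon (\<eta> y) r) (\<lambda>_. 1)}"
        by (simp add: germ_eq_refl)
    next
      fix p q
      assume pq: "p \<in> {r. germ_eq G z (\<lambda>y. pmon (\<eta> y) r) (\<lambda>_. 1)}" "q \<in> {r. germ_eq G z (\<lambda>y. pmon (\<eta> y) r) (\<lambda>_. 1)}"
      have "\<forall>\<^sub>F y in nhds z. pmon (\<eta> y) (p + q) = pmon (\<eta> y) p * pmon (\<eta> y) q"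
        using near by eventually_elim (simp add: pmon_add)
      then have "germ_eq G z (\<lambda>y. pmon (\<eta> y) (p + q)) (\<lambda>y. pmon (\<eta> y) p * pmon (\<eta> y) q)"
        by (rule germ_eq_eventually[OF mon_\<eta>_analytic[OF z]])
      moreover have "germ_eq G z (\<lambda>y. pmon (\<eta> y) p * pmon (\<eta> y) q) (\<lambda>_. 1)"
        using germ_eq_mult[of G z "\<lambda>y. pmon (\<eta> y) p" "\<lambda>_. 1" "\<lambda>y. pmon (\<eta> y) q" "\<lambda>_. 1"] pq by simp
      ultimately show "p + q \<in> {r. germ_eq G z (\<lambda>y. pmon (\<eta> y) r) (\<lambda>_. 1)}"
        using germ_eq_trans by blast
    next
      fix p
      assume "p \<in> {r. germ_eq G z (\<lambda>y. pmon (\<eta> y) r) (\<lambda>_. 1)}"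
      then show "- p \<in> {r. germ_eq G z (\<lambda>y. pmon (\<eta> y) r) (\<lambda>_. 1)}"
        using germ_eq_inverse[of G z "\<lambda>y. pmon (\<eta> y) p" "\<lambda>_. 1"] pmon_nonzero[of "\<eta> z", OF \<eta>_nz[OF z]]
        by (simp add: pmon_minus)
    qed
    with r show ?thesis by blast
  qed
  have mon_\<psi>: "germ_eq G z (\<lambda>y. pmon (($) (\<psi> y)) (combination c r)) (\<lambda>y. pmon (\<eta> y) r)" if z: "z \<in> Z'" for z r
  proof -
    define u where "u = combination c r"
    \<comment> \<open>\<open>combination c\<close> maps both terms to \<open>int N *s u\<close>, so
      \<open>q\<close> is a linear relation and some admissible multiple \<open>M\<close> of it lies
      in the span of the \<open>\<rho> j\<close>.\<close>
    define q where "q = combination s u - int N *s r"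
    \<comment> \<open>The quotient of the two sides to be compared. Its \<open>N\<close>-th power is
      the monomial with exponent \<open>q\<close>, hence its power with exponent
      \<open>N * M\<close> is 1 modulo (G).\<close>
    define f where "f y = pmon (($) (\<psi> y)) u * pmon (\<eta> y) (- r)" for y
    have "combination c (combination s u) = (\<Sum>k\<in>UNIV. u $ k *s combination c (s k))"
      unfolding combination_def[of s] by (simp add: combination_sum combination_smult)
    also have "\<dots> = int N *s combination (\<lambda>k. axis k 1) u"
      unfolding s by (simp add: combination_def vec_eq_iff sum_distrib_left mult_ac)
    finally have "combination c q = 0"
      by (simp add: q_def combination_diff combination_smult combination_axes u_def)
    then obtain M where M: "0 < M" "pos \<or> odd M" "int M *s q \<in> zspan (range \<rho>)"
      using M[of q] by (auto simp: relations)
    have fN: "\<forall>\<^sub>F y in nhds z. f y ^ N = pmon (\<eta> y) q"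
      using \<eta>_near[OF z]
    proof eventually_elim
      case (elim y)
      then have nz: "\<eta> y k \<noteq> 0" for k
        by (intro admissible_nonzero[of pos]) simp
      have "pmon (($) (\<psi> y)) u ^ N = pmon (\<eta> y) (combination s u)"
        unfolding pmon_power_base[symmetric] \<psi>_power[OF elim] by (simp add: pmon_combination nz)
      moreover have "pmon (\<eta> y) (- r) ^ N = pmon (\<eta> y) (- (int N *s r))"
        by (simp add: pmon_minus pmon_smult power_inverse)
      ultimately show ?case
        using pmon_add[of "\<eta> y" "combination s u" "- (int N *s r)", OF nz]
        by (simp add: f_def power_mult_distrib q_def)
    qed
    have f_analytic: "real_analytic_at f z"
      unfolding f_def
      by (intro real_analytic_at_mult real_analytic_at_pmon \<psi>_analytic[OF z] \<psi>_nz[OF z] mon_\<eta>_analytic[OF z])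
    have "\<forall>\<^sub>F y in nhds z. f y ^ (N * M) = pmon (\<eta> y) (int M *s q)"
      using fN by eventually_elim (simp add: power_mult pmon_smult)
    then have "germ_eq G z (\<lambda>y. f y ^ (N * M)) (\<lambda>y. pmon (\<eta> y) (int M *s q))"
      by (intro germ_eq_eventually real_analytic_at_power f_analytic)
    then have fNM: "germ_eq G z (\<lambda>y. f y ^ (N * M)) (\<lambda>_. 1)"
      using relation_one[OF z M(3)] by (rule germ_eq_trans)
    have "admissible pos (f z)"
      unfolding f_def using admissible_pmon[of pos "($) (\<psi> z)" u] admissible_pmon[of pos "\<eta> z" "- r"]
        \<psi>_adm[OF z] \<eta>_adm[OF z] by (auto simp: admissible_def split: if_splits)
    \<comment> \<open>The congruence fixes only a power of the value at \<open>z\<close>; here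
      positivity, or oddness of \<open>N * M\<close>, excludes the other root -1.\<close>
    then have "f z = 1"
      using germ_eq_value[OF fNM G0[OF z]] N M admissible_power_eq_1[of pos "f z" "N * M"] by auto
    with f_analytic fNM have "germ_eq G z f (\<lambda>_. 1)"
      by (rule germ_eq_one_if_power) (use N M in simp)
    then have "germ_eq G z (\<lambda>y. f y * pmon (\<eta> y) r) (\<lambda>y. 1 * pmon (\<eta> y) r)"
      by (intro germ_eq_mult germ_eq_refl mon_\<eta>_analytic[OF z])
    moreover have "\<forall>\<^sub>F y in nhds z. pmon (($) (\<psi> y)) u = f y * pmon (\<eta> y) r"
      using \<eta>_near[OF z]
    proof eventually_elim
      case (elim y)
      then have "pmon (\<eta> y) r \<noteq> 0"
        by (intro pmon_nonzero admissible_nonzero[of pos]) simp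
      then show ?case
        by (simp add: f_def pmon_minus)
    qed
    then have "germ_eq G z (\<lambda>y. pmon (($) (\<psi> y)) u) (\<lambda>y. f y * pmon (\<eta> y) r)"
      by (intro germ_eq_eventually real_analytic_at_pmon \<psi>_analytic[OF z] \<psi>_nz[OF z])
    ultimately show ?thesis
      unfolding u_def using germ_eq_trans by fastforce
  qed
  have \<phi>\<psi>: "(\<lambda>y. \<phi> (\<psi> y) $ m - y $ m) \<in> germ_ideal G z" if "z \<in> Z'" for z m
    using mon_\<psi>[OF that, of "axis (Inl m) 1"]
    by (simp add: germ_eq_def \<phi>_def pmon_axis combination_axis c_def \<eta>_def)
  have \<phi>\<psi>_analytic: "real_analytic_at (\<lambda>y. \<phi> (\<psi> y) $ m) z" if "z \<in> Z'" for z m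
    using mon_\<psi>[OF that, of "axis (Inl m) 1"] by (simp add: germ_eq_def \<phi>_def combination_axis c_def)
  have F\<psi>: "(\<lambda>y. F i (\<psi> y)) \<in> germ_ideal G z" if z: "z \<in> Z'" for z i
  proof -
    have "\<phi> (\<psi> z) = z"
      using germ_ideal_vanishes[OF \<phi>\<psi>[OF z] G0[OF z]] by (simp add: vec_eq_iff)
    \<comment> \<open>Hadamard's lemma is applied to \<open>h i\<close> itself:
      \<open>\<phi>\<close> after \<open>\<psi>\<close> is congruent to the identity, so
      \<open>h i\<close> takes congruent values at both. The monomial of \<open>\<psi> y\<close>
      with exponent \<open>w i\<close> is also congruent to \<open>h i\<close>, whence
      \<open>F i\<close> pulls back into the ideal.\<close>
    then have h: "(\<lambda>y. h_real d (b i) (\<phi> (\<psi> y)) - h_real d (b i) y) \<in> germ_ideal G z"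
      by (intro germ_ideal_compose_diff[OF real_analytic_at_h_real _ \<phi>\<psi>_analytic[OF z] real_analytic_at_coord \<phi>\<psi>[OF z]]) simp
    have "(\<lambda>y. pmon (($) (\<psi> y)) (w i) - h_real d (b i) y) \<in> germ_ideal G z"
      using mon_\<psi>[OF z, of "axis (Inr i) 1"]
      by (simp add: germ_eq_def pmon_axis combination_axis c_def \<eta>_def)
    from germ_ideal_diff[OF h this] show ?thesis
      by (simp add: F_eq)
  qed
  have \<psi>Z: "\<psi> z \<in> Z" if "z \<in> Z'" for z
    using \<psi>_adm[OF that] germ_ideal_vanishes[OF F\<psi>[OF that] G0[OF that]] by (simp add: Z_def)
  have \<psi>\<phi>: "(\<lambda>x. \<psi> (\<phi> x) $ k - x $ k) \<in> germ_ideal F z" if z: "z \<in> Z" for z k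
  proof -
    \<comment> \<open>The same device as before: the ratio that should be 1 has \<open>N\<close>-th
      power congruent to 1, because \<open>s k\<close> represents
      \<open>int N *s axis k 1\<close>.\<close>
    define f where "f x = \<psi> (\<phi> x) $ k * inverse (x $ k)" for x
    have "real_analytic_at (\<lambda>x. \<psi> (\<phi> x) $ k) z"
      by (rule real_analytic_at_compose[OF \<psi>_analytic[OF \<phi>Z[OF z]] \<phi>_analytic[OF z]])
    then have f_analytic: "real_analytic_at f z"
      unfolding f_def using x_nz[OF z] by (intro real_analytic_at_mult real_analytic_at_inverse) auto
    have adm: "\<forall>\<^sub>F x in nhds z. \<forall>k. admissible pos (\<eta> (\<phi> x) k)"
      by (intro eventually_all_finite eventually_admissible \<eta>\<phi>_analytic[OF z] \<eta>\<phi>_adm[OF z])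
    have near: "\<forall>\<^sub>F x in nhds z. x $ k \<noteq> 0"
      using x_nz[OF z] by (intro eventually_nonzero) auto
    have "\<forall>\<^sub>F x in nhds z. f x ^ N = pmon (\<eta> (\<phi> x)) (s k) * inverse (x $ k) ^ N"
      using adm by eventually_elim (simp add: f_def power_mult_distrib \<psi>_power)
    then have "germ_eq F z (\<lambda>x. f x ^ N) (\<lambda>x. pmon (\<eta> (\<phi> x)) (s k) * inverse (x $ k) ^ N)"
      by (intro germ_eq_eventually real_analytic_at_power f_analytic)
    moreover have "germ_eq F z (\<lambda>x. pmon (\<eta> (\<phi> x)) (s k) * inverse (x $ k) ^ N)
        (\<lambda>x. pmon (($) x) (int N *s axis k 1) * inverse (x $ k) ^ N)"
      using mon_\<eta>\<phi>[OF z, of "s k"] x_nz[OF z] unfolding s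
      by (intro germ_eq_mult germ_eq_refl real_analytic_at_power real_analytic_at_inverse) auto
    moreover have "\<forall>\<^sub>F x in nhds z. pmon (($) x) (int N *s axis k 1) * inverse (x $ k) ^ N = 1"
      using near by eventually_elim (simp add: pmon_smult pmon_axis flip: power_mult_distrib)
    then have "germ_eq F z (\<lambda>x. pmon (($) x) (int N *s axis k 1) * inverse (x $ k) ^ N) (\<lambda>_. 1)"
      using calculation(2) by (intro germ_eq_eventually) (auto simp: germ_eq_def)
    ultimately have fN: "germ_eq F z (\<lambda>x. f x ^ N) (\<lambda>_. 1)"
      using germ_eq_trans by blast
    have "admissible pos (f z)"
      using \<psi>_adm[OF \<phi>Z[OF z], of k] z unfolding f_def
      by (auto simp: Z_def admissible_def split: if_splits)
    then have "f z = 1"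
      using germ_eq_value[OF fN F0[OF z]] N admissible_power_eq_1[of pos "f z" N] by auto
    with f_analytic fN have "germ_eq F z f (\<lambda>_. 1)"
      by (rule germ_eq_one_if_power) (rule N(1))
    then have "(\<lambda>x. x $ k * (f x - 1)) \<in> germ_ideal F z"
      by (intro germ_ideal_mult) (auto simp: germ_eq_def)
    moreover have "\<forall>\<^sub>F x in nhds z. x $ k * (f x - 1) = \<psi> (\<phi> x) $ k - x $ k"
      using near by eventually_elim (simp add: f_def field_simps)
    ultimately show ?thesis
      by (rule germ_ideal_cong)
  qed
  have "analytic_subscheme {x. \<forall>i. admissible pos (x $ i)} F \<cong>\<^sub>s
      analytic_subscheme {y. \<forall>k. admissible pos (\<eta> y k)} G"
  proof (rule analytic_subscheme_isomorphic[where \<phi> = \<phi> and \<psi> = \<psi>])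
    fix z assume "z \<in> {z \<in> {x. \<forall>i. admissible pos (x $ i)}. \<forall>j. F j z = 0}"
    then have z: "z \<in> Z"
      by (simp add: Z_def)
    show "\<phi> z \<in> {z \<in> {y. \<forall>k. admissible pos (\<eta> y k)}. \<forall>j. G j z = 0}"
      using \<phi>Z[OF z] by (simp add: Z'_def)
    show "real_analytic_at (\<lambda>y. \<phi> y $ i) z" "(\<lambda>y. G j (\<phi> y)) \<in> germ_ideal F z"
      "(\<lambda>y. \<psi> (\<phi> y) $ k - y $ k) \<in> germ_ideal F z" for i j k
      using z by (rule \<phi>_analytic G\<phi> \<psi>\<phi>)+
  next
    fix z assume "z \<in> {z \<in> {y. \<forall>k. admissible pos (\<eta> y k)}. \<forall>j. G j z = 0}"
    then have z: "z \<in> Z'"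
      by (simp add: Z'_def)
    show "\<psi> z \<in> {z \<in> {x. \<forall>i. admissible pos (x $ i)}. \<forall>j. F j z = 0}"
      using \<psi>Z[OF z] by (simp add: Z_def)
    show "real_analytic_at (\<lambda>y. \<psi> y $ i) z" "(\<lambda>y. F j (\<psi> y)) \<in> germ_ideal G z"
      "(\<lambda>y. \<phi> (\<psi> y) $ k - y $ k) \<in> germ_ideal G z" for i j k
      using z by (rule \<psi>_analytic F\<psi> \<phi>\<psi>)+
  qed
  then show ?thesis
    by (simp add: F_def G_def[abs_def] domain)
qed

section \<open>Rings of fractions and Laurent polynomials\<close>

lemma type_ring_simps [simp]:
  "carrier ring_of_type_algebra = UNIV"
  "a \<otimes>\<^bsub>ring_of_type_algebra\<^esub> b = a * b" "\<one>\<^bsub>ring_of_type_algebra\<^esub> = 1"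
  "a \<oplus>\<^bsub>ring_of_type_algebra\<^esub> b = a + b" "\<zero>\<^bsub>ring_of_type_algebra\<^esub> = 0"
  by (simp_all add: ring_of_type_algebra_def)

lemma type_ring_hom_iff:
  "f \<in> ring_hom ring_of_type_algebra Q \<longleftrightarrow> (\<forall>a. f a \<in> carrier Q) \<and> f 1 = \<one>\<^bsub>Q\<^esub> \<and>
    (\<forall>a b. f (a * b) = f a \<otimes>\<^bsub>Q\<^esub> f b) \<and> (\<forall>a b. f (a + b) = f a \<oplus>\<^bsub>Q\<^esub> f b)"
  by (auto simp: ring_hom_def)

lemma ring_hom_comp: "f \<in> ring_hom A B \<Longrightarrow> g \<in> ring_hom B C \<Longrightarrow> (\<lambda>x. g (f x)) \<in> ring_hom A C"
  using ring_hom_trans[of f A B g C] by (simp add: o_def)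

definition mult_closed :: "'a::comm_ring_1 set \<Rightarrow> bool"
  where "mult_closed S \<longleftrightarrow> 1 \<in> S \<and> (\<forall>s\<in>S. \<forall>t\<in>S. s * t \<in> S)"

abbreviation fraction :: "'a::comm_ring_1 set \<Rightarrow> 'a \<Rightarrow> 'a \<Rightarrow> ('a \<times> 'a) set"
  where "fraction \<equiv> frac ring_of_type_algebra"

abbreviation fractions :: "'a::comm_ring_1 set \<Rightarrow> ('a \<times> 'a) set ring"
  where "fractions \<equiv> localization ring_of_type_algebra"

lemma mem_fraction: "(b, t) \<in> fraction S a s \<longleftrightarrow> t \<in> S \<and> (\<exists>u\<in>S. u * (t * a) = u * (s * b))"
  by (simp add: frac_def)

text \<open>The hypothesis is symmetric in the two fractions, so a single inclusion of classes has
  to be shown.\<close>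

lemma fraction_eqI:
  assumes S: "mult_closed S" and "s \<in> S" "t \<in> S" "u \<in> S" and eq: "u * (t * a) = u * (s * b)"
  shows "fraction S a s = fraction S b t"
proof -
  have sub: "fraction S a s \<subseteq> fraction S b t"
    if st: "s \<in> S" "t \<in> S" and eq: "u * (t * a) = u * (s * b)" for a b s t
  proof clarify
    fix c r assume "(c, r) \<in> fraction S a s"
    then obtain u' where r: "r \<in> S" "u' \<in> S" "u' * (r * a) = u' * (s * c)"
      by (auto simp: mem_fraction)
    \<comment> \<open>The witness combines both given ones with \<open>s\<close>: the relation from
      \<open>(c, r)\<close> to \<open>a\<close> and the one from \<open>a\<close> to
      \<open>b\<close> are multiplied until the middle numerator \<open>a\<close> cancels
      out.\<close>
    have "(u * u' * s) * (r * b) = (u' * r) * (u * (s * b))"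
      by (simp add: mult_ac)
    also have "\<dots> = (u * t) * (u' * (r * a))"
      unfolding eq[symmetric] by (simp add: mult_ac)
    also have "\<dots> = (u * u' * s) * (t * c)"
      unfolding r(3) by (simp add: mult_ac)
    finally have "(u * u' * s) * (r * b) = (u * u' * s) * (t * c)" .
    moreover have "u * u' * s \<in> S"
      using S \<open>u \<in> S\<close> r(2) st by (simp add: mult_closed_def)
    ultimately show "(c, r) \<in> fraction S b t"
      using r(1) by (auto simp: mem_fraction)
  qed
  show ?thesis
    using sub[OF assms(2,3) eq] sub[OF assms(3,2) eq[symmetric]] by (rule equalityI)
qed

lemma carrier_fractions: "carrier (fractions S) = {fraction S a s | a s. s \<in> S}"
  by (simp add: localization_def)

lemma fraction_in_carrier: "s \<in> S \<Longrightarrow> fraction S a s \<in> carrier (fractions S)"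
  by (auto simp: carrier_fractions)

lemma fractions_one: "\<one>\<^bsub>fractions S\<^esub> = fraction S 1 1" and fractions_zero: "\<zero>\<^bsub>fractions S\<^esub> = fraction S 0 1"
  by (simp_all add: localization_def)

lemma UN_eq_const: "p \<in> A \<Longrightarrow> (\<And>x. x \<in> A \<Longrightarrow> F x = C) \<Longrightarrow> (\<Union>x\<in>A. F x) = C"
  by auto

text \<open>Well-definedness for a general numerator \<open>p\<close>: given witnesses
  \<open>u\<close> and \<open>v\<close> for the two arguments, \<open>u * v\<close> is a witness for
  the results. All sets in the union then coincide.\<close>

lemma fractions_op:
  assumes S: "mult_closed S" and "s \<in> S" "t \<in> S"
    and op: "\<And>a' s' b' t' u v. \<lbrakk>s' \<in> S; t' \<in> S; u \<in> S; v \<in> S; u * (s' * a) = u * (s * a'); v * (t' * b) = v * (t * b')\<rbrakk>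
      \<Longrightarrow> (u * v) * ((s * t) * p a' s' b' t') = (u * v) * ((s' * t') * p a s b t)"
  shows "(\<Union>(a, s)\<in>fraction S a s. \<Union>(b, t)\<in>fraction S b t. fraction S (p a s b t) (s * t)) =
    fraction S (p a s b t) (s * t)"
proof (rule UN_eq_const)
  show "(a, s) \<in> fraction S a s"
    using S assms(2) by (auto simp: mem_fraction mult_closed_def)
  fix x assume x: "x \<in> fraction S a s"
  obtain a' s' where x': "x = (a', s')"
    by fastforce
  have "(\<Union>(b, t)\<in>fraction S b t. fraction S (p a' s' b t) (s' * t)) = fraction S (p a s b t) (s * t)"
  proof (rule UN_eq_const)
    show "(b, t) \<in> fraction S b t"
      using S assms(3) by (auto simp: mem_fraction mult_closed_def)
    fix y assume y: "y \<in> fraction S b t"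
    obtain b' t' where y': "y = (b', t')"
      by fastforce
    obtain u v where uv: "u \<in> S" "v \<in> S" "u * (s' * a) = u * (s * a')" "v * (t' * b) = v * (t * b')"
      and st: "s' \<in> S" "t' \<in> S"
      using x y unfolding x' y' mem_fraction by blast
    have "fraction S (p a' s' b' t') (s' * t') = fraction S (p a s b t) (s * t)"
      by (rule fraction_eqI[OF S, of _ _ "u * v"])
        (use S assms(2,3) st uv op[OF st uv] in \<open>auto simp: mult_closed_def\<close>)
    then show "(case y of (b, t) \<Rightarrow> fraction S (p a' s' b t) (s' * t)) = fraction S (p a s b t) (s * t)"
      by (simp add: y')
  qed
  then show "(case x of (a, s) \<Rightarrow> \<Union>(b, t)\<in>fraction S b t. fraction S (p a s b t) (s * t)) =
      fraction S (p a s b t) (s * t)"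
    by (simp add: x')
qed

lemma fractions_mult:
  assumes "mult_closed S" "s \<in> S" "t \<in> S"
  shows "fraction S a s \<otimes>\<^bsub>fractions S\<^esub> fraction S b t = fraction S (a * b) (s * t)"
proof -
  have "(u * v) * ((s * t) * (a' * b')) = (u * v) * ((s' * t') * (a * b))"
    if "u * (s' * a) = u * (s * a')" "v * (t' * b) = v * (t * b')" for a' s' b' t' u v
  proof -
    have "(u * v) * ((s * t) * (a' * b')) = (u * (s * a')) * (v * (t * b'))"
      by (simp add: mult_ac)
    also have "\<dots> = (u * v) * ((s' * t') * (a * b))"
      unfolding that[symmetric] by (simp add: mult_ac)
    finally show ?thesis .
  qed
  then show ?thesis
    using fractions_op[OF assms, where p = "\<lambda>a s b t. a * b"] by (simp add: localization_def)
qed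

lemma fractions_add:
  assumes "mult_closed S" "s \<in> S" "t \<in> S"
  shows "fraction S a s \<oplus>\<^bsub>fractions S\<^esub> fraction S b t = fraction S (t * a + s * b) (s * t)"
proof -
  have "(u * v) * ((s * t) * (t' * a' + s' * b')) = (u * v) * ((s' * t') * (t * a + s * b))"
    if "u * (s' * a) = u * (s * a')" "v * (t' * b) = v * (t * b')" for a' s' b' t' u v
  proof -
    have "(u * v) * ((s * t) * (t' * a' + s' * b')) =
        (v * t * t') * (u * (s * a')) + (u * s * s') * (v * (t * b'))"
      by (simp add: algebra_simps)
    also have "\<dots> = (u * v) * ((s' * t') * (t * a + s * b))"
      unfolding that[symmetric] by (simp add: algebra_simps)
    finally show ?thesis .
  qed
  then show ?thesis
    using fractions_op[OF assms, where p = "\<lambda>a s b t. t * a + s * b"] by (simp add: localization_def)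
qed

lemma cring_fractions:
  assumes S: "mult_closed S"
  shows "cring (fractions S)"
proof -
  have S1: "1 \<in> S" and Sm: "s \<in> S \<Longrightarrow> t \<in> S \<Longrightarrow> s * t \<in> S" for s t
    using S by (auto simp: mult_closed_def)
  have carrier: "\<exists>a s. x = fraction S a s \<and> s \<in> S" if "x \<in> carrier (fractions S)" for x
    using that by (auto simp: carrier_fractions)
  have eqI: "fraction S a s = fraction S b t" if "s \<in> S" "t \<in> S" "t * a = s * b" for a s b t
    by (rule fraction_eqI[OF S that(1,2) S1]) (simp add: that(3))
  note ops = fractions_mult[OF S] fractions_add[OF S] fractions_one fractions_zero fraction_in_carrier S1 Sm
  show ?thesis
  proof (rule cringI)
    show "abelian_group (fractions S)"
    proof (rule abelian_groupI)
      fix x y z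
      assume "x \<in> carrier (fractions S)" "y \<in> carrier (fractions S)" "z \<in> carrier (fractions S)"
      then obtain a s b t c r where x: "x = fraction S a s" "s \<in> S" and y: "y = fraction S b t" "t \<in> S"
        and z: "z = fraction S c r" "r \<in> S"
        using carrier by metis
      show "(x \<oplus>\<^bsub>fractions S\<^esub> y) \<oplus>\<^bsub>fractions S\<^esub> z = x \<oplus>\<^bsub>fractions S\<^esub> (y \<oplus>\<^bsub>fractions S\<^esub> z)"
        by (simp add: x y z ops) (rule eqI; simp add: x(2) y(2) z(2) ops algebra_simps)
    next
      fix x y
      assume "x \<in> carrier (fractions S)" "y \<in> carrier (fractions S)"
      then obtain a s b t where x: "x = fraction S a s" "s \<in> S" and y: "y = fraction S b t" "t \<in> S"
        using carrier by metis
      show "x \<oplus>\<^bsub>fractions S\<^esub> y = y \<oplus>\<^bsub>fractions S\<^esub> x"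
        using x(2) y(2) by (simp add: x y ops add.commute mult.commute)
      show "x \<oplus>\<^bsub>fractions S\<^esub> y \<in> carrier (fractions S)"
        using x(2) y(2) by (simp add: x y ops)
    next
      fix x assume "x \<in> carrier (fractions S)"
      then obtain a s where x: "x = fraction S a s" "s \<in> S"
        using carrier by metis
      show "\<zero>\<^bsub>fractions S\<^esub> \<oplus>\<^bsub>fractions S\<^esub> x = x"
        using x(2) by (simp add: x ops)
      show "\<exists>y\<in>carrier (fractions S). y \<oplus>\<^bsub>fractions S\<^esub> x = \<zero>\<^bsub>fractions S\<^esub>"
      proof (rule bexI[of _ "fraction S (- a) s"])
        show "fraction S (- a) s \<oplus>\<^bsub>fractions S\<^esub> x = \<zero>\<^bsub>fractions S\<^esub>"
          by (simp add: x ops) (rule eqI; simp add: x(2) ops)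
      qed (use x(2) in \<open>simp add: ops\<close>)
    qed (simp add: ops)
    show "comm_monoid (fractions S)"
    proof (rule comm_monoidI)
      fix x y z
      assume "x \<in> carrier (fractions S)" "y \<in> carrier (fractions S)" "z \<in> carrier (fractions S)"
      then obtain a s b t c r where x: "x = fraction S a s" "s \<in> S" and y: "y = fraction S b t" "t \<in> S"
        and z: "z = fraction S c r" "r \<in> S"
        using carrier by metis
      show "(x \<otimes>\<^bsub>fractions S\<^esub> y) \<otimes>\<^bsub>fractions S\<^esub> z = x \<otimes>\<^bsub>fractions S\<^esub> (y \<otimes>\<^bsub>fractions S\<^esub> z)"
        using x(2) y(2) z(2) by (simp add: x y z ops mult.assoc)
    next
      fix x y
      assume "x \<in> carrier (fractions S)" "y \<in> carrier (fractions S)"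
      then obtain a s b t where x: "x = fraction S a s" "s \<in> S" and y: "y = fraction S b t" "t \<in> S"
        using carrier by metis
      show "x \<otimes>\<^bsub>fractions S\<^esub> y = y \<otimes>\<^bsub>fractions S\<^esub> x"
        using x(2) y(2) by (simp add: x y ops mult.commute)
      show "x \<otimes>\<^bsub>fractions S\<^esub> y \<in> carrier (fractions S)"
        using x(2) y(2) by (simp add: x y ops)
    next
      fix x assume "x \<in> carrier (fractions S)"
      then obtain a s where x: "x = fraction S a s" "s \<in> S"
        using carrier by metis
      show "\<one>\<^bsub>fractions S\<^esub> \<otimes>\<^bsub>fractions S\<^esub> x = x"
        using x(2) by (simp add: x ops)
    qed (simp add: ops)
    fix x y z
    assume "x \<in> carrier (fractions S)" "y \<in> carrier (fractions S)" "z \<in> carrier (fractions S)"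
    then obtain a s b t c r where x: "x = fraction S a s" "s \<in> S" and y: "y = fraction S b t" "t \<in> S"
      and z: "z = fraction S c r" "r \<in> S"
      using carrier by metis
    show "(x \<oplus>\<^bsub>fractions S\<^esub> y) \<otimes>\<^bsub>fractions S\<^esub> z =
        x \<otimes>\<^bsub>fractions S\<^esub> z \<oplus>\<^bsub>fractions S\<^esub> y \<otimes>\<^bsub>fractions S\<^esub> z"
      by (simp add: x y z ops) (rule eqI; simp add: x(2) y(2) z(2) ops algebra_simps)
  qed
qed

lemma to_fractions_hom:
  assumes S: "mult_closed S"
  shows "(\<lambda>a. fraction S a 1) \<in> ring_hom ring_of_type_algebra (fractions S)"
proof -
  have "1 \<in> S"
    using S by (simp add: mult_closed_def)
  then show ?thesis
    by (simp add: type_ring_hom_iff fractions_one fractions_mult[OF S] fractions_add[OF S] fraction_in_carrier)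
qed

lemma to_fractions_Units:
  assumes S: "mult_closed S" and s: "s \<in> S"
  shows "fraction S s 1 \<in> Units (fractions S)"
proof -
  interpret cring "fractions S"
    by (rule cring_fractions[OF S])
  have S1: "1 \<in> S"
    using S by (simp add: mult_closed_def)
  have "fraction S s s = fraction S 1 1"
    by (rule fraction_eqI[OF S s S1 S1]) simp
  then have "fraction S 1 s \<otimes>\<^bsub>fractions S\<^esub> fraction S s 1 = \<one>\<^bsub>fractions S\<^esub>"
    using S1 s by (simp add: fractions_mult[OF S] fractions_one)
  then show ?thesis
    using S1 s m_comm by (auto simp: Units_def fraction_in_carrier intro!: bexI[of _ "fraction S 1 s"])
qed

text \<open>Universal property of localization: \<open>f a\<close> times the inverse of
  \<open>f s\<close> does not depend on the representative, because the images of denominators are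
  units and can be cancelled.\<close>

lemma fractions_hom_exists:
  assumes S: "mult_closed S" and Q: "cring Q" and f: "f \<in> ring_hom ring_of_type_algebra Q"
    and units: "\<And>s. s \<in> S \<Longrightarrow> f s \<in> Units Q"
  obtains g where "g \<in> ring_hom (fractions S) Q" "\<forall>a. g (fraction S a 1) = f a"
proof -
  interpret Q: cring Q by fact
  have S1: "1 \<in> S" and Sm: "s \<in> S \<Longrightarrow> t \<in> S \<Longrightarrow> s * t \<in> S" for s t
    using S by (auto simp: mult_closed_def)
  have fc: "f a \<in> carrier Q" and f1: "f 1 = \<one>\<^bsub>Q\<^esub>" and fm: "f (a * b) = f a \<otimes>\<^bsub>Q\<^esub> f b"
    and fa: "f (a + b) = f a \<oplus>\<^bsub>Q\<^esub> f b" for a b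
    using f by (auto simp: type_ring_hom_iff)
  have ic: "inv\<^bsub>Q\<^esub> (f s) \<in> carrier Q" "f s \<otimes>\<^bsub>Q\<^esub> inv\<^bsub>Q\<^esub> (f s) = \<one>\<^bsub>Q\<^esub>" if "s \<in> S" for s
    using units[OF that] by simp_all
  have solve: "x = y" if "u \<in> Units Q" "x \<in> carrier Q" "y \<in> carrier Q" "u \<otimes>\<^bsub>Q\<^esub> x = u \<otimes>\<^bsub>Q\<^esub> y" for u x y
    using that by simp
  define val where "val p = f (fst p) \<otimes>\<^bsub>Q\<^esub> inv\<^bsub>Q\<^esub> (f (snd p))" for p
  \<comment> \<open>\<open>val (a, s)\<close> is the unique solution of \<open>f s\<close> times
    \<open>x\<close> equals \<open>f a\<close>. Compatibility with products, sums and the unit is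
    checked through this equation, without computing with inverses.\<close>
  have valI: "val (a, s) = x" if s: "s \<in> S" and x: "x \<in> carrier Q" "f s \<otimes>\<^bsub>Q\<^esub> x = f a" for a s x
  proof (rule solve[OF units[OF s]])
    have "f s \<otimes>\<^bsub>Q\<^esub> val (a, s) = f a \<otimes>\<^bsub>Q\<^esub> (f s \<otimes>\<^bsub>Q\<^esub> inv\<^bsub>Q\<^esub> (f s))"
      using ic(1)[OF s] fc by (simp add: val_def Q.m_lcomm)
    then show "f s \<otimes>\<^bsub>Q\<^esub> val (a, s) = f s \<otimes>\<^bsub>Q\<^esub> x"
      using ic(2)[OF s] fc x by simp
  qed (use ic(1)[OF s] fc x in \<open>simp_all add: val_def\<close>)
  have val: "f s \<otimes>\<^bsub>Q\<^esub> val (a, s) = f a" "val (a, s) \<in> carrier Q" if s: "s \<in> S" for a s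
  proof -
    have "f s \<otimes>\<^bsub>Q\<^esub> val (a, s) = f a \<otimes>\<^bsub>Q\<^esub> (f s \<otimes>\<^bsub>Q\<^esub> inv\<^bsub>Q\<^esub> (f s))"
      using ic(1)[OF s] fc by (simp add: val_def Q.m_lcomm)
    then show "f s \<otimes>\<^bsub>Q\<^esub> val (a, s) = f a"
      using ic(2)[OF s] fc by simp
    show "val (a, s) \<in> carrier Q"
      using ic(1)[OF s] fc by (simp add: val_def)
  qed
  have const: "val p = val (a, s)" if s: "s \<in> S" and p: "p \<in> fraction S a s" for a s p
  proof -
    obtain b t where bt: "p = (b, t)"
      by fastforce
    then obtain u where u: "t \<in> S" "u \<in> S" "u * (t * a) = u * (s * b)"
      using p by (auto simp: mem_fraction)
    have "f t \<otimes>\<^bsub>Q\<^esub> val (a, s) = f b"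
    proof (rule solve[OF units[OF Sm[OF u(2) s]]])
      have "f (u * s) \<otimes>\<^bsub>Q\<^esub> (f t \<otimes>\<^bsub>Q\<^esub> val (a, s)) = f u \<otimes>\<^bsub>Q\<^esub> (f t \<otimes>\<^bsub>Q\<^esub> (f s \<otimes>\<^bsub>Q\<^esub> val (a, s)))"
        using val(2)[OF s, of a] fc by (simp add: fm Q.m_ac)
      also have "\<dots> = f (u * (t * a))"
        by (simp add: val(1)[OF s] fm)
      also have "\<dots> = f (u * s) \<otimes>\<^bsub>Q\<^esub> f b"
        unfolding u(3) using fc by (simp add: fm Q.m_assoc)
      finally show "f (u * s) \<otimes>\<^bsub>Q\<^esub> (f t \<otimes>\<^bsub>Q\<^esub> val (a, s)) = f (u * s) \<otimes>\<^bsub>Q\<^esub> f b" .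
    qed (use val(2)[OF s, of a] fc in auto)
    then show ?thesis
      using valI[OF u(1) val(2)[OF s, of a], of b] by (simp add: bt)
  qed
  \<comment> \<open>The chosen representative is immaterial by \<open>const\<close>.\<close>
  define g where "g C = val (SOME p. p \<in> C)" for C
  have g: "g (fraction S a s) = val (a, s)" if s: "s \<in> S" for a s
  proof -
    have "(a, s) \<in> fraction S a s"
      using s S1 by (auto simp: mem_fraction)
    then show ?thesis
      unfolding g_def by (intro const[OF s] someI)
  qed
  have "g \<in> ring_hom (fractions S) Q"
  proof (rule ring_hom_memI)
    fix x assume "x \<in> carrier (fractions S)"
    then obtain a s where x: "x = fraction S a s" "s \<in> S"
      by (auto simp: carrier_fractions)
    show "g x \<in> carrier Q"
      using x val(2) by (simp add: g)
    fix y assume "y \<in> carrier (fractions S)"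
    then obtain b t where y: "y = fraction S b t" "t \<in> S"
      by (auto simp: carrier_fractions)
    have c: "val (a, s) \<in> carrier Q" "val (b, t) \<in> carrier Q"
      using val(2) x(2) y(2) by auto
    have "val (a * b, s * t) = val (a, s) \<otimes>\<^bsub>Q\<^esub> val (b, t)"
    proof (rule valI[OF Sm[OF x(2) y(2)]])
      have "f (s * t) \<otimes>\<^bsub>Q\<^esub> (val (a, s) \<otimes>\<^bsub>Q\<^esub> val (b, t)) =
          (f s \<otimes>\<^bsub>Q\<^esub> val (a, s)) \<otimes>\<^bsub>Q\<^esub> (f t \<otimes>\<^bsub>Q\<^esub> val (b, t))"
        using c fc by (simp add: fm Q.m_ac)
      then show "f (s * t) \<otimes>\<^bsub>Q\<^esub> (val (a, s) \<otimes>\<^bsub>Q\<^esub> val (b, t)) = f (a * b)"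
        using val(1) x(2) y(2) by (simp add: fm)
    qed (use c in simp)
    then show "g (x \<otimes>\<^bsub>fractions S\<^esub> y) = g x \<otimes>\<^bsub>Q\<^esub> g y"
      using x y by (simp add: fractions_mult[OF S] g Sm)
    have "val (t * a + s * b, s * t) = val (a, s) \<oplus>\<^bsub>Q\<^esub> val (b, t)"
    proof (rule valI[OF Sm[OF x(2) y(2)]])
      have "f (s * t) \<otimes>\<^bsub>Q\<^esub> (val (a, s) \<oplus>\<^bsub>Q\<^esub> val (b, t)) =
          f t \<otimes>\<^bsub>Q\<^esub> (f s \<otimes>\<^bsub>Q\<^esub> val (a, s)) \<oplus>\<^bsub>Q\<^esub> f s \<otimes>\<^bsub>Q\<^esub> (f t \<otimes>\<^bsub>Q\<^esub> val (b, t))"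
        using c fc by (simp add: fm Q.r_distr Q.m_ac)
      then show "f (s * t) \<otimes>\<^bsub>Q\<^esub> (val (a, s) \<oplus>\<^bsub>Q\<^esub> val (b, t)) = f (t * a + s * b)"
        using val(1) x(2) y(2) by (simp add: fm fa)
    qed (use c in simp)
    then show "g (x \<oplus>\<^bsub>fractions S\<^esub> y) = g x \<oplus>\<^bsub>Q\<^esub> g y"
      using x y by (simp add: fractions_add[OF S] g Sm)
  next
    have "val (1, 1) = \<one>\<^bsub>Q\<^esub>"
      by (rule valI[OF S1]) (simp_all add: f1)
    then show "g \<one>\<^bsub>fractions S\<^esub> = \<one>\<^bsub>Q\<^esub>"
      by (simp add: fractions_one g S1)
  qed
  moreover have "g (fraction S a 1) = f a" for a
    unfolding g[OF S1] by (rule valI[OF S1]) (simp_all add: f1 fc)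
  ultimately show ?thesis
    using that by blast
qed

text \<open>Multiplying \<open>x\<close> by the image of its denominator \<open>s\<close> gives a
  fraction with denominator 1, and any homomorphism maps that image to a unit, which can be
  cancelled.\<close>

lemma fractions_hom_unique:
  assumes S: "mult_closed S" and Q: "cring Q"
    and g: "g \<in> ring_hom (fractions S) Q" and g': "g' \<in> ring_hom (fractions S) Q"
    and eq: "\<And>a. g (fraction S a 1) = g' (fraction S a 1)" and x: "x \<in> carrier (fractions S)"
  shows "g x = g' x"
proof -
  interpret Q: cring Q by fact
  interpret F: cring "fractions S" by (rule cring_fractions[OF S])
  have S1: "1 \<in> S"
    using S by (simp add: mult_closed_def)
  obtain a s where x': "x = fraction S a s" "s \<in> S"
    using x by (auto simp: carrier_fractions)
  let ?s = "fraction S s 1"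
  have s: "?s \<in> carrier (fractions S)"
    using S1 by (rule fraction_in_carrier)
  have "?s \<otimes>\<^bsub>fractions S\<^esub> x = fraction S a 1"
    using x' S1 fraction_eqI[OF S x'(2) S1 S1, of "s * a" a] by (simp add: fractions_mult[OF S])
  then have "g ?s \<otimes>\<^bsub>Q\<^esub> g x = g ?s \<otimes>\<^bsub>Q\<^esub> g' x"
    using ring_hom_mult[OF g s x] ring_hom_mult[OF g' s x] eq[of a] eq[of s] by simp
  moreover have "g ?s \<in> Units Q"
  proof -
    obtain y where y: "y \<in> carrier (fractions S)" "y \<otimes>\<^bsub>fractions S\<^esub> ?s = \<one>\<^bsub>fractions S\<^esub>"
      using to_fractions_Units[OF S x'(2)] by (auto simp: Units_def)
    then have "g y \<otimes>\<^bsub>Q\<^esub> g ?s = \<one>\<^bsub>Q\<^esub>"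
      using ring_hom_mult[OF g y(1) s] ring_hom_one[OF g] by simp
    then show ?thesis
      using ring_hom_closed[OF g] y s Q.m_comm by (auto simp: Units_def)
  qed
  ultimately show ?thesis
    using ring_hom_closed[OF g x] ring_hom_closed[OF g' x] by simp
qed

section \<open>Universal properties of Laurent polynomials and quotient rings\<close>

lemma poly_mapping_additive_induct [case_names single add]:
  fixes p :: "'a \<Rightarrow>\<^sub>0 'b::comm_monoid_add"
  assumes "\<And>k c. P (Poly_Mapping.single k c)" "\<And>p q. P p \<Longrightarrow> P q \<Longrightarrow> P (p + q)"
  shows "P p"
proof (induction p rule: update_induct)
  case const
  show ?case
    using assms(1)[of undefined 0] by simp
next
  case (update f a b)
  have "Poly_Mapping.update a b f = f + Poly_Mapping.single a b"
    using update(1) by (intro poly_mapping_eqI) (auto simp: lookup_update lookup_add lookup_single when_def in_keys_iff)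
  then show ?case
    using assms update(3) by simp
qed

lemma chi_0: "chi 0 = 1"
  by (simp add: chi_def)

lemma chi_add: "chi (u + v) = chi u * chi v"
  by (simp add: chi_def mult_single)

lemma single_eq_const_chi: "Poly_Mapping.single u c = const c * chi u"
  by (simp add: const_def chi_def mult_single)

lemma const_hom: "const \<in> ring_hom ring_of_type_algebra ring_of_type_algebra"
  by (simp add: type_ring_hom_iff const_def mult_single single_add)

lemma laurent_hom_unique:
  fixes f g :: "'n::finite laurent \<Rightarrow> 'q"
  assumes f: "f \<in> ring_hom laurent_ring Q" and g: "g \<in> ring_hom laurent_ring Q"
    and const: "\<And>c. f (const c) = g (const c)" and chi: "\<And>u. f (chi u) = g (chi u)"
  shows "f p = g p"
proof (induction p rule: poly_mapping_additive_induct)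
  case (single u c)
  then show ?case
    using f g const chi by (simp add: single_eq_const_chi type_ring_hom_iff)
next
  case (add p q)
  then show ?case
    using f g by (simp add: type_ring_hom_iff)
qed

text \<open>Universal property of the group ring: constants and characters may be mapped
  independently, provided that \<open>\<kappa>\<close> turns addition of exponents into
  multiplication.\<close>

lemma laurent_hom_exists:
  fixes \<iota> :: "complex \<Rightarrow> 'q" and \<kappa> :: "int^'n::finite \<Rightarrow> 'q"
  assumes Q: "cring Q" and \<iota>: "\<iota> \<in> ring_hom ring_of_type_algebra Q"
    and \<kappa>: "\<And>u. \<kappa> u \<in> carrier Q" "\<kappa> 0 = \<one>\<^bsub>Q\<^esub>" "\<And>u v. \<kappa> (u + v) = \<kappa> u \<otimes>\<^bsub>Q\<^esub> \<kappa> v"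
  obtains f :: "'n laurent \<Rightarrow> 'q" where "f \<in> ring_hom laurent_ring Q"
    "\<forall>c. f (const c) = \<iota> c" "\<forall>u. f (chi u) = \<kappa> u"
proof -
  interpret Q: cring Q by fact
  have \<iota>c: "\<iota> a \<in> carrier Q" and \<iota>1: "\<iota> 1 = \<one>\<^bsub>Q\<^esub>" and \<iota>m: "\<iota> (a * b) = \<iota> a \<otimes>\<^bsub>Q\<^esub> \<iota> b"
    and \<iota>a: "\<iota> (a + b) = \<iota> a \<oplus>\<^bsub>Q\<^esub> \<iota> b" for a b
    using \<iota> by (auto simp: type_ring_hom_iff)
  have \<iota>0: "\<iota> 0 = \<zero>\<^bsub>Q\<^esub>"
    using \<iota>a[of 0 0] \<iota>c[of 0] by (simp add: Q.add.r_cancel_one')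
  define summand where "summand p u = \<iota> (Poly_Mapping.lookup p u) \<otimes>\<^bsub>Q\<^esub> \<kappa> u" for p u
  have tc: "summand p u \<in> carrier Q" for p u
    using \<iota>c \<kappa>(1) by (simp add: summand_def)
  have t0: "summand p u = \<zero>\<^bsub>Q\<^esub>" if "u \<notin> Poly_Mapping.keys p" for p u
  proof -
    have "Poly_Mapping.lookup p u = 0"
      using that by (simp add: in_keys_iff)
    then show ?thesis
      using \<kappa>(1) by (simp add: summand_def \<iota>0)
  qed
  define f where "f p = (\<Oplus>\<^bsub>Q\<^esub>u\<in>Poly_Mapping.keys p. summand p u)" for p
  \<comment> \<open>Cancellation can make the support of \<open>p + q\<close> smaller than the union
    of the supports; summing over any finite superset lets all three sums run over the same
    set.\<close>
  have f_superset: "f p = (\<Oplus>\<^bsub>Q\<^esub>u\<in>K. summand p u)" if "finite K" "Poly_Mapping.keys p \<subseteq> K" for p K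
    unfolding f_def using that t0 tc by (intro Q.add.finprod_mono_neutral_cong_left) auto
  have f_add: "f (p + q) = f p \<oplus>\<^bsub>Q\<^esub> f q" for p q
  proof -
    let ?K = "Poly_Mapping.keys p \<union> Poly_Mapping.keys q"
    have "f (p + q) = (\<Oplus>\<^bsub>Q\<^esub>u\<in>?K. summand (p + q) u)"
      by (intro f_superset) (auto simp: keys_add)
    also have "\<dots> = (\<Oplus>\<^bsub>Q\<^esub>u\<in>?K. summand p u \<oplus>\<^bsub>Q\<^esub> summand q u)"
      using \<iota>c \<kappa>(1) by (simp add: summand_def lookup_add \<iota>a Q.l_distr)
    also have "\<dots> = (\<Oplus>\<^bsub>Q\<^esub>u\<in>?K. summand p u) \<oplus>\<^bsub>Q\<^esub> (\<Oplus>\<^bsub>Q\<^esub>u\<in>?K. summand q u)"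
      using tc by (intro Q.add.finprod_multf) auto
    also have "\<dots> = f p \<oplus>\<^bsub>Q\<^esub> f q"
      by (simp add: f_superset[of ?K])
    finally show ?thesis .
  qed
  have f_single: "f (Poly_Mapping.single u c) = \<iota> c \<otimes>\<^bsub>Q\<^esub> \<kappa> u" for u c
    using f_superset[of "{u}" "Poly_Mapping.single u c"] by (simp add: summand_def \<iota>c \<kappa>(1))
  have fc: "f p \<in> carrier Q" for p
    unfolding f_def using tc by (intro Q.finsum_closed) auto
  \<comment> \<open>Both sides are additive in each factor, so comparison on single terms
    suffices.\<close>
  have "f (p * q) = f p \<otimes>\<^bsub>Q\<^esub> f q" for p q
  proof (induction p rule: poly_mapping_additive_induct)
    case (single u c)
    show ?case
    proof (induction q rule: poly_mapping_additive_induct)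
      case (single v d)
      show ?case
        using \<iota>c \<kappa>(1) by (simp add: mult_single f_single \<iota>m \<kappa>(3) Q.m_ac)
    next
      case (add q r)
      then show ?case
        using fc by (simp add: distrib_left f_add Q.r_distr)
    qed
  next
    case (add p r)
    then show ?case
      using fc by (simp add: distrib_right f_add Q.l_distr)
  qed
  moreover have "f 1 = \<one>\<^bsub>Q\<^esub>"
    using f_single[of 0 1] by (simp add: \<iota>1 \<kappa>(2))
  ultimately have "f \<in> ring_hom laurent_ring Q"
    using fc f_add by (simp add: type_ring_hom_iff)
  then show ?thesis
    using f_single[of 0] f_single[of _ 1] \<iota>c \<kappa> \<iota>1 by (intro that allI) (simp_all add: const_def chi_def)
qed

text \<open>\<open>f\<close> is constant on each coset of \<open>I\<close>, so the image of a coset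
  is a singleton and \<open>the_elem\<close> reads off its value.\<close>

lemma factor_hom_exists:
  assumes R: "cring R" and Q: "cring Q" and I: "ideal I R" and f: "f \<in> ring_hom R Q"
    and I0: "\<And>a. a \<in> I \<Longrightarrow> f a = \<zero>\<^bsub>Q\<^esub>"
  obtains g where "g \<in> ring_hom (R Quot I) Q" "\<forall>a\<in>carrier R. g (I +>\<^bsub>R\<^esub> a) = f a"
proof -
  interpret R: cring R by fact
  interpret Q: cring Q by fact
  interpret I: ideal I R by fact
  define g where "g C = the_elem (f ` C)" for C
  have g: "g (I +>\<^bsub>R\<^esub> a) = f a" if a: "a \<in> carrier R" for a
  proof -
    have eq: "f x = f a" if x: "x \<in> I +>\<^bsub>R\<^esub> a" for x
    proof -
      obtain i where "i \<in> I" "x = i \<oplus>\<^bsub>R\<^esub> a"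
        using x by (auto simp: a_r_coset_def')
      then show ?thesis
        using ring_hom_add[OF f, of i a] ring_hom_closed[OF f a] a I0 I.a_subset by auto
    qed
    have "f ` (I +>\<^bsub>R\<^esub> a) = (\<lambda>_. f a) ` (I +>\<^bsub>R\<^esub> a)"
      by (rule image_cong[OF refl eq])
    also have "\<dots> = {f a}"
      using I.a_rcos_self[OF a] by (rule image_constant)
    finally have "f ` (I +>\<^bsub>R\<^esub> a) = {f a}" .
    then show ?thesis
      by (simp add: g_def)
  qed
  have carrier: "\<exists>a\<in>carrier R. C = I +>\<^bsub>R\<^esub> a" if "C \<in> carrier (R Quot I)" for C
    using that by (auto simp: FactRing_def A_RCOSETS_def')
  have "g \<in> ring_hom (R Quot I) Q"
  proof (rule ring_hom_memI)
    fix C assume "C \<in> carrier (R Quot I)"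
    then obtain a where a: "a \<in> carrier R" "C = I +>\<^bsub>R\<^esub> a"
      using carrier by blast
    then show "g C \<in> carrier Q"
      using ring_hom_closed[OF f] by (simp add: g)
    fix D assume "D \<in> carrier (R Quot I)"
    then obtain b where b: "b \<in> carrier R" "D = I +>\<^bsub>R\<^esub> b"
      using carrier by blast
    show "g (C \<otimes>\<^bsub>R Quot I\<^esub> D) = g C \<otimes>\<^bsub>Q\<^esub> g D" "g (C \<oplus>\<^bsub>R Quot I\<^esub> D) = g C \<oplus>\<^bsub>Q\<^esub> g D"
      using a b ring_hom_mult[OF I.rcos_ring_hom a(1) b(1)] ring_hom_add[OF I.rcos_ring_hom a(1) b(1)]
        ring_hom_mult[OF f a(1) b(1)] ring_hom_add[OF f a(1) b(1)]
        g[OF R.m_closed[OF a(1) b(1)]] g[OF R.a_closed[OF a(1) b(1)]] g[OF a(1)] g[OF b(1)]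
      by simp_all
  next
    show "g \<one>\<^bsub>R Quot I\<^esub> = \<one>\<^bsub>Q\<^esub>"
      using ring_hom_one[OF I.rcos_ring_hom] g[OF R.one_closed] ring_hom_one[OF f] by simp
  qed
  then show ?thesis
    using g by (intro that) auto
qed

lemma genideal_kernel:
  assumes "ring R" "ring Q" "f \<in> ring_hom R Q" and "E \<subseteq> carrier R" "\<And>e. e \<in> E \<Longrightarrow> f e = \<zero>\<^bsub>Q\<^esub>"
    and "a \<in> Idl\<^bsub>R\<^esub> E"
  shows "f a = \<zero>\<^bsub>Q\<^esub>"
proof -
  have f: "ring_hom_ring R Q f"
    by (rule ring_hom_ringI2[OF assms(1-3)])
  have "Idl\<^bsub>R\<^esub> E \<subseteq> a_kernel R Q f"
    by (rule ring.genideal_minimal[OF assms(1) ring_hom_ring.kernel_is_ideal[OF f]])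
      (use assms(4,5) in \<open>auto simp: a_kernel_def'\<close>)
  with assms(6) have "a \<in> a_kernel R Q f"
    by (rule subsetD[rotated])
  then show ?thesis
    by (simp add: a_kernel_def')
qed

text \<open>The induced maps between the quotients exist only inside the proof, so \<open>gf\<close>
  and \<open>fg\<close> quantify over every \<open>h\<close> that factors \<open>g\<close> or
  \<open>f\<close>. They say that the composites induce the identity on classes.\<close>

lemma quotient_ring_iso:
  assumes A: "cring A" and B: "cring B" and I: "ideal I A" and J: "ideal J B"
    and f: "f \<in> ring_hom B (A Quot I)" "\<And>b. b \<in> J \<Longrightarrow> f b = \<zero>\<^bsub>A Quot I\<^esub>"
    and g: "g \<in> ring_hom A (B Quot J)" "\<And>a. a \<in> I \<Longrightarrow> g a = \<zero>\<^bsub>B Quot J\<^esub>"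
    and gf: "\<And>h. \<lbrakk>h \<in> ring_hom (A Quot I) (B Quot J); \<forall>a\<in>carrier A. h (I +>\<^bsub>A\<^esub> a) = g a\<rbrakk>
      \<Longrightarrow> \<forall>b\<in>carrier B. h (f b) = J +>\<^bsub>B\<^esub> b"
    and fg: "\<And>h. \<lbrakk>h \<in> ring_hom (B Quot J) (A Quot I); \<forall>b\<in>carrier B. h (J +>\<^bsub>B\<^esub> b) = f b\<rbrakk>
      \<Longrightarrow> \<forall>a\<in>carrier A. h (g a) = I +>\<^bsub>A\<^esub> a"
  obtains h where "h \<in> ring_iso (B Quot J) (A Quot I)" "\<forall>b\<in>carrier B. h (J +>\<^bsub>B\<^esub> b) = f b"
proof -
  have AI: "cring (A Quot I)" and BJ: "cring (B Quot J)"
    using ideal.quotient_is_cring[OF I A] ideal.quotient_is_cring[OF J B] by auto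
  obtain h where h: "h \<in> ring_hom (B Quot J) (A Quot I)" "\<forall>b\<in>carrier B. h (J +>\<^bsub>B\<^esub> b) = f b"
    by (rule factor_hom_exists[OF B AI J f])
  obtain k where k: "k \<in> ring_hom (A Quot I) (B Quot J)" "\<forall>a\<in>carrier A. k (I +>\<^bsub>A\<^esub> a) = g a"
    by (rule factor_hom_exists[OF A BJ I g])
  have carrierA: "\<exists>a\<in>carrier A. C = I +>\<^bsub>A\<^esub> a" if "C \<in> carrier (A Quot I)" for C
    using that by (auto simp: FactRing_def A_RCOSETS_def')
  have carrierB: "\<exists>b\<in>carrier B. C = J +>\<^bsub>B\<^esub> b" if "C \<in> carrier (B Quot J)" for C
    using that by (auto simp: FactRing_def A_RCOSETS_def')
  have "bij_betw h (carrier (B Quot J)) (carrier (A Quot I))"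
  proof (rule bij_betw_byWitness[where f' = k])
    show "\<forall>C\<in>carrier (B Quot J). k (h C) = C"
    proof
      fix C assume "C \<in> carrier (B Quot J)"
      then obtain b where "b \<in> carrier B" "C = J +>\<^bsub>B\<^esub> b"
        using carrierB by blast
      then show "k (h C) = C"
        using gf[OF k] h(2) by simp
    qed
    show "\<forall>C\<in>carrier (A Quot I). h (k C) = C"
    proof
      fix C assume "C \<in> carrier (A Quot I)"
      then obtain a where "a \<in> carrier A" "C = I +>\<^bsub>A\<^esub> a"
        using carrierA by blast
      then show "h (k C) = C"
        using fg[OF h] k(2) by simp
    qed
  qed (use ring_hom_closed[OF h(1)] ring_hom_closed[OF k(1)] in auto)
  then have "h \<in> ring_iso (B Quot J) (A Quot I)"
    using h(1) by (simp add: ring_iso_def)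
  then show ?thesis
    using h(2) by (rule that)
qed

section \<open>The schemes over the complex numbers\<close>

context monoid
begin

text \<open>The laws of integer powers are those of the group \<open>units_of G\<close>; this
  identifies powers taken there with powers in the ambient monoid.\<close>

lemma Units_int_pow_units_of:
  assumes "x \<in> Units G"
  shows "x [^]\<^bsub>units_of G\<^esub> (k::int) = x [^] k"
  unfolding int_pow_def2 units_of_pow[OF assms] units_of_inv[OF Units_pow_closed[OF assms]] ..

lemma Units_int_pow_closed:
  assumes "x \<in> Units G"
  shows "x [^] (k::int) \<in> carrier G"
proof -
  have "x [^]\<^bsub>units_of G\<^esub> k \<in> carrier (units_of G)"
    by (rule group.int_pow_closed[OF units_group]) (simp add: units_of_carrier assms)
  then show ?thesis
    unfolding units_of_carrier Units_int_pow_units_of[OF assms] by (rule Units_closed)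
qed

lemma Units_int_pow_add:
  assumes "x \<in> Units G"
  shows "x [^] (j + k :: int) = x [^] j \<otimes> x [^] k"
proof -
  have "x [^]\<^bsub>units_of G\<^esub> (j + k) = x [^]\<^bsub>units_of G\<^esub> j \<otimes>\<^bsub>units_of G\<^esub> x [^]\<^bsub>units_of G\<^esub> k"
    by (rule group.int_pow_mult[OF units_group]) (simp add: units_of_carrier assms)
  then show ?thesis
    unfolding units_of_mult Units_int_pow_units_of[OF assms] .
qed

lemma int_pow_one_exponent: "x \<in> carrier G \<Longrightarrow> x [^] (1::int) = x"
  by (simp add: int_pow_def2)

end

text \<open>Counterpart of \<open>pmon\<close> in an abstract ring; negative exponents are
  meaningful for families of units.\<close>

definition unit_monomial :: "('a, 'b) monoid_scheme \<Rightarrow> ('k::finite \<Rightarrow> 'a) \<Rightarrow> int^'k \<Rightarrow> 'a"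
  where "unit_monomial G t r = (\<Otimes>\<^bsub>G\<^esub>k\<in>UNIV. t k [^]\<^bsub>G\<^esub> (r $ k))"

context comm_monoid
begin

lemma unit_monomial_closed: "(\<And>k. t k \<in> Units G) \<Longrightarrow> unit_monomial G t r \<in> carrier G"
  unfolding unit_monomial_def by (intro finprod_closed) (simp add: Units_int_pow_closed)

lemma unit_monomial_0: "unit_monomial G t 0 = \<one>"
  by (simp add: unit_monomial_def finprod_one_eqI)

lemma unit_monomial_add:
  assumes "\<And>k. t k \<in> Units G"
  shows "unit_monomial G t (r + s) = unit_monomial G t r \<otimes> unit_monomial G t s"
proof -
  have "(\<Otimes>k\<in>UNIV. t k [^] (r $ k) \<otimes> t k [^] (s $ k)) =
      (\<Otimes>k\<in>UNIV. t k [^] (r $ k)) \<otimes> (\<Otimes>k\<in>UNIV. t k [^] (s $ k))"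
    using assms by (intro finprod_multf) (auto simp: Units_int_pow_closed)
  then show ?thesis
    by (simp add: unit_monomial_def Units_int_pow_add assms)
qed

lemma unit_monomial_axis:
  assumes "\<And>k. t k \<in> Units G"
  shows "unit_monomial G t (axis i 1) = t i"
proof -
  have "t k [^] (axis i 1 $ k :: int) = (if i = k then t k else \<one>)" for k
    using assms by (simp add: axis_def int_pow_one_exponent Units_closed)
  then have "unit_monomial G t (axis i 1) = (\<Otimes>k\<in>UNIV. if i = k then t k else \<one>)"
    by (simp add: unit_monomial_def)
  also have "\<dots> = t i"
    using assms by (intro finprod_singleton) (auto simp: Units_closed)
  finally show ?thesis .
qed

end

text \<open>The unit vectors generate the lattice. Two maps turning addition into multiplication are
  compared by taking for \<open>T\<close> the exponents on which they agree.\<close>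

lemma additive_set_eq_UNIV:
  fixes T :: "(int^'k) set"
  assumes "0 \<in> T" "\<And>x y. x \<in> T \<Longrightarrow> y \<in> T \<Longrightarrow> x + y \<in> T" "\<And>x. x \<in> T \<Longrightarrow> - x \<in> T"
    and axes: "\<And>k. axis k 1 \<in> T"
  shows "r \<in> T"
proof -
  let ?S = "range (\<lambda>k. axis k 1) :: (int^'k) set"
  have "combination (\<lambda>k. axis k 1) r \<in> zspan ?S"
    unfolding combination_def using zspan_superset[of ?S] by (intro zspan_sum zspan_closed(5)) blast
  then have "r \<in> zspan ?S"
    by (simp add: combination_axes)
  moreover have "zspan ?S \<subseteq> T"
    using assms by (intro zspan_subset_subgroup) auto
  ultimately show ?thesis
    by blast
qed

lemma type_ring_minus: "a \<ominus>\<^bsub>ring_of_type_algebra\<^esub> b = a - b" for a b :: "'a::comm_ring_1"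
proof -
  interpret cring "ring_of_type_algebra :: 'a ring"
    by (rule cring_from_type_algebra)
  have "\<ominus>\<^bsub>ring_of_type_algebra\<^esub> b = - b"
    by (rule minus_equality) simp_all
  then show ?thesis
    by (simp add: a_minus_def)
qed

lemma poly_value_hom:
  fixes f :: "'a::comm_ring_1 \<Rightarrow> 'b::comm_ring_1"
  assumes "f \<in> ring_hom ring_of_type_algebra ring_of_type_algebra"
  shows "f (poly_value d \<iota> c y) = poly_value d (\<lambda>t. f (\<iota> t)) c (\<lambda>m. f (y m))"
proof -
  have f: "f 1 = 1" "f (a * b) = f a * f b" "f (a + b) = f a + f b" for a b
    using assms by (auto simp: type_ring_hom_iff)
  have f0: "f 0 = 0"
    using f(3)[of 0 0] by simp
  have sum: "f (\<Sum>i\<in>A. g i) = (\<Sum>i\<in>A. f (g i))" for A and g :: "'i \<Rightarrow> 'a"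
    by (induction A rule: infinite_finite_induct) (simp_all add: f f0)
  have prod: "f (\<Prod>i\<in>A. g i) = (\<Prod>i\<in>A. f (g i))" for A and g :: "'i \<Rightarrow> 'a"
    by (induction A rule: infinite_finite_induct) (simp_all add: f)
  have power: "f (a ^ n) = f a ^ n" for a n
    by (induction n) (simp_all add: f)
  show ?thesis
    by (simp add: poly_value_def sum prod power f)
qed

lemma mult_closed_h_powers: "mult_closed (h_powers d b)"
  unfolding mult_closed_def
proof (intro conjI ballI)
  have "(\<Prod>i\<in>UNIV. h_laurent d (b i) ^ 0) \<in> h_powers d b"
    unfolding h_powers_def by (intro CollectI exI[of _ "\<lambda>_. 0"]) simp
  then show "1 \<in> h_powers d b"
    by simp
  fix s t assume "s \<in> h_powers d b" "t \<in> h_powers d b"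
  then obtain e e' where "s = (\<Prod>i\<in>UNIV. h_laurent d (b i) ^ e i)" "t = (\<Prod>i\<in>UNIV. h_laurent d (b i) ^ e' i)"
    unfolding h_powers_def by blast
  then have "s * t = (\<Prod>i\<in>UNIV. h_laurent d (b i) ^ (e i + e' i))"
    by (simp add: power_add prod.distrib)
  then show "s * t \<in> h_powers d b"
    unfolding h_powers_def by (intro CollectI exI[of _ "\<lambda>i. e i + e' i"]) simp
qed

lemma h_laurent_in_h_powers: "h_laurent d (b i) \<in> h_powers d b"
proof -
  have "(\<Prod>j\<in>UNIV. h_laurent d (b j) ^ (if j = i then 1 else 0)) = (\<Prod>j\<in>UNIV. if j = i then h_laurent d (b j) else 1)"
    by (rule prod.cong) auto
  then have eq: "h_laurent d (b i) = (\<Prod>j\<in>UNIV. h_laurent d (b j) ^ (if j = i then 1 else 0))"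
    by simp
  show ?thesis
    unfolding h_powers_def by (intro CollectI exI[of _ "\<lambda>j. if j = i then 1 else 0"] conjI TrueI) (rule eq)
qed

lemma hom_h_powers_Units:
  assumes Q: "cring Q" and f: "f \<in> ring_hom laurent_ring Q" and h: "\<And>i. f (h_laurent d (b i)) \<in> Units Q"
    and s: "s \<in> h_powers d b"
  shows "f s \<in> Units Q"
proof -
  interpret Q: cring Q by fact
  have f1: "f 1 = \<one>\<^bsub>Q\<^esub>" and fm: "f (x * y) = f x \<otimes>\<^bsub>Q\<^esub> f y" for x y
    using f by (auto simp: type_ring_hom_iff)
  have power: "f (h_laurent d (b i) ^ n) \<in> Units Q" for i n
    using h by (induction n) (simp_all add: f1 fm)
  have "f (\<Prod>i\<in>A. h_laurent d (b i) ^ e i) \<in> Units Q" for e :: "_ \<Rightarrow> nat" and A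
    by (induction A rule: infinite_finite_induct) (simp_all add: f1 fm power)
  then show ?thesis
    using s by (auto simp: h_powers_def)
qed

lemma F_scheme_isomorphic_G_scheme:
  fixes v :: "'l::finite \<Rightarrow> int^'n::finite" and w :: "'n \<Rightarrow> int^'n" and b :: "'n \<Rightarrow> int^'l \<Rightarrow> complex"
    and \<rho> :: "'l \<Rightarrow> int^('l + 'n)"
  assumes span: "\<And>u. \<exists>r. combination (case_sum v w) r = u"
    and relations: "zspan (range \<rho>) = linear_relations v w"
  shows "F_scheme d b v w \<cong>\<^sub>s G_scheme d b \<rho>"
proof -
  let ?A = "laurent_ring :: 'n laurent ring" and ?L = "laurent_ring :: 'l laurent ring"
  let ?C = "complement_ring d b"
  let ?to = "to_complement_ring d b"
  define c where "c = case_sum v w"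
  have S: "mult_closed (h_powers d b)"
    by (rule mult_closed_h_powers)
  have A: "cring ?A"
    by (rule cring_from_type_algebra)
  have C: "cring ?C"
    unfolding complement_ring_def by (rule cring_fractions[OF S])
  interpret A: cring ?A by (rule A)
  interpret C: cring ?C by (rule C)
  have to: "?to \<in> ring_hom ?L ?C"
    using to_fractions_hom[OF S] by (simp add: to_complement_ring_def[abs_def] complement_ring_def)
  have to': "?to a \<in> carrier ?C" "?to 1 = \<one>\<^bsub>?C\<^esub>" "?to (a * a') = ?to a \<otimes>\<^bsub>?C\<^esub> ?to a'" for a a'
    using to by (auto simp: type_ring_hom_iff)

  define \<eta> where "\<eta> m = ?to (chi (axis m 1))" for m
  define \<theta> where "\<theta> i = ?to (h_laurent d (b i))" for i
  have \<eta>: "\<eta> m \<in> Units ?C" for m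
  proof -
    have "?to (chi (- axis m 1)) \<otimes>\<^bsub>?C\<^esub> \<eta> m = \<one>\<^bsub>?C\<^esub>" "\<eta> m \<otimes>\<^bsub>?C\<^esub> ?to (chi (- axis m 1)) = \<one>\<^bsub>?C\<^esub>"
      unfolding \<eta>_def by (simp_all flip: to'(3) chi_add add: chi_0 to'(2))
    then show ?thesis
      using to'(1) unfolding Units_def \<eta>_def by blast
  qed
  have \<theta>: "\<theta> i \<in> Units ?C" for i
    using to_fractions_Units[OF S h_laurent_in_h_powers[of d b i]]
    by (simp add: \<theta>_def to_complement_ring_def complement_ring_def)
  \<comment> \<open>A homomorphism from the lattice of pairs of exponents to the units of the
    complement ring; the equations (G) say that it is 1 at the \<open>\<rho> j\<close>.\<close>
  define E where "E r = unit_monomial ?C \<eta> (\<chi> m. r $ Inl m) \<otimes>\<^bsub>?C\<^esub> unit_monomial ?C \<theta> (\<chi> i. r $ Inr i)" for r :: "int^('l + 'n)"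
  have E_closed: "E r \<in> carrier ?C" for r
    unfolding E_def by (intro C.m_closed C.unit_monomial_closed \<eta> \<theta>)
  have vec_0: "(\<chi> m. (0 :: int^('l + 'n)) $ Inl m) = 0" "(\<chi> i. (0 :: int^('l + 'n)) $ Inr i) = 0"
    by (simp_all add: vec_eq_iff)
  have E_0: "E 0 = \<one>\<^bsub>?C\<^esub>"
    unfolding E_def vec_0 by (simp add: C.unit_monomial_0)
  have E_add: "E (r + s) = E r \<otimes>\<^bsub>?C\<^esub> E s" for r s
  proof -
    have "(\<chi> m. (r + s) $ Inl m) = (\<chi> m. r $ Inl m) + (\<chi> m. s $ Inl m)"
      "(\<chi> i. (r + s) $ Inr i) = (\<chi> i. r $ Inr i) + (\<chi> i. s $ Inr i)"
      by (simp_all add: vec_eq_iff)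
    then show ?thesis
      using C.unit_monomial_closed[of \<eta>, OF \<eta>] C.unit_monomial_closed[of \<theta>, OF \<theta>]
      by (simp add: E_def C.unit_monomial_add[of \<eta>, OF \<eta>] C.unit_monomial_add[of \<theta>, OF \<theta>] C.m_ac)
  qed
  have E_Inl: "E (axis (Inl m) 1) = \<eta> m" for m
  proof -
    have "(\<chi> k. axis (Inl m) (1::int) $ (Inl k :: 'l + 'n)) = axis m 1" "(\<chi> k. axis (Inl m) (1::int) $ (Inr k :: 'l + 'n)) = 0"
      by (simp_all add: vec_eq_iff axis_def)
    then show ?thesis
      using C.Units_closed[OF \<eta>[of m]] by (simp add: E_def C.unit_monomial_axis[of \<eta>, OF \<eta>] C.unit_monomial_0)
  qed
  have E_Inr: "E (axis (Inr i) 1) = \<theta> i" for i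
  proof -
    have "(\<chi> k. axis (Inr i) (1::int) $ (Inl k :: 'l + 'n)) = 0" "(\<chi> k. axis (Inr i) (1::int) $ (Inr k :: 'l + 'n)) = axis i 1"
      by (simp_all add: vec_eq_iff axis_def)
    then show ?thesis
      using C.Units_closed[OF \<theta>[of i]] by (simp add: E_def C.unit_monomial_axis[of \<theta>, OF \<theta>] C.unit_monomial_0)
  qed
  have G_eq: "G_rational d b r = E r \<ominus>\<^bsub>?C\<^esub> \<one>\<^bsub>?C\<^esub>" for r
    by (simp add: G_rational_def Let_def E_def unit_monomial_def \<eta>_def \<theta>_def)

  \<comment> \<open>The substitution of \<open>chi (v m)\<close> for the \<open>m\<close>-th
    variable, available on all Laurent polynomials because characters are invertible.\<close>
  obtain sub :: "'l laurent \<Rightarrow> 'n laurent" where sub: "sub \<in> ring_hom ?L ?A"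
    "\<forall>x. sub (const x) = const x" "\<forall>u. sub (chi u) = chi (combination v u)"
    by (rule laurent_hom_exists[OF A const_hom, of "\<lambda>u. chi (combination v u)"])
      (simp_all add: chi_0 chi_add combination_add)
  define h where "h i = h_laurent d (b i)" for i
  have F_eq: "F_laurent d b v w i = sub (h i) - chi (w i)" for i
    unfolding F_laurent_def h_def h_laurent_def poly_value_hom[OF sub(1)]
    by (simp add: sub(2,3) combination_axis)

  define I where "I = Idl\<^bsub>?A\<^esub> (range (F_laurent d b v w))"
  have I: "ideal I ?A"
    unfolding I_def by (intro A.genideal_ideal) simp
  let ?qI = "\<lambda>a. I +>\<^bsub>?A\<^esub> a"
  let ?RF = "?A Quot I"
  have RF: "cring ?RF"
    by (rule ideal.quotient_is_cring[OF I A])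
  interpret RF: cring ?RF by (rule RF)
  have qI: "?qI \<in> ring_hom ?A ?RF"
    by (rule ideal.rcos_ring_hom[OF I])
  have qI': "?qI a \<in> carrier ?RF" "?qI 1 = \<one>\<^bsub>?RF\<^esub>" "?qI (a * a') = ?qI a \<otimes>\<^bsub>?RF\<^esub> ?qI a'" for a a'
    using qI unfolding type_ring_hom_iff by auto
  have qI_h: "?qI (sub (h i)) = ?qI (chi (w i))" for i
  proof -
    have "sub (h i) \<ominus>\<^bsub>?A\<^esub> chi (w i) \<in> I"
      unfolding type_ring_minus F_eq[symmetric] I_def
      by (rule subsetD[OF A.genideal_self]) simp_all
    then show ?thesis
      using A.quotient_eq_iff_same_a_r_cos[OF I, of "sub (h i)" "chi (w i)"] by simp
  qed
  have qI_chi: "?qI (chi (- u)) \<otimes>\<^bsub>?RF\<^esub> ?qI (chi u) = \<one>\<^bsub>?RF\<^esub>" "?qI (chi u) \<otimes>\<^bsub>?RF\<^esub> ?qI (chi (- u)) = \<one>\<^bsub>?RF\<^esub>" for u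
    unfolding qI'(3)[symmetric] chi_add[symmetric] by (simp_all add: chi_0 qI'(2))
  have qI_unit: "?qI (chi u) \<in> Units ?RF" for u
    using qI_chi[of u] qI'(1) unfolding Units_def by blast
  have f1: "(\<lambda>a. ?qI (sub a)) \<in> ring_hom ?L ?RF"
    by (rule ring_hom_comp[OF sub(1) qI])
  have "?qI (sub s) \<in> Units ?RF" if "s \<in> h_powers d b" for s
    by (rule hom_h_powers_Units[OF RF f1 _ that]) (use qI_h qI_unit in \<open>simp add: h_def\<close>)
  \<comment> \<open>Modulo (F) the image of \<open>h i\<close> is the character of
    \<open>w i\<close>, a unit; this is what extends the substitution over the localization.\<close>
  then obtain f where f: "f \<in> ring_hom ?C ?RF" "\<forall>a. f (?to a) = ?qI (sub a)"
    using fractions_hom_exists[OF S RF f1] unfolding complement_ring_def to_complement_ring_def by blast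
  \<comment> \<open>Both sides turn addition of exponents into multiplication, so agreement on unit
    vectors is enough: for \<open>Inl\<close> it is the substitution, for \<open>Inr\<close> it is
    (F).\<close>
  have fE: "f (E r) = ?qI (chi (combination c r))" for r
  proof -
    let ?T = "{r. f (E r) = ?qI (chi (combination c r))}"
    have fc: "f (E r) \<in> carrier ?RF" for r
      using ring_hom_closed[OF f(1) E_closed] .
    have "r \<in> ?T"
    proof (rule additive_set_eq_UNIV)
      show "0 \<in> ?T"
        using ring_hom_one[OF f(1)] by (simp add: E_0 chi_0 qI'(2))
      show "x + y \<in> ?T" if "x \<in> ?T" "y \<in> ?T" for x y
        using that ring_hom_mult[OF f(1) E_closed[of x] E_closed[of y]]
        by (simp add: E_add combination_add chi_add qI'(3))
      show "- x \<in> ?T" if x: "x \<in> ?T" for x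
      proof -
        have "f (E (- x)) \<otimes>\<^bsub>?RF\<^esub> f (E x) = f (E (- x + x))"
          unfolding E_add using ring_hom_mult[OF f(1) E_closed E_closed] by simp
        also have "\<dots> = \<one>\<^bsub>?RF\<^esub>"
          using ring_hom_one[OF f(1)] by (simp add: E_0)
        finally have "f (E (- x)) \<otimes>\<^bsub>?RF\<^esub> ?qI (chi (combination c x)) = \<one>\<^bsub>?RF\<^esub>"
          using x by simp
        then have "f (E (- x)) = ?qI (chi (- combination c x))"
          using qI_chi(2) by (rule RF.inv_unique) (rule qI'(1) fc)+
        then show ?thesis
          by (simp add: combination_minus)
      qed
      show "axis k 1 \<in> ?T" for k
      proof (cases k)
        case (Inl m)
        then show ?thesis
          using f(2) by (simp add: E_Inl \<eta>_def combination_axis c_def sub(3))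
      next
        case (Inr i)
        then show ?thesis
          using f(2) qI_h by (simp add: E_Inr \<theta>_def combination_axis c_def h_def)
      qed
    qed
    then show ?thesis
      by simp
  qed
  have \<rho>0: "combination c (\<rho> j) = 0" for j
  proof -
    have "\<rho> j \<in> linear_relations v w"
      unfolding relations[symmetric] by (rule subsetD[OF zspan_superset rangeI])
    then show ?thesis
      by (simp add: linear_relations_eq c_def)
  qed

  define J where "J = Idl\<^bsub>?C\<^esub> (range (\<lambda>j. G_rational d b (\<rho> j)))"
  have G_closed: "range (\<lambda>j. G_rational d b (\<rho> j)) \<subseteq> carrier ?C"
    using E_closed by (auto simp: G_eq)
  have J: "ideal J ?C"
    unfolding J_def using G_closed by (rule C.genideal_ideal)
  let ?qJ = "\<lambda>a. J +>\<^bsub>?C\<^esub> a"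
  let ?RG = "?C Quot J"
  have RG: "cring ?RG"
    by (rule ideal.quotient_is_cring[OF J C])
  interpret RG: cring ?RG by (rule RG)
  have qJ: "?qJ \<in> ring_hom ?C ?RG"
    by (rule ideal.rcos_ring_hom[OF J])
  have qJc: "?qJ a \<in> carrier ?RG" if "a \<in> carrier ?C" for a
    using ring_hom_closed[OF qJ that] .
  have f_J: "f a = \<zero>\<^bsub>?RF\<^esub>" if "a \<in> J" for a
  proof (rule genideal_kernel[OF C.ring_axioms RF.ring_axioms f(1) G_closed _ that[unfolded J_def]])
    fix e assume "e \<in> range (\<lambda>j. G_rational d b (\<rho> j))"
    then obtain j where e: "e = E (\<rho> j) \<ominus>\<^bsub>?C\<^esub> \<one>\<^bsub>?C\<^esub>"
      by (auto simp: G_eq)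
    then have ec: "e \<in> carrier ?C" and e1: "e \<oplus>\<^bsub>?C\<^esub> \<one>\<^bsub>?C\<^esub> = E (\<rho> j)"
      using E_closed[of "\<rho> j"] by (simp_all add: a_minus_def C.a_assoc C.l_neg)
    have "f e \<oplus>\<^bsub>?RF\<^esub> \<one>\<^bsub>?RF\<^esub> = f (e \<oplus>\<^bsub>?C\<^esub> \<one>\<^bsub>?C\<^esub>)"
      using ring_hom_add[OF f(1) ec C.one_closed] ring_hom_one[OF f(1)] by simp
    also have "\<dots> = \<zero>\<^bsub>?RF\<^esub> \<oplus>\<^bsub>?RF\<^esub> \<one>\<^bsub>?RF\<^esub>"
      unfolding e1 fE \<rho>0 by (simp add: chi_0 qI'(2))
    finally show "f e = \<zero>\<^bsub>?RF\<^esub>"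
      using ring_hom_closed[OF f(1) ec] by (simp only: RF.add.right_cancel RF.zero_closed RF.one_closed)
  qed
  \<comment> \<open>The exponents at which \<open>E\<close> is 1 modulo (G) form a subgroup
    containing the \<open>\<rho> j\<close>. Since these generate all linear relations, every
    relation is trivial in the quotient.\<close>
  have qJ_relation: "?qJ (E r) = \<one>\<^bsub>?RG\<^esub>" if r: "combination c r = 0" for r
  proof -
    let ?T = "{r. ?qJ (E r) = \<one>\<^bsub>?RG\<^esub>}"
    have "zspan (range \<rho>) \<subseteq> ?T"
    proof (rule zspan_subset_subgroup)
      show "range \<rho> \<subseteq> ?T"
      proof clarify
        fix j
        have "E (\<rho> j) \<ominus>\<^bsub>?C\<^esub> \<one>\<^bsub>?C\<^esub> \<in> J"
          unfolding G_eq[symmetric] J_def by (rule subsetD[OF C.genideal_self[OF G_closed]]) simp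
        then show "?qJ (E (\<rho> j)) = \<one>\<^bsub>?RG\<^esub>"
          using C.quotient_eq_iff_same_a_r_cos[OF J E_closed C.one_closed] ring_hom_one[OF qJ] by simp
      qed
      show "0 \<in> ?T"
        using ring_hom_one[OF qJ] by (simp add: E_0)
      show "x + y \<in> ?T" if "x \<in> ?T" "y \<in> ?T" for x y
        using that ring_hom_mult[OF qJ E_closed[of x] E_closed[of y]] by (simp add: E_add)
      show "- x \<in> ?T" if x: "x \<in> ?T" for x
      proof -
        have "?qJ (E (- x)) \<otimes>\<^bsub>?RG\<^esub> ?qJ (E x) = ?qJ (E (- x + x))"
          unfolding E_add using ring_hom_mult[OF qJ E_closed E_closed] by simp
        also have "\<dots> = \<one>\<^bsub>?RG\<^esub>"
          using ring_hom_one[OF qJ] by (simp add: E_0)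
        finally show ?thesis
          using x qJc[OF E_closed[of "- x"]] by simp
      qed
    qed
    moreover have "r \<in> zspan (range \<rho>)"
      using r by (simp add: relations linear_relations_eq c_def)
    ultimately have "r \<in> ?T"
      by (rule subsetD)
    then show ?thesis
      by simp
  qed
  have qJ_cong: "?qJ (E r) = ?qJ (E r')" if "combination c r = combination c r'" for r r'
  proof -
    have "?qJ (E (r - r')) = \<one>\<^bsub>?RG\<^esub>"
      using that by (intro qJ_relation) (simp add: combination_diff)
    then show ?thesis
      using E_add[of "r - r'" r'] ring_hom_mult[OF qJ E_closed[of "r - r'"] E_closed[of r']] qJc[OF E_closed[of r']]
      by simp
  qed
  \<comment> \<open>An arbitrary representation of \<open>u\<close> is chosen; by
    \<open>qJ_cong\<close> the class is the same for all of them, which also makes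
    \<open>\<kappa>\<close> multiplicative.\<close>
  define \<kappa> where "\<kappa> u = ?qJ (E (SOME r. combination c r = u))" for u
  have \<kappa>: "\<kappa> (combination c r) = ?qJ (E r)" for r
    unfolding \<kappa>_def by (intro qJ_cong) (rule someI[of "\<lambda>s. combination c s = combination c r"], rule refl)
  have span: "\<exists>r. u = combination c r" for u
    using span[of u] by (auto simp: c_def)
  have \<kappa>c: "\<kappa> u \<in> carrier ?RG" for u
    unfolding \<kappa>_def by (intro qJc E_closed)
  have \<kappa>0: "\<kappa> 0 = \<one>\<^bsub>?RG\<^esub>"
    using \<kappa>[of 0] ring_hom_one[OF qJ] by (simp add: E_0)
  have \<kappa>add: "\<kappa> (u + u') = \<kappa> u \<otimes>\<^bsub>?RG\<^esub> \<kappa> u'" for u u'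
  proof -
    obtain r r' where u: "u = combination c r" "u' = combination c r'"
      using span[of u] span[of u'] by (elim exE)
    show ?thesis
      unfolding u combination_add[symmetric] \<kappa> E_add using ring_hom_mult[OF qJ E_closed E_closed] .
  qed
  have const_to: "(\<lambda>x. ?qJ (?to (const x))) \<in> ring_hom ring_of_type_algebra ?RG"
    by (rule ring_hom_comp[OF ring_hom_comp[OF const_hom to] qJ])
  obtain g :: "'n laurent \<Rightarrow> _" where g: "g \<in> ring_hom ?A ?RG"
    "\<forall>x. g (const x) = ?qJ (?to (const x))" "\<forall>u. g (chi u) = \<kappa> u"
    by (rule laurent_hom_exists[OF RG const_to, of \<kappa>, OF \<kappa>c \<kappa>0 \<kappa>add])
  \<comment> \<open>On exponents supported on the first summand \<open>E\<close> is the Laurent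
    monomial itself; again it suffices to check unit vectors.\<close>
  have to_chi: "E (\<chi> k. case k of Inl m \<Rightarrow> u $ m | Inr i \<Rightarrow> 0) = ?to (chi u)" (is "E (?inl u) = _") for u :: "int^'l"
  proof -
    let ?T = "{u. E (?inl u) = ?to (chi u)}"
    have inl: "?inl (x + y) = ?inl x + ?inl y" "?inl 0 = 0" "?inl (axis m 1) = axis (Inl m) 1" for x y m
      by (simp_all add: vec_eq_iff axis_def split: sum.split)
    have "u \<in> ?T"
    proof (rule additive_set_eq_UNIV)
      show "0 \<in> ?T"
        unfolding mem_Collect_eq inl by (simp add: E_0 chi_0 to'(2))
      show "x + y \<in> ?T" if "x \<in> ?T" "y \<in> ?T" for x y
        using that unfolding mem_Collect_eq inl by (simp add: E_add chi_add to'(3))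
      show "- x \<in> ?T" if x: "x \<in> ?T" for x
      proof -
        have "E (?inl (- x)) \<otimes>\<^bsub>?C\<^esub> ?to (chi x) = E (?inl (- x)) \<otimes>\<^bsub>?C\<^esub> E (?inl x)"
          using x by simp
        also have "\<dots> = E (?inl (- x + x))"
          unfolding inl(1) E_add ..
        also have "\<dots> = \<one>\<^bsub>?C\<^esub>"
          using inl(2) by (simp only: add.left_inverse E_0)
        finally have 1: "E (?inl (- x)) \<otimes>\<^bsub>?C\<^esub> ?to (chi x) = \<one>\<^bsub>?C\<^esub>" .
        have 2: "?to (chi x) \<otimes>\<^bsub>?C\<^esub> ?to (chi (- x)) = \<one>\<^bsub>?C\<^esub>"
          unfolding to'(3)[symmetric] chi_add[symmetric] by (simp add: chi_0 to'(2))
        have "E (?inl (- x)) = ?to (chi (- x))"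
          using 1 2 by (rule C.inv_unique) (rule to'(1) E_closed)+
        then show ?thesis
          by simp
      qed
      show "axis m 1 \<in> ?T" for m
        unfolding mem_Collect_eq inl by (simp add: E_Inl \<eta>_def)
    qed
    then show ?thesis
      by simp
  qed
  \<comment> \<open>One composite on numerators. Two homomorphisms from Laurent polynomials agree if
    they do so on constants and characters, and a character of exponent \<open>u\<close> is sent to
    the image under \<open>v\<close> of that exponent.\<close>
  have g_sub: "g (sub a) = ?qJ (?to a)" for a
  proof (rule laurent_hom_unique[OF ring_hom_comp[OF sub(1) g(1)] ring_hom_comp[OF to qJ]])
    show "g (sub (const x)) = ?qJ (?to (const x))" for x
      using sub(2) g(2) by simp
    fix u :: "int^'l"
    let ?u = "\<chi> k. case k of Inl m \<Rightarrow> u $ m | Inr i \<Rightarrow> 0"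
    have "combination c ?u = combination v u"
      by (simp add: combination_def c_def sum_UNIV_Plus)
    then show "g (sub (chi u)) = ?qJ (?to (chi u))"
      using \<kappa>[of ?u] sub(3) g(3) by (simp add: to_chi)
  qed
  have g_I: "g a = \<zero>\<^bsub>?RG\<^esub>" if "a \<in> I" for a
  proof (rule genideal_kernel[OF A.ring_axioms RG.ring_axioms g(1) _ _ that[unfolded I_def]])
    fix e assume "e \<in> range (F_laurent d b v w)"
    then obtain i where e: "e = sub (h i) - chi (w i)"
      by (auto simp: F_eq)
    have gc: "g x \<in> carrier ?RG" and ga: "g (x + y) = g x \<oplus>\<^bsub>?RG\<^esub> g y" for x y
      using g(1) by (auto simp: type_ring_hom_iff)
    have "g e \<oplus>\<^bsub>?RG\<^esub> g (chi (w i)) = g (sub (h i))"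
      unfolding ga[symmetric] by (simp add: e)
    also have "\<dots> = ?qJ (E (axis (Inr i) 1))"
      by (simp add: g_sub E_Inr \<theta>_def h_def)
    also have "\<dots> = g (chi (w i))"
      using \<kappa>[of "axis (Inr i) 1"] g(3) by (simp add: combination_axis c_def)
    finally have "g e \<oplus>\<^bsub>?RG\<^esub> g (chi (w i)) = \<zero>\<^bsub>?RG\<^esub> \<oplus>\<^bsub>?RG\<^esub> g (chi (w i))"
      using gc by simp
    then show "g e = \<zero>\<^bsub>?RG\<^esub>"
      using gc by (simp only: RG.add.right_cancel RG.zero_closed)
  qed simp_all

  have C_unique: "g1 x = g2 x"
    if "g1 \<in> ring_hom ?C ?RG" "g2 \<in> ring_hom ?C ?RG" "\<And>a. g1 (?to a) = g2 (?to a)" "x \<in> carrier ?C" for g1 g2 x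
    by (rule fractions_hom_unique[OF S RG, folded complement_ring_def to_complement_ring_def, OF that])
  obtain k where k: "k \<in> ring_iso ?RG ?RF" "\<forall>x\<in>carrier ?C. k (?qJ x) = f x"
  proof (rule quotient_ring_iso[OF A C I J f(1) f_J g(1) g_I])
    fix k assume k: "k \<in> ring_hom ?RF ?RG" "\<forall>a\<in>carrier ?A. k (?qI a) = g a"
    show "\<forall>x\<in>carrier ?C. k (f x) = ?qJ x"
    proof
      fix x assume x: "x \<in> carrier ?C"
      show "k (f x) = ?qJ x"
      proof (rule C_unique[OF ring_hom_comp[OF f(1) k(1)] qJ _ x])
        show "k (f (?to a)) = ?qJ (?to a)" for a
          using f(2) k(2) g_sub by simp
      qed
    qed
  next
    fix k assume k: "k \<in> ring_hom ?RG ?RF" "\<forall>x\<in>carrier ?C. k (?qJ x) = f x"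
    \<comment> \<open>The other composite, again compared on constants and characters. Spanning
      provides the representation of \<open>u\<close> in terms of which \<open>\<kappa>\<close> and
      \<open>fE\<close> evaluate it.\<close>
    have "k (g a) = ?qI a" for a
    proof (rule laurent_hom_unique[OF ring_hom_comp[OF g(1) k(1)] qI])
      show "k (g (const x)) = ?qI (const x)" for x
        using g(2) k(2) f(2) to'(1) sub(2) by simp
      fix u
      obtain r where u: "u = combination c r"
        using span[of u] by (rule exE)
      show "k (g (chi u)) = ?qI (chi u)"
        using g(3) k(2) E_closed by (simp add: u \<kappa> fE)
    qed
    then show "\<forall>a\<in>carrier ?A. k (g a) = ?qI a"
      by blast
  qed
  have "Spec ?RF (\<lambda>x. ?qI (const x)) \<cong>\<^sub>s Spec ?RG (\<lambda>x. ?qJ (?to (const x)))"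
  proof (rule Spec_isomorphic[OF RG RF k(1)])
    show "?qJ (?to (const x)) \<in> carrier ?RG" for x
      by (intro qJc to'(1))
    show "k (?qJ (?to (const x))) = ?qI (const x)" for x
      using k(2) f(2) to'(1) sub(2) by simp
  qed
  then show ?thesis
    unfolding F_scheme_def G_scheme_def closed_subscheme_def I_def[symmetric] J_def[symmetric] .
qed

section \<open>Coefficients and lattice conditions\<close>

text \<open>Exchanging the two sums shows that a vanishing combination of the rows annihilates every
  argument \<open>z\<close> of the forms, so independence of the forms makes the rows
  independent.\<close>

lemma independent_forms_imp_invertible:
  fixes A :: "'a::field^'n^'n"
  assumes indep: "\<And>c :: 'n \<Rightarrow> 'a.
    (\<forall>z :: 'n \<Rightarrow> 'a. (\<Sum>i\<in>UNIV. c i * (\<Sum>k\<in>UNIV. A $ i $ k * z k)) = 0) \<Longrightarrow> \<forall>i. c i = 0"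
  shows "invertible A"
  unfolding invertible_right_inverse matrix_right_invertible_independent_rows
proof (intro allI impI)
  fix c :: "'n \<Rightarrow> 'a" and i
  assume "(\<Sum>i\<in>UNIV. c i *s row i A) = 0"
  then have column: "(\<Sum>i\<in>UNIV. c i * A $ i $ k) = 0" for k
    by (simp add: vec_eq_iff row_def)
  have "(\<Sum>i\<in>UNIV. c i * (\<Sum>k\<in>UNIV. A $ i $ k * z k)) = 0" for z
  proof -
    have "(\<Sum>i\<in>UNIV. c i * (\<Sum>k\<in>UNIV. A $ i $ k * z k)) = (\<Sum>i\<in>UNIV. \<Sum>k\<in>UNIV. c i * A $ i $ k * z k)"
      by (simp add: sum_distrib_left mult.assoc)
    also have "\<dots> = (\<Sum>k\<in>UNIV. \<Sum>i\<in>UNIV. c i * A $ i $ k * z k)"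
      by (rule sum.swap)
    also have "\<dots> = (\<Sum>k\<in>UNIV. (\<Sum>i\<in>UNIV. c i * A $ i $ k) * z k)"
      by (simp add: sum_distrib_right)
    finally show ?thesis
      by (simp add: column)
  qed
  then show "c i = 0"
    using indep[of c] by blast
qed

text \<open>The entrywise conjugate of the inverse is again an inverse.\<close>

lemma matrix_inv_real:
  fixes A :: "complex^'n^'n"
  assumes A: "invertible A" and real: "\<And>i k. A $ i $ k \<in> \<real>"
  shows "matrix_inv A $ i $ k \<in> \<real>"
proof -
  define B where "B = matrix_inv A"
  define B' where "B' = (\<chi> i k. cnj (B $ i $ k))"
  have AB: "A ** B = mat 1" and BA: "B ** A = mat 1"
    using someI_ex[OF A[unfolded invertible_def]] by (simp_all add: B_def matrix_inv_def)
  have "A ** B' = (\<chi> i k. cnj ((A ** B) $ i $ k))"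
    using real by (simp add: matrix_matrix_mult_def B'_def vec_eq_iff Reals_cnj_iff)
  also have "\<dots> = mat 1"
    by (simp add: AB mat_def vec_eq_iff)
  finally have "B ** (A ** B') = B"
    by simp
  then have "B' = B"
    by (simp add: matrix_mul_assoc BA)
  then have "cnj (B $ i $ k) = B $ i $ k"
    by (simp add: B'_def vec_eq_iff)
  then show ?thesis
    by (simp add: B_def Reals_cnj_iff)
qed

text \<open>The product of the individual multiples serves all unit vectors at once; the preimage
  for \<open>k\<close> is scaled by the product of the others.\<close>

lemma common_axis_multiple:
  fixes c :: "'k::finite \<Rightarrow> int^'n::finite"
  assumes "\<And>k. \<exists>D>0. int D *s axis k 1 \<in> range (combination c)"
  obtains N s where "0 < N" "\<forall>k. combination c (s k) = int N *s axis k 1"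
proof -
  have "\<forall>k. \<exists>D. 0 < D \<and> (\<exists>r. combination c r = int D *s axis k 1)"
  proof
    fix k
    obtain D r where "0 < D" "int D *s axis k 1 = combination c r"
      using assms[of k] by (auto simp: image_iff)
    then show "\<exists>D. 0 < D \<and> (\<exists>r. combination c r = int D *s axis k 1)"
      by (intro exI[of _ D] conjI exI[of _ r]) simp_all
  qed
  then obtain D where D: "\<forall>k. 0 < D k \<and> (\<exists>r. combination c r = int (D k) *s axis k 1)"
    by (rule choice[THEN exE])
  then have "\<forall>k. \<exists>r. combination c r = int (D k) *s axis k 1"
    by simp
  then obtain r where r: "\<forall>k. combination c (r k) = int (D k) *s axis k 1"
    by (rule choice[THEN exE])
  define N where "N = (\<Prod>k\<in>UNIV. D k)"
  have "combination c (int (\<Prod>j\<in>UNIV - {k}. D j) *s r k) = int N *s axis k 1" for k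
    using prod.remove[of UNIV k D]
    by (simp add: combination_smult r N_def vec_eq_iff mult_ac)
  moreover have "0 < N"
    using D by (simp add: N_def)
  ultimately show ?thesis
    by (intro that allI)
qed

lemma saturation_add_closed: "0 \<in> saturation S" "x \<in> saturation S \<Longrightarrow> y \<in> saturation S \<Longrightarrow> x + y \<in> saturation S"
proof -
  have "to_real (0 :: int^'a) = 0" "to_real (x + y) = to_real x + to_real y" for x y :: "int^'a"
    by (simp_all add: to_real_def vec_eq_iff)
  then show "0 \<in> saturation S" "x \<in> saturation S \<Longrightarrow> y \<in> saturation S \<Longrightarrow> x + y \<in> saturation S"
    by (simp_all add: saturation_def span_zero span_add)
qed

theorem theorem3p7:
  fixes d :: nat
    and \<psi> :: "int^'l::finite \<Rightarrow> int^'n::finite"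
    and w :: "'n \<Rightarrow> int^'n"
    and a :: "'n \<Rightarrow> int^'l \<Rightarrow> complex"
    and a' :: "complex^'n^'n"
    and \<rho> :: "'l \<Rightarrow> int^('l + 'n)"
  defines "v \<equiv> \<lambda>m. \<psi> (axis m 1)"
    and "A \<equiv> \<psi> ` simplex_points d \<union> range w"
    and "b \<equiv> reduced_coeff a a'"
    and "bR \<equiv> \<lambda>i p. Re (reduced_coeff a a' i p)"
  assumes d_pos: "d > 0"
    and psi_linear: "module_hom (*s) (*s) \<psi>"
    and w_affinely_independent: "inj w" "\<not> affine_dependent (to_real ` range w)"
    and forms_independent:
      "\<And>c :: 'n \<Rightarrow> complex.
        (\<forall>z :: 'n \<Rightarrow> complex. (\<Sum>i\<in>UNIV. c i * (\<Sum>k\<in>UNIV. a' $ i $ k * z k)) = 0) \<Longrightarrow> \<forall>i. c i = 0"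
    and relations: "\<And>j. \<rho> j \<in> linear_relations v w"
    and relations_independent: "inj \<rho>" "\<not> module.dependent (*s) (range \<rho>)"
  shows
    "(zspan A = UNIV \<and> zspan (range \<rho>) = linear_relations v w \<longrightarrow>
        F_scheme d b v w \<cong>\<^sub>s G_scheme d b \<rho>) \<and>
     ((\<forall>i. (\<forall>p\<in>simplex_points d. a i p \<in> \<real>) \<and> (\<forall>k. a' $ i $ k \<in> \<real>)) \<longrightarrow>
        (\<forall>i. \<forall>p\<in>simplex_points d. b i p \<in> \<real>) \<and>
        (odd (lattice_index UNIV (zspan A)) \<and>
         odd (lattice_index (saturation (zspan (range \<rho>))) (zspan (range \<rho>))) \<longrightarrow>
           analytic_subscheme {x. \<forall>i. x $ i \<noteq> 0} (F_real d bR v w) \<cong>\<^sub>s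
           analytic_subscheme {y. (\<forall>m. y $ m \<noteq> 0) \<and> (\<forall>i. h_real d (bR i) y \<noteq> 0)}
             (\<lambda>j. G_real d bR (\<rho> j))) \<and>
        (full_rank_sublattice (zspan A) UNIV \<and>
         full_rank_sublattice (zspan (range \<rho>)) (linear_relations v w) \<longrightarrow>
           analytic_subscheme {x. \<forall>i. 0 < x $ i} (F_real d bR v w) \<cong>\<^sub>s
           analytic_subscheme {y. (\<forall>m. 0 < y $ m) \<and> (\<forall>i. 0 < h_real d (bR i) y)}
             (\<lambda>j. G_real d bR (\<rho> j))))"
proof -
  let ?c = "case_sum v w"
  have A_combination: "zspan A \<subseteq> range (combination ?c)"
    unfolding A_def v_def by (rule zspan_subset_combinations[OF psi_linear])
  have \<rho>0: "combination ?c (\<rho> j) = 0" for j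
    using relations[of j] by (simp add: linear_relations_eq)

  have part1: "F_scheme d b v w \<cong>\<^sub>s G_scheme d b \<rho>"
    if span: "zspan A = UNIV" and basis: "zspan (range \<rho>) = linear_relations v w"
  proof (rule F_scheme_isomorphic_G_scheme[OF _ basis])
    fix u
    have "u \<in> range (combination ?c)"
      by (rule subsetD[OF A_combination]) (simp add: span)
    then show "\<exists>r. combination ?c r = u"
      by (auto simp: image_iff)
  qed

  have real_coeff: "b i p \<in> \<real>"
    if real: "\<forall>i. (\<forall>p\<in>simplex_points d. a i p \<in> \<real>) \<and> (\<forall>k. a' $ i $ k \<in> \<real>)" and p: "p \<in> simplex_points d" for i p
  proof -
    have "matrix_inv a' $ i $ j \<in> \<real>" for j
      using real by (intro matrix_inv_real independent_forms_imp_invertible forms_independent) blast+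
    then show ?thesis
      unfolding b_def reduced_coeff_def using real p by (intro Reals_minus sum_in_Reals Reals_mult) auto
  qed

  have part2: "analytic_subscheme {x. \<forall>i. x $ i \<noteq> 0} (F_real d bR v w) \<cong>\<^sub>s
      analytic_subscheme {y. (\<forall>m. y $ m \<noteq> 0) \<and> (\<forall>i. h_real d (bR i) y \<noteq> 0)} (\<lambda>j. G_real d bR (\<rho> j))"
    if A_odd: "odd (lattice_index UNIV (zspan A))"
      and \<rho>_odd: "odd (lattice_index (saturation (zspan (range \<rho>))) (zspan (range \<rho>)))"
  proof -
    \<comment> \<open>The index annihilates the quotient, so this odd number multiplies every unit
      vector into the span of the exponents.\<close>
    define N where "N = lattice_index UNIV (zspan A)"
    define M where "M = lattice_index (saturation (zspan (range \<rho>))) (zspan (range \<rho>))"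
    have N: "0 < N" "odd N" and M: "0 < M" "odd M"
      using A_odd \<rho>_odd by (simp_all add: N_def M_def odd_pos)
    have "\<forall>k. \<exists>r. combination ?c r = int N *s axis k 1"
    proof
      fix k
      have "int N *s axis k 1 \<in> zspan A"
        unfolding N_def by (rule lattice_index_smult_mem) (simp_all add: zspan_closed)
      then have "int N *s axis k 1 \<in> range (combination ?c)"
        by (rule subsetD[OF A_combination])
      then show "\<exists>r. combination ?c r = int N *s axis k 1"
        by (auto simp: image_iff)
    qed
    then obtain s where s: "\<forall>k. combination ?c (s k) = int N *s axis k 1"
      by (rule choice[THEN exE])
    \<comment> \<open>Some multiple of \<open>r\<close>, of unknown parity, lies in the span of the
      \<open>\<rho> j\<close>; this places \<open>r\<close> in the saturation, and the odd index
      \<open>M\<close> then replaces that multiple.\<close>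
    have M_relation: "int M *s r \<in> zspan (range \<rho>)" if "r \<in> linear_relations v w" for r
    proof -
      have "combination ?c r = 0"
        using that by (simp add: linear_relations_eq)
      then obtain D where "0 < D" "int D *s r \<in> zspan (range \<rho>)"
        using relation_multiple_in_zspan[OF N(1) s[rule_format] \<rho>0 relations_independent] by metis
      then have "r \<in> saturation (zspan (range \<rho>))"
        unfolding saturation_def mem_Collect_eq by (rule multiple_in_imp_span_to_real)
      then show ?thesis
        unfolding M_def by (intro lattice_index_smult_mem saturation_add_closed zspan_closed)
    qed
    have "analytic_subscheme {x. \<forall>i. admissible False (x $ i)} (F_real d bR v w) \<cong>\<^sub>s
      analytic_subscheme {y. (\<forall>m. admissible False (y $ m)) \<and> (\<forall>i. admissible False (h_real d (bR i) y))}
        (\<lambda>j. G_real d bR (\<rho> j))"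
      using M M_relation N(2)
      by (intro real_systems_isomorphic[OF relations N(1) _ s[rule_format]] exI[of _ M]) simp_all
    then show ?thesis
      by (simp add: admissible_def)
  qed

  have part3: "analytic_subscheme {x. \<forall>i. 0 < x $ i} (F_real d bR v w) \<cong>\<^sub>s
      analytic_subscheme {y. (\<forall>m. 0 < y $ m) \<and> (\<forall>i. 0 < h_real d (bR i) y)} (\<lambda>j. G_real d bR (\<rho> j))"
    if full: "full_rank_sublattice (zspan A) UNIV"
  proof -
    have "\<exists>D>0. int D *s axis k 1 \<in> range (combination ?c)" for k
    proof -
      obtain D where "0 < D" "int D *s axis k 1 \<in> zspan A"
        using full unfolding A_def by (rule full_rank_imp_multiple_mem)
      then show ?thesis
        using subsetD[OF A_combination] by (intro exI[of _ D]) simp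
    qed
    \<comment> \<open>No control of parity is required on the positive orthant, where roots of every
      order are available.\<close>
    then obtain N s where N: "0 < N" and s: "\<forall>k. combination ?c (s k) = int N *s axis k 1"
      by (rule common_axis_multiple)
    have M_relation: "\<exists>M>0. (True \<or> odd M) \<and> int M *s r \<in> zspan (range \<rho>)" if "r \<in> linear_relations v w" for r
    proof -
      have "combination ?c r = 0"
        using that by (simp add: linear_relations_eq)
      then obtain D where "0 < D" "int D *s r \<in> zspan (range \<rho>)"
        using relation_multiple_in_zspan[OF N s[rule_format] \<rho>0 relations_independent] by metis
      then show ?thesis
        by (intro exI[of _ D]) simp
    qed
    have "analytic_subscheme {x. \<forall>i. admissible True (x $ i)} (F_real d bR v w) \<cong>\<^sub>s
      analytic_subscheme {y. (\<forall>m. admissible True (y $ m)) \<and> (\<forall>i. admissible True (h_real d (bR i) y))}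
        (\<lambda>j. G_real d bR (\<rho> j))"
      by (rule real_systems_isomorphic[OF relations N _ s[rule_format] M_relation]) simp
    then show ?thesis
      by (simp add: admissible_def)
  qed

  show ?thesis
    using part1 real_coeff part2 part3 by (intro conjI impI allI ballI) simp_all
qed

end
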